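(* Let $p$ be a prime and $B_p$ the quaternion algebra over $\mathbb{Q}$ ramified exactly at $p$ and $\infty$. If $\mathcal{O},\mathcal{O}'$ are maximal orders in $B_p$ with $\theta_{\mathcal{O}}=\theta_{\mathcal{O}'}$, then $\mathcal{O}\simeq\mathcal{O}'$ (as rings).
   Context: $N(x)=x\overline{x}$ denotes the reduced norm on $B_p$, with $\overline{x}$ the canonical involution. For a lattice $\Lambda$ with integral quadratic form $Q$, its theta function is the formal power series $\theta_\Lambda(q)=\sum_{x\in\Lambda}q^{Q(x)}$. For an order $\mathcal{O}\subseteq B_p$, the quadratic form is the norm $N$, so the coefficient of $q^n$ in $\theta_{\mathcal{O}}$ is the number of elements of $\mathcal{O}$ of norm $n$. *)

theory Defs
  imports Main "HOL-Computational_Algebra.Formal_Power_Series"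
begin

text \<open>Elements x0 + x1 i + x2 j + x3 k with i^2 = a, j^2 = b, k = ij = -ji.\<close>

datatype quat = Quat (q0: rat) (q1: rat) (q2: rat) (q3: rat)

instantiation quat :: ab_group_add
begin
definition "0 = Quat 0 0 0 0"
definition "x + y = Quat (q0 x + q0 y) (q1 x + q1 y) (q2 x + q2 y) (q3 x + q3 y)"
definition "- x = Quat (- q0 x) (- q1 x) (- q2 x) (- q3 x)"
definition "x - y = Quat (q0 x - q0 y) (q1 x - q1 y) (q2 x - q2 y) (q3 x - q3 y)"
instance
  by standard (auto simp: zero_quat_def plus_quat_def uminus_quat_def minus_quat_def
                 intro: quat.expand)
end

definition qone :: quat where "qone = Quat 1 0 0 0"

definition qscale :: "rat \<Rightarrow> quat \<Rightarrow> quat" where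
  "qscale c x = Quat (c * q0 x) (c * q1 x) (c * q2 x) (c * q3 x)"

definition qmult :: "int \<Rightarrow> int \<Rightarrow> quat \<Rightarrow> quat \<Rightarrow> quat" where
  "qmult a b x y =
     Quat (q0 x * q0 y + of_int a * q1 x * q1 y + of_int b * q2 x * q2 y
             - of_int (a * b) * q3 x * q3 y)
          (q0 x * q1 y + q1 x * q0 y - of_int b * q2 x * q3 y + of_int b * q3 x * q2 y)
          (q0 x * q2 y + q2 x * q0 y + of_int a * q1 x * q3 y - of_int a * q3 x * q1 y)
          (q0 x * q3 y + q3 x * q0 y + q1 x * q2 y - q2 x * q1 y)"

definition qconj :: "quat \<Rightarrow> quat" where
  "qconj x = Quat (q0 x) (- q1 x) (- q2 x) (- q3 x)"

definition qnorm :: "int \<Rightarrow> int \<Rightarrow> quat \<Rightarrow> rat" where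
  "qnorm a b x = q0 (qmult a b x (qconj x))"

text \<open>(a,b | Q) is ramified at infinity iff the Hilbert symbol (a,b)_R = -1.\<close>
definition ramified_infty :: "int \<Rightarrow> int \<Rightarrow> bool" where
  "ramified_infty a b \<longleftrightarrow> a < 0 \<and> b < 0"

text \<open>Ramified at a prime l iff the Hilbert symbol (a,b)_l = -1, i.e. the conic
  a x^2 + b y^2 = z^2 has no nontrivial solution over Q_l.  Since Q_l is not available,
  we use the equivalent (by compactness of Z_l^3) formulation: for some k there is no
  l-primitive integer solution modulo l^k.\<close>
definition ramified_at :: "int \<Rightarrow> int \<Rightarrow> nat \<Rightarrow> bool" where
  "ramified_at a b l \<longleftrightarrow>
     \<not> (\<forall>k::nat. \<exists>x y z :: int.
            \<not> (int l dvd x \<and> int l dvd y \<and> int l dvd z) \<and>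
            (int l ^ k) dvd (a * x^2 + b * y^2 - z^2))"

definition is_Bp :: "nat \<Rightarrow> int \<Rightarrow> int \<Rightarrow> bool" where
  "is_Bp p a b \<longleftrightarrow> a \<noteq> 0 \<and> b \<noteq> 0 \<and> ramified_infty a b \<and>
     (\<forall>l::nat. prime l \<longrightarrow> (ramified_at a b l \<longleftrightarrow> l = p))"

definition full_lattice :: "quat set \<Rightarrow> bool" where
  "full_lattice L \<longleftrightarrow> (\<exists>e :: nat \<Rightarrow> quat.
      (\<forall>c :: nat \<Rightarrow> rat. (\<Sum>i<4. qscale (c i) (e i)) = 0 \<longrightarrow> (\<forall>i<4. c i = 0)) \<and>
      L = {(\<Sum>i<4. qscale (of_int (n i)) (e i)) | n :: nat \<Rightarrow> int. True})"

definition is_order :: "int \<Rightarrow> int \<Rightarrow> quat set \<Rightarrow> bool" where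
  "is_order a b R \<longleftrightarrow> full_lattice R \<and> qone \<in> R \<and>
     (\<forall>x\<in>R. \<forall>y\<in>R. qmult a b x y \<in> R)"

definition is_maximal_order :: "int \<Rightarrow> int \<Rightarrow> quat set \<Rightarrow> bool" where
  "is_maximal_order a b R \<longleftrightarrow> is_order a b R \<and>
     (\<forall>R'. is_order a b R' \<and> R \<subseteq> R' \<longrightarrow> R' = R)"

definition theta :: "int \<Rightarrow> int \<Rightarrow> quat set \<Rightarrow> nat fps" where
  "theta a b R = Abs_fps (\<lambda>n. card {x \<in> R. qnorm a b x = of_nat n})"

definition ring_iso_orders :: "int \<Rightarrow> int \<Rightarrow> quat set \<Rightarrow> quat set \<Rightarrow> bool" where
  "ring_iso_orders a b R R' \<longleftrightarrow> (\<exists>f. bij_betw f R R' \<and> f qone = qone \<and>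
     (\<forall>x\<in>R. \<forall>y\<in>R. f (x + y) = f x + f y) \<and>
     (\<forall>x\<in>R. \<forall>y\<in>R. f (qmult a b x y) = qmult a b (f x) (f y)))"

end

theory Submission
  imports Defs
begin

text \<open>
  A maximal order R has a basis 1, i, j, k whose multiplication table is governed by an integral ternary
  form f. If a prime l divides the half-discriminant of f and f is isotropic or too degenerate at l, then
  R is contained in an explicit larger order; otherwise f is anisotropic at l, which means that the algebra
  is ramified at l. Hence the half-discriminant is, up to sign, p or 1, and 1 is excluded by positivity.

  The Gross lattice L = {2x - tr x | x in R} therefore has determinant 4p^2, all its 2 x 2 minors
  N(v)N(w) - <v,w>^2 are divisible by 4p, and its norms are 0 or 3 mod 4. The coefficient of q^n in the theta
  function of R is the sum over t of r(4n - t^2), where r(D) is the number of vectors of norm D in L. The minors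
  show that L has at most one pair of vectors of norm 4n if 4n \<le> p; as r(D) is even for D > 0, the theta
  function determines r(D) for all D < p by induction.

  Let D1 \<le> D2 \<le> D3 be the successive minima of L. If D3 < p, they are determined by these numbers r(D), and
  the inner products of a reduced basis are determined up to sign by the congruences modulo p, with the
  determinant fixing the sign of their product. If D3 \<ge> p, then the first two basis vectors span a lattice of
  determinant exactly 4p, which is determined by p and the numbers r(D) with D < p, and the projection of the
  third one to their plane is determined modulo that lattice. So L is determined up to isometry. An isometry of Gross
  lattices, composed with -1 if it reverses the orientation, extends to a ring isomorphism of the orders.
\<close>

section \<open>Quaternion arithmetic\<close>

text \<open>Two obstacles shape the argument. Local statements have to be made without completions:
  anisotropy at l is kept as a property of f modulo l^2, and a descent raises it to every power of
  l, which is the form that meets \<open>ramified_at\<close>. The theta function, in turn, yields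
  for each n only the combination 2 r(4n-1) + r(4n) of two new unknowns; as both are even and r(4n)
  is 0 or 2, the residue modulo 4 separates them, but only while 4n \<le> p. So nothing is known
  about norms from p on, and the case D3 \<ge> p needs another source of information: the
  determinant 4p^2 is comparable to D3 times the minor of the first two basis vectors, so a large D3
  forces this minor down to its least possible value 4p. The minors of L are divisible by 4p because
  its Gram matrix is the adjugate of the Gram matrix of f.\<close>

definition qcomb :: "rat \<Rightarrow> rat \<Rightarrow> rat \<Rightarrow> rat \<Rightarrow> quat \<Rightarrow> quat \<Rightarrow> quat \<Rightarrow> quat" where
  "qcomb n x y z i j k = qscale n qone + qscale x i + qscale y j + qscale z k"

definition qspan :: "quat \<Rightarrow> quat \<Rightarrow> quat \<Rightarrow> quat set" where
  "qspan i j k = {qcomb (of_int n) (of_int x) (of_int y) (of_int z) i j k | n x y z. True}"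

text \<open>The determinant of the imaginary parts only: \<open>qone\<close> always serves as the
  fourth basis vector, so \<open>qdet i j k\<close> is nonzero exactly when 1, i, j, k is a
  basis.\<close>

definition qdet :: "quat \<Rightarrow> quat \<Rightarrow> quat \<Rightarrow> rat" where
  "qdet x y z = q1 x * (q2 y * q3 z - q3 y * q2 z) - q2 x * (q1 y * q3 z - q3 y * q1 z)
              + q3 x * (q1 y * q2 z - q2 y * q1 z)"

text \<open>The polarised norm form on imaginary parts. Real parts are dropped, so
  \<open>qone\<close> lies in the radical and no projection has to be written.\<close>

definition qip :: "int \<Rightarrow> int \<Rightarrow> quat \<Rightarrow> quat \<Rightarrow> rat" where
  "qip a b x y = - of_int a * q1 x * q1 y - of_int b * q2 x * q2 y + of_int a * of_int b * q3 x * q3 y"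

lemmas quat_ops = zero_quat_def plus_quat_def minus_quat_def uminus_quat_def qscale_def qone_def qconj_def

lemma quat_sel [simp]:
  "q0 (x + y) = q0 x + q0 y" "q1 (x + y) = q1 x + q1 y" "q2 (x + y) = q2 x + q2 y" "q3 (x + y) = q3 x + q3 y"
  "q0 (x - y) = q0 x - q0 y" "q1 (x - y) = q1 x - q1 y" "q2 (x - y) = q2 x - q2 y" "q3 (x - y) = q3 x - q3 y"
  "q0 (- x) = - q0 x" "q1 (- x) = - q1 x" "q2 (- x) = - q2 x" "q3 (- x) = - q3 x"
  "q0 0 = 0" "q1 0 = 0" "q2 0 = 0" "q3 0 = 0"
  "q0 qone = 1" "q1 qone = 0" "q2 qone = 0" "q3 qone = 0"
  "q0 (qscale c x) = c * q0 x" "q1 (qscale c x) = c * q1 x" "q2 (qscale c x) = c * q2 x" "q3 (qscale c x) = c * q3 x"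
  "q0 (qconj x) = q0 x" "q1 (qconj x) = - q1 x" "q2 (qconj x) = - q2 x" "q3 (qconj x) = - q3 x"
  by (simp_all add: quat_ops)

lemma quat_eqI:
  "q0 x = q0 y \<Longrightarrow> q1 x = q1 y \<Longrightarrow> q2 x = q2 y \<Longrightarrow> q3 x = q3 y \<Longrightarrow> x = y"
  by (rule quat.expand) simp

lemma qcomb_sel [simp]:
  "q0 (qcomb n x y z i j k) = n + x * q0 i + y * q0 j + z * q0 k"
  "q1 (qcomb n x y z i j k) = x * q1 i + y * q1 j + z * q1 k"
  "q2 (qcomb n x y z i j k) = x * q2 i + y * q2 j + z * q2 k"
  "q3 (qcomb n x y z i j k) = x * q3 i + y * q3 j + z * q3 k"
  by (simp_all add: qcomb_def)

lemma qmult_sel: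
  "q0 (qmult a b x y) = q0 x * q0 y + of_int a * q1 x * q1 y + of_int b * q2 x * q2 y
             - of_int a * of_int b * q3 x * q3 y"
  "q1 (qmult a b x y) = q0 x * q1 y + q1 x * q0 y - of_int b * q2 x * q3 y + of_int b * q3 x * q2 y"
  "q2 (qmult a b x y) = q0 x * q2 y + q2 x * q0 y + of_int a * q1 x * q3 y - of_int a * q3 x * q1 y"
  "q3 (qmult a b x y) = q0 x * q3 y + q3 x * q0 y + q1 x * q2 y - q2 x * q1 y"
  by (simp_all add: qmult_def)

lemma qmult_assoc: "qmult a b (qmult a b x y) z = qmult a b x (qmult a b y z)"
  by (rule quat_eqI) (simp_all add: qmult_sel algebra_simps)

lemma qmult_distrib:
  "qmult a b (x + y) z = qmult a b x z + qmult a b y z"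
  "qmult a b x (y + z) = qmult a b x y + qmult a b x z"
  by (rule quat_eqI; simp add: qmult_sel algebra_simps)+

lemma qmult_scale:
  "qmult a b (qscale c x) y = qscale c (qmult a b x y)"
  "qmult a b x (qscale c y) = qscale c (qmult a b x y)"
  by (rule quat_eqI; simp add: qmult_sel algebra_simps)+

lemma qmult_one [simp]: "qmult a b qone x = x" "qmult a b x qone = x"
  by (rule quat_eqI; simp add: qmult_sel)+

lemma qconj_mult: "qconj (qmult a b x y) = qmult a b (qconj y) (qconj x)"
  by (rule quat_eqI) (simp_all add: qmult_sel algebra_simps)

lemma qconj_conj [simp]: "qconj (qconj x) = x"
  by (rule quat_eqI) simp_all

lemma qnorm_eq: "qnorm a b x = q0 x ^ 2 + qip a b x x"
  by (simp add: qnorm_def qmult_sel qip_def power2_eq_square algebra_simps)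

lemma qmult_conj: "qmult a b x (qconj x) = qscale (qnorm a b x) qone"
  "qmult a b (qconj x) x = qscale (qnorm a b x) qone"
  by (rule quat_eqI; simp add: qmult_sel qnorm_eq qip_def power2_eq_square algebra_simps)+

lemma qnorm_mult: "qnorm a b (qmult a b x y) = qnorm a b x * qnorm a b y"
  by (simp add: qnorm_eq qmult_sel qip_def power2_eq_square algebra_simps)

lemma qmult_self: "qmult a b x x = qscale (2 * q0 x) x - qscale (qnorm a b x) qone"
  by (rule quat_eqI) (simp_all add: qmult_sel qnorm_eq qip_def power2_eq_square algebra_simps)

lemma qnorm_conj [simp]: "qnorm a b (qconj x) = qnorm a b x"
  by (simp add: qnorm_eq qip_def)

lemma qip_pos:
  assumes "a < 0" "b < 0"
  shows "qip a b x x \<ge> 0" "qip a b x x = 0 \<longleftrightarrow> q1 x = 0 \<and> q2 x = 0 \<and> q3 x = 0"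
proof -
  define A B C where "A = - (of_int a :: rat)" "B = - (of_int b :: rat)" "C = (of_int a :: rat) * of_int b"
  have p: "A > 0" "B > 0" "C > 0" using assms by (auto simp: A_B_C_def mult_neg_neg)
  have e: "qip a b x x = A * (q1 x)^2 + B * (q2 x)^2 + C * (q3 x)^2"
    by (simp add: qip_def A_B_C_def power2_eq_square)
  show "qip a b x x \<ge> 0" using p by (simp add: e)
  have "A * (q1 x)^2 \<ge> 0" "B * (q2 x)^2 \<ge> 0" "C * (q3 x)^2 \<ge> 0" using p by auto
  then show "qip a b x x = 0 \<longleftrightarrow> q1 x = 0 \<and> q2 x = 0 \<and> q3 x = 0"
    unfolding e using p by (auto simp: add_nonneg_eq_0_iff)
qed

lemma qnorm_pos:
  assumes "a < 0" "b < 0" "x \<noteq> 0"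
  shows "qnorm a b x > 0"
proof -
  have "qnorm a b x \<noteq> 0"
  proof
    assume "qnorm a b x = 0"
    then have "q0 x ^ 2 = 0" "qip a b x x = 0"
      using qip_pos(1)[OF assms(1,2), of x] by (auto simp: qnorm_eq add_nonneg_eq_0_iff)
    then show False using assms qip_pos(2)[OF assms(1,2), of x] by (auto intro: quat_eqI)
  qed
  moreover have "qnorm a b x \<ge> 0"
    using qip_pos(1)[OF assms(1,2), of x] by (simp add: qnorm_eq)
  ultimately show ?thesis by simp
qed

lemma qcomb_eq_iff:
  assumes "qdet i j k \<noteq> 0"
  shows "qcomb n x y z i j k = qcomb n' x' y' z' i j k \<longleftrightarrow> n = n' \<and> x = x' \<and> y = y' \<and> z = z'"
proof
  assume e: "qcomb n x y z i j k = qcomb n' x' y' z' i j k"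
  define X Y Z where "X = x - x'" "Y = y - y'" "Z = z - z'"
  have c1: "X * q1 i + Y * q1 j + Z * q1 k = 0"
    using arg_cong[OF e, of q1] by (simp add: X_Y_Z_def algebra_simps)
  have c2: "X * q2 i + Y * q2 j + Z * q2 k = 0"
    using arg_cong[OF e, of q2] by (simp add: X_Y_Z_def algebra_simps)
  have c3: "X * q3 i + Y * q3 j + Z * q3 k = 0"
    using arg_cong[OF e, of q3] by (simp add: X_Y_Z_def algebra_simps)
  \<comment> \<open>Cramer's rule, as a polynomial identity.\<close>
  have "X * qdet i j k = 0" "Y * qdet i j k = 0" "Z * qdet i j k = 0"
    using c1 c2 c3 unfolding qdet_def by algebra+
  then have "X = 0" "Y = 0" "Z = 0" using assms by auto
  moreover have "n + x * q0 i + y * q0 j + z * q0 k = n' + x' * q0 i + y' * q0 j + z' * q0 k"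
    using arg_cong[OF e, of q0] by simp
  ultimately show "n = n' \<and> x = x' \<and> y = y' \<and> z = z'" by (simp add: X_Y_Z_def)
qed auto

lemma qcomb_in_qspan:
  assumes "qdet i j k \<noteq> 0"
  shows "qcomb n x y z i j k \<in> qspan i j k \<longleftrightarrow> n \<in> \<int> \<and> x \<in> \<int> \<and> y \<in> \<int> \<and> z \<in> \<int>"
proof
  assume "qcomb n x y z i j k \<in> qspan i j k"
  then obtain n' x' y' z' where
    "qcomb n x y z i j k = qcomb (of_int n') (of_int x') (of_int y') (of_int z') i j k"
    by (auto simp: qspan_def)
  then show "n \<in> \<int> \<and> x \<in> \<int> \<and> y \<in> \<int> \<and> z \<in> \<int>" by (simp add: qcomb_eq_iff[OF assms])
next
  assume "n \<in> \<int> \<and> x \<in> \<int> \<and> y \<in> \<int> \<and> z \<in> \<int>"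
  then show "qcomb n x y z i j k \<in> qspan i j k"
    unfolding qspan_def by (auto elim!: Ints_cases) 
qed

lemma qcomb_exists:
  assumes "qdet i j k \<noteq> 0"
  obtains n x y z where "q = qcomb n x y z i j k"
proof -
  define d where "d = qdet i j k"
  define x y z where "x = qdet q j k / d" "y = qdet i q k / d" "z = qdet i j q / d"
  define n where "n = q0 q - x * q0 i - y * q0 j - z * q0 k"
  have nz: "d \<noteq> 0" using assms d_def by simp
  have e: "x * d = qdet q j k" "y * d = qdet i q k" "z * d = qdet i j q"
    using nz by (simp_all add: x_y_z_def)
  have "q1 q * d = (x * q1 i + y * q1 j + z * q1 k) * d"
       "q2 q * d = (x * q2 i + y * q2 j + z * q2 k) * d"
       "q3 q * d = (x * q3 i + y * q3 j + z * q3 k) * d"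
    using e unfolding d_def qdet_def by algebra+
  then have "q1 q = x * q1 i + y * q1 j + z * q1 k"
       "q2 q = x * q2 i + y * q2 j + z * q2 k"
       "q3 q = x * q3 i + y * q3 j + z * q3 k" using nz by simp_all
  then have "q = qcomb n x y z i j k" by (intro quat_eqI) (simp_all add: n_def)
  then show ?thesis by (rule that)
qed

text \<open>On imaginary parts the form is diagonal with entries -a, -b, ab, whose product is
  (ab)^2.\<close>

lemma qip_gram_det:
  "qip a b x x * qip a b y y * qip a b z z + 2 * qip a b x y * qip a b x z * qip a b y z
     - qip a b x x * (qip a b y z)^2 - qip a b y y * (qip a b x z)^2 - qip a b z z * (qip a b x y)^2
   = (of_int a * of_int b * qdet x y z)^2"
  by (simp add: qip_def qdet_def power2_eq_square algebra_simps)

section \<open>Lattices and orders\<close>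

lemma sum_lt_4: "(\<Sum>i<4. f i) = f 0 + f 1 + f 2 + f (3::nat)" for f :: "nat \<Rightarrow> 'a::comm_monoid_add"
  by (simp add: eval_nat_numeral lessThan_Suc add_ac)

lemma full_lattice_qspan:
  assumes "qdet i j k \<noteq> 0"
  shows "full_lattice (qspan i j k)"
proof -
  define e where "e = (\<lambda>n::nat. [qone, i, j, k] ! n)"
  have e: "e 0 = qone" "e 1 = i" "e 2 = j" "e 3 = k" by (simp_all add: e_def numeral_eq_Suc)
  have s: "(\<Sum>l<4. qscale (c l) (e l)) = qcomb (c 0) (c 1) (c 2) (c 3) i j k" for c :: "nat \<Rightarrow> rat"
    by (simp only: sum_lt_4 e qcomb_def)
  have z: "0 = qcomb 0 0 0 0 i j k" by (rule quat_eqI) simp_all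
  show ?thesis unfolding full_lattice_def
  proof (intro exI[of _ e] conjI allI impI)
    fix c :: "nat \<Rightarrow> rat" and l :: nat
    assume "(\<Sum>l<4. qscale (c l) (e l)) = 0" "l < 4"
    then have "c 0 = 0" "c 1 = 0" "c 2 = 0" "c 3 = 0"
      unfolding s z qcomb_eq_iff[OF assms] by auto
    moreover have "l = 0 \<or> l = 1 \<or> l = 2 \<or> l = 3" using \<open>l < 4\<close> by auto
    ultimately show "c l = 0" by auto
  next
    show "qspan i j k = {\<Sum>l<4. qscale (of_int (n l)) (e l) | n. True}" (is "_ = ?S")
    proof
      show "?S \<subseteq> qspan i j k" by (auto simp: s[of "\<lambda>l. of_int (_ l)"] qspan_def)
      show "qspan i j k \<subseteq> ?S"
      proof
        fix v assume "v \<in> qspan i j k"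
        then obtain n x y z where v: "v = qcomb (of_int n) (of_int x) (of_int y) (of_int z) i j k"
          by (auto simp: qspan_def)
        define f where "f = (\<lambda>m::nat. [n, x, y, z] ! m)"
        have "f 0 = n" "f 1 = x" "f 2 = y" "f 3 = z" by (simp_all add: f_def numeral_eq_Suc)
        then have "v = (\<Sum>l<4. qscale (of_int (f l)) (e l))"
          by (simp only: s[of "\<lambda>l. of_int (f l)"] v)
        then show "v \<in> ?S" by blast
      qed
    qed
  qed
qed

lemma common_denominator:
  fixes S :: "rat set"
  assumes "finite S"
  shows "\<exists>m::int. m > 0 \<and> (\<forall>s\<in>S. of_int m * s \<in> \<int>)"
  using assms
proof (induction S)
  case empty then show ?case by (intro exI[of _ 1]) auto
next
  case (insert s S)
  then obtain m :: int where m: "m > 0" "\<forall>s\<in>S. of_int m * s \<in> \<int>" by auto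
  obtain u d where "quotient_of s = (u, d)" by fastforce
  then have s: "s = of_int u / of_int d" "d > 0"
    by (auto dest: quotient_of_div quotient_of_denom_pos)
  then have "of_int d * s = of_int u" by simp
  then have 1: "of_int (m * d) * s = of_int (m * u)" by simp
  have "of_int (m * d) * t = of_int d * (of_int m * t)" for t :: rat by simp
  then have "\<forall>t\<in>S. of_int (m * d) * t \<in> \<int>" using m(2) by (metis Ints_mult Ints_of_int)
  with 1 show ?case using m s
    by (intro exI[of _ "m * d"]) (auto simp del: of_int_mult)
qed

section \<open>Lattices inside the four-dimensional rational vector space of quaternions\<close>

interpretation quatvs: vector_space qscale
  by standard (rule quat_eqI; simp add: algebra_simps)+

interpretation quatvs: finite_dimensional_vector_space qscale "{Quat 1 0 0 0, Quat 0 1 0 0, Quat 0 0 1 0, Quat 0 0 0 1}"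
proof
  let ?B = "{Quat 1 0 0 0, Quat 0 1 0 0, Quat 0 0 1 0, Quat 0 0 0 1}"
  show "finite ?B" by simp
  show "\<not> quatvs.dependent ?B"
    unfolding quatvs.dependent_finite[OF \<open>finite ?B\<close>]
    by (auto simp: quat_ops)
  show "quatvs.span ?B = UNIV"
  proof -
    have "v \<in> quatvs.span ?B" for v
    proof -
      have "v = qscale (q0 v) (Quat 1 0 0 0) + qscale (q1 v) (Quat 0 1 0 0)
              + qscale (q2 v) (Quat 0 0 1 0) + qscale (q3 v) (Quat 0 0 0 1)"
        by (rule quat_eqI) simp_all
      also have "\<dots> \<in> quatvs.span ?B"
        by (intro quatvs.span_add quatvs.span_scale quatvs.span_base) auto
      finally show ?thesis .
    qed
    then show ?thesis by blast
  qed
qed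

text \<open>\<open>full_lattice\<close> asserts only independence; that four vectors also span comes
  from the dimension. Spanning is needed to find multiples of the unit vectors inside a
  lattice.\<close>

lemma independent_quadruple_spans:
  fixes e :: "nat \<Rightarrow> quat"
  assumes ind: "\<And>c :: nat \<Rightarrow> rat. (\<Sum>i<4. qscale (c i) (e i)) = 0 \<Longrightarrow> \<forall>i<4. c i = 0"
  shows "\<exists>c. v = (\<Sum>i<4. qscale (c i) (e i))"
proof -
  have inj: "inj_on e {..<4}"
  proof (rule inj_onI, rule ccontr)
    fix x y assume xy: "x \<in> {..<4}" "y \<in> {..<4}" "e x = e y" "x \<noteq> y"
    define c where "c = (\<lambda>i. if i = x then 1 else if i = y then -1 else 0 :: rat)"
    have "(\<Sum>i<4. qscale (c i) (e i)) = (\<Sum>i\<in>{x, y}. qscale (c i) (e i))"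
      using xy by (intro sum.mono_neutral_right) (auto simp: c_def)
    also have "\<dots> = qscale 1 (e x) + qscale (-1) (e x)" using xy by (simp add: c_def)
    also have "\<dots> = 0" by (rule quat_eqI) simp_all
    finally have "c x = 0" using ind xy by auto
    then show False by (simp add: c_def)
  qed
  let ?E = "e ` {..<4}"
  have indep: "quatvs.independent ?E"
  proof
    assume "quatvs.dependent ?E"
    then obtain u where u: "\<exists>v\<in>?E. u v \<noteq> 0" "(\<Sum>v\<in>?E. qscale (u v) v) = 0"
      by (auto simp: quatvs.dependent_finite)
    have "(\<Sum>i<4. qscale ((u \<circ> e) i) (e i)) = 0"
      using u(2) by (simp add: sum.reindex[OF inj])
    then have "\<forall>i<4. (u \<circ> e) i = 0" by (rule ind)
    then show False using u(1) by auto
  qed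
  have "card ?E = 4" using card_image[OF inj] by simp
  moreover have "quatvs.dimension = 4"
    unfolding quatvs.dimension_def by simp
  ultimately have "quatvs.span ?E = UNIV"
    using quatvs.card_ge_dim_independent[of ?E UNIV] indep
    by (auto simp: quatvs.dim_UNIV)
  then have "v \<in> quatvs.span ?E" by simp
  then obtain u where "v = (\<Sum>w\<in>?E. qscale (u w) w)"
    by (auto simp: quatvs.span_finite)
  then have "v = (\<Sum>i<4. qscale ((u \<circ> e) i) (e i))"
    by (simp add: sum.reindex[OF inj])
  then show ?thesis by blast
qed

text \<open>Squeezes the lattice between m Z^4 and (1/m) Z^4, with one m for both inclusions, and
  records that it is a group. This form suits arguments that do not refer to a basis.\<close>

lemma full_latticeE:
  assumes "full_lattice L"
  obtains m :: int where "m > 0"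
    "\<And>x. x \<in> L \<Longrightarrow> of_int m * q0 x \<in> \<int> \<and> of_int m * q1 x \<in> \<int> \<and> of_int m * q2 x \<in> \<int> \<and> of_int m * q3 x \<in> \<int>"
    "\<And>x0 x1 x2 x3 :: int. qscale (of_int m) (Quat (of_int x0) (of_int x1) (of_int x2) (of_int x3)) \<in> L"
    "\<And>x y. x \<in> L \<Longrightarrow> y \<in> L \<Longrightarrow> x + y \<in> L" "\<And>x y. x \<in> L \<Longrightarrow> y \<in> L \<Longrightarrow> x - y \<in> L"
    "\<And>x (n::int). x \<in> L \<Longrightarrow> qscale (of_int n) x \<in> L"
proof -
  obtain e where ind: "\<And>c :: nat \<Rightarrow> rat. (\<Sum>i<4. qscale (c i) (e i)) = 0 \<Longrightarrow> \<forall>i<4. c i = 0"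
    and L: "L = {(\<Sum>i<4. qscale (of_int (n i)) (e i)) | n :: nat \<Rightarrow> int. True}"
    using assms unfolding full_lattice_def by blast
  have add: "x + y \<in> L" if "x \<in> L" "y \<in> L" for x y
  proof -
    from that obtain n n' where "x = (\<Sum>i<4. qscale (of_int (n i)) (e i))" "y = (\<Sum>i<4. qscale (of_int (n' i)) (e i))"
      unfolding L by auto
    then have "x + y = (\<Sum>i<4. qscale (of_int (n i + n' i)) (e i))"
      by (simp add: quatvs.scale_left_distrib sum.distrib)
    then show ?thesis unfolding L by (auto intro!: exI[of _ "\<lambda>i. n i + n' i"])
  qed
  have scale: "qscale (of_int m) x \<in> L" if "x \<in> L" for x and m :: int
  proof -
    from that obtain n where "x = (\<Sum>i<4. qscale (of_int (n i)) (e i))"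
      unfolding L by auto
    then have "qscale (of_int m) x = (\<Sum>i<4. qscale (of_int (m * n i)) (e i))"
      by (simp add: quatvs.scale_sum_right)
    then show ?thesis unfolding L by (auto intro!: exI[of _ "\<lambda>i. m * n i"])
  qed
  have diff: "x - y \<in> L" if "x \<in> L" "y \<in> L" for x y
  proof -
    have "x - y = x + qscale (of_int (-1)) y" by (rule quat_eqI) simp_all
    then show ?thesis using add scale that by metis
  qed
  let ?S = "q0 ` e ` {..<4} \<union> q1 ` e ` {..<4} \<union> q2 ` e ` {..<4} \<union> q3 ` e ` {..<4}"
  have "finite ?S" by simp
  from common_denominator[OF this] obtain m :: int
    where m: "m > 0" "\<forall>s\<in>?S. of_int m * s \<in> \<int>" by (elim exE conjE)
  have den: "of_int m * q0 x \<in> \<int> \<and> of_int m * q1 x \<in> \<int> \<and> of_int m * q2 x \<in> \<int> \<and> of_int m * q3 x \<in> \<int>" if "x \<in> L" for x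
  proof -
    from that obtain n where x: "x = (\<Sum>i<4. qscale (of_int (n i)) (e i))"
      unfolding L by auto
    have I: "of_int m * (of_int z * s) \<in> \<int>" if "s \<in> ?S" for s and z :: int
    proof -
      have "of_int m * (of_int z * s) = of_int z * (of_int m * s)" by simp
      then show ?thesis using m(2)[rule_format, OF that] by (metis Ints_mult Ints_of_int)
    qed
    show ?thesis unfolding x sum_lt_4
      by (simp add: distrib_left) (intro conjI Ints_add I; simp)
  qed
  have ex: "\<exists>k::int. k > 0 \<and> qscale (of_int k) v \<in> L" for v
  proof -
    obtain c where c: "v = (\<Sum>i<4. qscale (c i) (e i))"
      using independent_quadruple_spans[OF ind] by blast
    have "finite (c ` {..<4})" by simp
    from common_denominator[OF this] obtain k :: int
      where k: "k > 0" "\<forall>s\<in>c ` {..<4}. of_int k * s \<in> \<int>" by (elim exE conjE)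
    define n where "n = (\<lambda>i. \<lfloor>of_int k * c i\<rfloor>)"
    have n: "of_int (n i) = of_int k * c i" if "i < 4" for i
      using k(2)[rule_format, of "c i"] that by (auto simp add: n_def elim!: Ints_cases)
    have "qscale (of_int k) v = (\<Sum>i<4. qscale (of_int (n i)) (e i))"
      by (simp add: c quatvs.scale_sum_right n)
    then show ?thesis using k(1) unfolding L by blast
  qed
  obtain k0 :: int where k0: "k0 > 0" "qscale (of_int k0) (Quat 1 0 0 0) \<in> L" using ex by blast
  obtain k1 :: int where k1: "k1 > 0" "qscale (of_int k1) (Quat 0 1 0 0) \<in> L" using ex by blast
  obtain k2 :: int where k2: "k2 > 0" "qscale (of_int k2) (Quat 0 0 1 0) \<in> L" using ex by blast
  obtain k3 :: int where k3: "k3 > 0" "qscale (of_int k3) (Quat 0 0 0 1) \<in> L" using ex by blast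
  define M where "M = m * k0 * k1 * k2 * k3"
  have M: "M > 0" using m k0 k1 k2 k3 by (simp add: M_def)
  have 1: "qscale (of_int M) (Quat (of_int x0) (of_int x1) (of_int x2) (of_int x3)) \<in> L" for x0 x1 x2 x3 :: int
  proof -
    have "qscale (of_int M) (Quat (of_int x0) (of_int x1) (of_int x2) (of_int x3)) =
       qscale (of_int (m * k1 * k2 * k3 * x0)) (qscale (of_int k0) (Quat 1 0 0 0)) +
       qscale (of_int (m * k0 * k2 * k3 * x1)) (qscale (of_int k1) (Quat 0 1 0 0)) +
       qscale (of_int (m * k0 * k1 * k3 * x2)) (qscale (of_int k2) (Quat 0 0 1 0)) +
       qscale (of_int (m * k0 * k1 * k2 * x3)) (qscale (of_int k3) (Quat 0 0 0 1))"
      by (rule quat_eqI) (simp_all add: M_def)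
    also have "\<dots> \<in> L" by (intro add scale k0 k1 k2 k3)
    finally show ?thesis .
  qed
  have 2: "of_int M * s \<in> \<int>" if "of_int m * s \<in> \<int>" for s :: rat
  proof -
    have "of_int M * s = of_int (k0 * k1 * k2 * k3) * (of_int m * s)" by (simp add: M_def)
    then show ?thesis using that by (metis Ints_mult Ints_of_int)
  qed
  show ?thesis
  proof (rule that[OF M])
    fix x assume "x \<in> L"
    then show "of_int M * q0 x \<in> \<int> \<and> of_int M * q1 x \<in> \<int> \<and> of_int M * q2 x \<in> \<int> \<and> of_int M * q3 x \<in> \<int>"
      using den 2 by simp
  qed (fact 1 add diff scale)+
qed

text \<open>The least positive element generates, by division with remainder; it exists because
  bounded denominators make all elements integers after scaling by m.\<close>

lemma discrete_subgroup_rat: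
  fixes H :: "rat set" and m :: int
  assumes "m > 0" and den: "\<And>h. h \<in> H \<Longrightarrow> of_int m * h \<in> \<int>"
    and diff: "\<And>x y. x \<in> H \<Longrightarrow> y \<in> H \<Longrightarrow> x - y \<in> H" and "h0 \<in> H" "h0 > 0"
    and scale: "\<And>x (n::int). x \<in> H \<Longrightarrow> of_int n * x \<in> H"
  obtains d where "d \<in> H" "d > 0" "\<And>h. h \<in> H \<Longrightarrow> \<exists>n::int. h = of_int n * d"
proof -
  obtain d where d: "d \<in> H" "d > 0"
    and min: "\<And>y. y \<in> H \<and> y > 0 \<Longrightarrow> nat \<lfloor>of_int m * d\<rfloor> \<le> nat \<lfloor>of_int m * y\<rfloor>"
    using ex_has_least_nat[of "\<lambda>y. y \<in> H \<and> y > 0" h0 "\<lambda>y. nat \<lfloor>of_int m * y\<rfloor>"] assms(4,5) by blast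
  show ?thesis
  proof (rule that[OF d])
    fix h assume h: "h \<in> H"
    define n where "n = \<lfloor>h / d\<rfloor>"
    define r where "r = h - of_int n * d"
    have "of_int n \<le> h / d" "h / d < of_int n + 1" unfolding n_def by (rule of_int_floor_le, rule floor_correct[THEN conjunct2, unfolded of_int_add of_int_1])
    then have r: "0 \<le> r" "r < d" using d by (auto simp: r_def field_simps)
    have rH: "r \<in> H" using diff[OF h scale[OF d(1)]] by (simp add: r_def)
    have "r = 0"
    proof (rule ccontr)
      assume "r \<noteq> 0"
      then have "nat \<lfloor>of_int m * d\<rfloor> \<le> nat \<lfloor>of_int m * r\<rfloor>" using min rH r by auto
      moreover obtain u v where uv: "of_int m * r = of_int u" "of_int m * d = of_int v"
        using den[OF rH] den[OF d(1)] by (auto elim!: Ints_cases)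
      ultimately have "nat v \<le> nat u" by simp
      moreover have "of_int m * r < of_int m * d" using r \<open>m > 0\<close> by simp
      moreover have "of_int m * r \<ge> 0" using r \<open>m > 0\<close> by simp
      ultimately show False using uv by simp
    qed
    then show "\<exists>n::int. h = of_int n * d" by (auto simp: r_def)
  qed
qed

text \<open>Hermite normal form: elements with vanishing last coordinates form a chain of subgroups,
  and on each of them the next coordinate takes values in an infinite cyclic group. The smallest
  member of the chain is R \<inter> Q, which has to be generated by 1.\<close>

lemma order_basis:
  assumes "is_order a b R"
  obtains i j k where "R = qspan i j k" "qdet i j k \<noteq> 0"
proof -
  have fl: "full_lattice R" and one: "qone \<in> R" and mult: "\<And>x y. x \<in> R \<Longrightarrow> y \<in> R \<Longrightarrow> qmult a b x y \<in> R"
    using assms by (auto simp: is_order_def)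
  from fl obtain m :: int where m: "m > 0"
    "\<And>x. x \<in> R \<Longrightarrow> of_int m * q0 x \<in> \<int> \<and> of_int m * q1 x \<in> \<int> \<and> of_int m * q2 x \<in> \<int> \<and> of_int m * q3 x \<in> \<int>"
    "\<And>x0 x1 x2 x3 :: int. qscale (of_int m) (Quat (of_int x0) (of_int x1) (of_int x2) (of_int x3)) \<in> R"
    and add: "\<And>x y. x \<in> R \<Longrightarrow> y \<in> R \<Longrightarrow> x + y \<in> R" and diff: "\<And>x y. x \<in> R \<Longrightarrow> y \<in> R \<Longrightarrow> x - y \<in> R"
    and scale: "\<And>x (n::int). x \<in> R \<Longrightarrow> qscale (of_int n) x \<in> R"
    by (rule full_latticeE) metis
  let ?R2 = "{x \<in> R. q3 x = 0}" let ?R1 = "{x \<in> R. q3 x = 0 \<and> q2 x = 0}"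
  let ?R0 = "{x \<in> R. q3 x = 0 \<and> q2 x = 0 \<and> q1 x = 0}"
  note e3 = m(3)[of 0 0 0 1] and e2 = m(3)[of 0 0 1 0] and e1 = m(3)[of 0 1 0 0]
  have gen: "\<exists>x\<in>S. f x > 0 \<and> (\<forall>y\<in>S. \<exists>n::int. f y = of_int n * f x)"
    if S: "S \<subseteq> R" "\<And>x y. x \<in> S \<Longrightarrow> y \<in> S \<Longrightarrow> x - y \<in> S" "\<And>x (n::int). x \<in> S \<Longrightarrow> qscale (of_int n) x \<in> S"
      and f: "\<And>x y. f (x - y) = f x - f y" "\<And>x n. f (qscale n x) = n * f x"
        "\<And>x. x \<in> R \<Longrightarrow> of_int m * f x \<in> \<int>"
      and x0: "x0 \<in> S" "f x0 > 0" for S and f :: "quat \<Rightarrow> rat" and x0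
  proof -
    have 1: "of_int m * h \<in> \<int>" if "h \<in> f ` S" for h
    proof -
      from that obtain u where "u \<in> S" "h = f u" by auto
      then show ?thesis using f(3)[of u] S(1) by auto
    qed
    have 2: "x - y \<in> f ` S" if "x \<in> f ` S" "y \<in> f ` S" for x y
    proof -
      from that obtain u v where "x = f u" "y = f v" "u \<in> S" "v \<in> S" by auto
      then show ?thesis using S(2)[of u v] f(1)[of u v] by (intro image_eqI[of _ _ "u - v"]) auto
    qed
    have 3: "of_int n * x \<in> f ` S" if "x \<in> f ` S" for x and n :: int
    proof -
      from that obtain u where "x = f u" "u \<in> S" by auto
      then show ?thesis using S(3)[of u n] f(2)[of "of_int n" u]
        by (intro image_eqI[of _ _ "qscale (of_int n) u"]) auto
    qed
    have "\<exists>d. d \<in> f ` S \<and> d > 0 \<and> (\<forall>h\<in>f ` S. \<exists>n::int. h = of_int n * d)"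
      by (rule discrete_subgroup_rat[OF m(1) 1 2 imageI[OF x0(1)] x0(2) 3]) auto
    then obtain d where d: "d \<in> f ` S" "d > 0" "\<forall>h\<in>f ` S. \<exists>n::int. h = of_int n * d"
      by (elim exE conjE)
    from d(1) obtain x where x: "x \<in> S" "d = f x" by auto
    show ?thesis
    proof (intro bexI[OF _ x(1)] conjI ballI)
      fix y assume "y \<in> S"
      then show "\<exists>n::int. f y = of_int n * f x" using d(3) x(2) by blast
    qed (use d(2) x(2) in simp)
  qed
  have mp: "(0::rat) < of_int m" using m(1) by simp
  have "\<exists>x\<in>R. q3 x > 0 \<and> (\<forall>y\<in>R. \<exists>n::int. q3 y = of_int n * q3 x)"
    by (rule gen[OF _ _ _ _ _ _ e3]) (use m(2) mp diff scale in auto)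
  then obtain k where k: "k \<in> R" "q3 k > 0" "\<And>y. y \<in> R \<Longrightarrow> \<exists>n::int. q3 y = of_int n * q3 k" by blast
  have "\<exists>x\<in>?R2. q2 x > 0 \<and> (\<forall>y\<in>?R2. \<exists>n::int. q2 y = of_int n * q2 x)"
    by (rule gen[of _ _ "qscale (of_int m) (Quat (of_int 0) (of_int 0) (of_int 1) (of_int 0))"])
       (use m(2) mp diff scale e2 in auto)
  then obtain j where j: "j \<in> ?R2" "q2 j > 0" "\<And>y. y \<in> ?R2 \<Longrightarrow> \<exists>n::int. q2 y = of_int n * q2 j" by blast
  have "\<exists>x\<in>?R1. q1 x > 0 \<and> (\<forall>y\<in>?R1. \<exists>n::int. q1 y = of_int n * q1 x)"
    by (rule gen[of _ _ "qscale (of_int m) (Quat (of_int 0) (of_int 1) (of_int 0) (of_int 0))"])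
       (use m(2) mp diff scale e1 in auto)
  then obtain i where i: "i \<in> ?R1" "q1 i > 0" "\<And>y. y \<in> ?R1 \<Longrightarrow> \<exists>n::int. q1 y = of_int n * q1 i" by blast
  have "\<exists>x\<in>?R0. q0 x > 0 \<and> (\<forall>y\<in>?R0. \<exists>n::int. q0 y = of_int n * q0 x)"
    by (rule gen[of _ _ qone])
       (use m(2) one diff scale in auto)
  then obtain o' where o': "o' \<in> ?R0" "q0 o' > 0" "\<And>y. y \<in> ?R0 \<Longrightarrow> \<exists>n::int. q0 y = of_int n * q0 o'" by blast
  \<comment> \<open>The square of the generator of R \<inter> Q is an integer multiple of it, so the
    generator is an integer; 1 is a multiple as well, so it is 1.\<close>
  have "qmult a b o' o' \<in> ?R0" using o'(1) mult by (auto simp: qmult_sel)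
  then obtain n :: int where "q0 (qmult a b o' o') = of_int n * q0 o'" using o'(3) by blast
  then have n: "q0 o' = of_int n" using o'(1,2) by (simp add: qmult_sel)
  have "qone \<in> ?R0" using one by simp
  then obtain n' :: int where "q0 qone = of_int n' * q0 o'" using o'(3) by blast
  then have "1 = of_int n' * q0 o'" by simp
  then have "n' * n = 1" unfolding n by (metis of_int_1 of_int_eq_iff of_int_mult)
  moreover have "n > 0" using o'(2) unfolding n by simp
  ultimately have "n = 1" by (metis pos_zmult_eq_1_iff mult.commute)
  then have d01: "q0 o' = 1" using n by simp
  have iR: "i \<in> R" "q3 i = 0" "q2 i = 0" and jR: "j \<in> R" "q3 j = 0" using i(1) j(1) by auto
  have det: "qdet i j k \<noteq> 0" using i(2) j(2) k(2) by (simp add: qdet_def iR jR)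
  have "R \<subseteq> qspan i j k"
  proof
    fix x assume x: "x \<in> R"
    then obtain z :: int where z: "q3 x = of_int z * q3 k" using k(3) by blast
    define x' where "x' = x - qscale (of_int z) k"
    have x': "x' \<in> R" "q3 x' = 0" using diff[OF x scale[OF k(1)]] z by (simp_all add: x'_def)
    then obtain y :: int where y: "q2 x' = of_int y * q2 j" using j(3)[of x'] by blast
    define x'' where "x'' = x' - qscale (of_int y) j"
    have x'': "x'' \<in> R" "q3 x'' = 0" "q2 x'' = 0"
      using diff[OF x'(1) scale[OF jR(1)]] x' y by (simp_all add: x''_def jR)
    then obtain w :: int where w: "q1 x'' = of_int w * q1 i" using i(3)[of x''] by blast
    define t where "t = x'' - qscale (of_int w) i"
    have t: "t \<in> R" "q3 t = 0" "q2 t = 0" "q1 t = 0"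
      using diff[OF x''(1) scale[OF iR(1)]] x'' w by (simp_all add: t_def iR)
    then obtain n :: int where "q0 t = of_int n * q0 o'" using o'(3)[of t] by blast
    then have n: "q0 t = of_int n" by (simp add: d01)
    have "t = qscale (of_int n) qone" using t n by (intro quat_eqI) simp_all
    moreover have "x = t + qscale (of_int w) i + qscale (of_int y) j + qscale (of_int z) k"
      by (simp add: t_def x''_def x'_def)
    ultimately have "x = qcomb (of_int n) (of_int w) (of_int y) (of_int z) i j k"
      by (simp only: qcomb_def)
    then show "x \<in> qspan i j k" by (auto simp: qspan_def)
  qed
  moreover have "qspan i j k \<subseteq> R"
    unfolding qspan_def qcomb_def using add scale one iR(1) jR(1) k(1) by auto
  ultimately show ?thesis using det that by blast
qed

section \<open>Good bases of an order\<close>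

text \<open>The multiplication table of the even Clifford algebra of the ternary form
  A x^2 + B y^2 + C z^2 + U y z + V x z + W x y.\<close>

definition qtab :: "int \<Rightarrow> int \<Rightarrow> quat \<Rightarrow> quat \<Rightarrow> quat \<Rightarrow> rat \<Rightarrow> rat \<Rightarrow> rat \<Rightarrow> rat \<Rightarrow> rat \<Rightarrow> rat \<Rightarrow> bool" where
  "qtab a b i j k A B C U V W \<longleftrightarrow>
     U = 2 * q0 i \<and> V = 2 * q0 j \<and> W = 2 * q0 k \<and>
     qnorm a b i = B * C \<and> qnorm a b j = A * C \<and> qnorm a b k = A * B \<and>
     qmult a b j k = qscale A (qconj i) \<and> qmult a b k i = qscale B (qconj j) \<and>
     qmult a b i j = qscale C (qconj k)"

lemma qtab_cycle: "qtab a b i j k A B C U V W \<Longrightarrow> qtab a b j k i B C A V W U"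
  by (auto simp: qtab_def mult.commute)

lemma qconj_eq: "qconj x = qscale (2 * q0 x) qone - x"
  by (rule quat_eqI) simp_all

lemma qmult_swap:
  "qmult a b y x = qscale (2 * q0 x) y + qscale (2 * q0 y) x - qscale (4 * q0 x * q0 y) qone
     + qconj (qmult a b x y)"
  by (rule quat_eqI) (simp_all add: qmult_sel algebra_simps)

lemma qtab_products:
  assumes "qtab a b i j k A B C U V W"
  shows "qmult a b i i = qcomb (- B * C) U 0 0 i j k" "qmult a b j j = qcomb (- A * C) 0 V 0 i j k"
    "qmult a b k k = qcomb (- A * B) 0 0 W i j k"
    "qmult a b j k = qcomb (A * U) (- A) 0 0 i j k" "qmult a b k i = qcomb (B * V) 0 (- B) 0 i j k"
    "qmult a b i j = qcomb (C * W) 0 0 (- C) i j k"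
    "qmult a b k j = qcomb (- V * W) A W V i j k" "qmult a b i k = qcomb (- U * W) W B U i j k"
    "qmult a b j i = qcomb (- U * V) V U C i j k"
proof -
  note t = assms[unfolded qtab_def]
  show "qmult a b i i = qcomb (- B * C) U 0 0 i j k" "qmult a b j j = qcomb (- A * C) 0 V 0 i j k"
    "qmult a b k k = qcomb (- A * B) 0 0 W i j k"
    unfolding qmult_self[of a b i] qmult_self[of a b j] qmult_self[of a b k]
    using t by (intro quat_eqI; simp)+
  show p: "qmult a b j k = qcomb (A * U) (- A) 0 0 i j k" "qmult a b k i = qcomb (B * V) 0 (- B) 0 i j k"
    "qmult a b i j = qcomb (C * W) 0 0 (- C) i j k"
    using t by (intro quat_eqI; simp add: algebra_simps)+
  show "qmult a b k j = qcomb (- V * W) A W V i j k"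
    unfolding qmult_swap[of a b k j] p using t by (intro quat_eqI) (simp_all add: algebra_simps)
  show "qmult a b i k = qcomb (- U * W) W B U i j k"
    unfolding qmult_swap[of a b i k] p using t by (intro quat_eqI) (simp_all add: algebra_simps)
  show "qmult a b j i = qcomb (- U * V) V U C i j k"
    unfolding qmult_swap[of a b j i] p using t by (intro quat_eqI) (simp_all add: algebra_simps)
qed

lemma qtab_mult:
  assumes "qtab a b i j k A B C U V W"
  shows "qmult a b (qcomb n x y z i j k) (qcomb n' x' y' z' i j k) = qcomb
     (n * n' - B * C * x * x' - A * C * y * y' - A * B * z * z' + A * U * y * z' + B * V * z * x' + C * W * x * y'
        - V * W * z * y' - U * W * x * z' - U * V * y * x')
     (n * x' + x * n' + U * x * x' - A * y * z' + A * z * y' + W * x * z' + V * y * x')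
     (n * y' + y * n' + V * y * y' - B * z * x' + W * z * y' + B * x * z' + U * y * x')
     (n * z' + z * n' + W * z * z' - C * x * y' + V * z * y' + U * x * z' + C * y * x') i j k"
  unfolding qcomb_def[of n] qcomb_def[of n'] qmult_distrib qmult_scale qmult_one qtab_products[OF assms]
  by (rule quat_eqI) (simp_all add: algebra_simps)

text \<open>Conjugation turns the one given product into A i = conj(k) conj(j). Multiplying by j on
  the right or by k on the left and cancelling A yields the other two products, and multiplicativity
  of the norm yields N(i).\<close>

lemma qtab_of_product:
  assumes "a < 0" "b < 0" and jk: "qmult a b j k = qscale A (qconj i)" and "A \<noteq> 0"
    and B: "qnorm a b k = A * B" and C: "qnorm a b j = A * C"
  shows "qtab a b i j k A B C (2 * q0 i) (2 * q0 j) (2 * q0 k)"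
proof -
  have "qconj (qscale A (qconj i)) = qscale A i" by (rule quat_eqI) simp_all
  then have kj: "qscale A i = qmult a b (qconj k) (qconj j)"
    using arg_cong[OF jk, of qconj] unfolding qconj_mult by simp
  have cancel: "x = y" if "qscale A x = qscale A y" for x y
    using that \<open>A \<noteq> 0\<close> quatvs.scale_left_imp_eq by blast
  have "qscale A (qmult a b i j) = qscale A (qscale C (qconj k))"
    unfolding qmult_scale[symmetric] kj qmult_assoc qmult_conj C by (simp add: qmult_scale)
  then have ij: "qmult a b i j = qscale C (qconj k)" by (rule cancel)
  have "qscale A (qmult a b k i) = qmult a b k (qscale A i)" by (simp add: qmult_scale)
  also have "\<dots> = qscale A (qscale B (qconj j))"
    unfolding kj qmult_assoc[symmetric] qmult_conj B by (simp add: qmult_scale)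
  finally have ki: "qmult a b k i = qscale B (qconj j)" by (rule cancel)
  have "A^2 * qnorm a b i = qnorm a b (qscale A (qconj i))"
    by (simp add: qnorm_eq qip_def power2_eq_square algebra_simps)
  also have "\<dots> = A^2 * (B * C)"
    unfolding jk[symmetric] qnorm_mult B C by (simp add: power2_eq_square)
  finally have "qnorm a b i = B * C" using \<open>A \<noteq> 0\<close> by simp
  then show ?thesis using jk ij ki B C by (simp add: qtab_def)
qed

text \<open>\<open>qtab\<close> admits rational coefficients, because tables are also considered for
  bases not yet known to have an integral one; here the coefficients are integers.\<close>

definition good_basis :: "int \<Rightarrow> int \<Rightarrow> quat set \<Rightarrow> quat \<Rightarrow> quat \<Rightarrow> quat \<Rightarrow> int \<Rightarrow> int \<Rightarrow> int \<Rightarrow> int \<Rightarrow> int \<Rightarrow> int \<Rightarrow> bool" where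
  "good_basis a b R i j k A B C U V W \<longleftrightarrow> R = qspan i j k \<and> qdet i j k \<noteq> 0 \<and>
     qtab a b i j k (of_int A) (of_int B) (of_int C) (of_int U) (of_int V) (of_int W)"

lemma qdet_zero:
  "qdet i j k \<noteq> 0 \<Longrightarrow> i \<noteq> 0 \<and> j \<noteq> 0 \<and> k \<noteq> 0"
  by (auto simp: qdet_def)

lemma good_basis_nonzero:
  assumes "a < 0" "b < 0" "good_basis a b R i j k A B C U V W"
  shows "A \<noteq> 0" "B \<noteq> 0" "C \<noteq> 0"
proof -
  have "i \<noteq> 0" "j \<noteq> 0" using assms(3) qdet_zero by (auto simp: good_basis_def)
  then have "qnorm a b i > 0" "qnorm a b j > 0" using assms qnorm_pos by auto
  then show "A \<noteq> 0" "B \<noteq> 0" "C \<noteq> 0" using assms(3) by (auto simp: good_basis_def qtab_def)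
qed

lemma qspan_basis: "i \<in> qspan i j k" "j \<in> qspan i j k" "k \<in> qspan i j k"
proof -
  have "i = qcomb (of_int 0) (of_int 1) (of_int 0) (of_int 0) i j k"
    "j = qcomb (of_int 0) (of_int 0) (of_int 1) (of_int 0) i j k"
    "k = qcomb (of_int 0) (of_int 0) (of_int 0) (of_int 1) i j k"
    by (rule quat_eqI; simp)+
  then show "i \<in> qspan i j k" "j \<in> qspan i j k" "k \<in> qspan i j k" unfolding qspan_def by blast+
qed

lemma qspan_cycle: "qspan i j k = qspan j k i"
proof -
  have e: "qcomb n x y z i j k = qcomb n y z x j k i" for n x y z
    by (rule quat_eqI) simp_all
  show ?thesis unfolding qspan_def e by blast
qed

lemma good_basis_cycle:
  assumes "good_basis a b R i j k A B C U V W"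
  shows "good_basis a b R j k i B C A V W U"
  using assms qspan_cycle[of i j k] qtab_cycle
  by (auto simp: good_basis_def qdet_def algebra_simps)

lemma qspan_shear:
  fixes s t c d :: int and i j k :: quat
  defines "i' \<equiv> i - qscale (of_int s) k + qscale (of_int c) qone"
    and "j' \<equiv> j - qscale (of_int t) k + qscale (of_int d) qone"
  shows "qspan i' j' k = qspan i j k" "qdet i' j' k = qdet i j k"
proof -
  have 1: "qcomb (of_int n) (of_int x) (of_int y) (of_int z) i' j' k =
     qcomb (of_int (n + c * x + d * y)) (of_int x) (of_int y) (of_int (z - s * x - t * y)) i j k" for n x y z :: int
    by (rule quat_eqI) (simp_all add: i'_def j'_def algebra_simps)
  have 2: "qcomb (of_int n) (of_int x) (of_int y) (of_int z) i j k =
     qcomb (of_int (n - c * x - d * y)) (of_int x) (of_int y) (of_int (z + s * x + t * y)) i' j' k" for n x y z :: int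
    by (rule quat_eqI) (simp_all add: i'_def j'_def algebra_simps)
  show "qspan i' j' k = qspan i j k"
  proof
    show "qspan i' j' k \<subseteq> qspan i j k" unfolding qspan_def using 1 by blast
    show "qspan i j k \<subseteq> qspan i' j' k" unfolding qspan_def using 2 by blast
  qed
  show "qdet i' j' k = qdet i j k" by (simp add: i'_def j'_def qdet_def algebra_simps)
qed

text \<open>The form transforms contragrediently to the basis: this change of basis substitutes
  (x + s z, y + t z, z) into f.\<close>

lemma good_basis_shear:
  assumes "a < 0" "b < 0" and g: "good_basis a b R i j k A B C U V W"
  shows "\<exists>i' j'. good_basis a b R i' j' k A B (C + A * s\<^sup>2 + B * t\<^sup>2 + U * t + V * s + W * s * t)
     (U + 2 * B * t + W * s) (V + 2 * A * s + W * t) W"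
proof -
  note t = g[unfolded good_basis_def, THEN conjunct2, THEN conjunct2]
  note t' = t[unfolded qtab_def]
  \<comment> \<open>The integer translations are forced by the table: the one of j gives j' k the
    k-coefficient A s that conj(i') requires, the one of i matches the constant terms.\<close>
  define i' where "i' = i - qscale (of_int s) k + qscale (of_int (B * t + W * s)) qone"
  define j' where "j' = j - qscale (of_int t) k + qscale (of_int (A * s + W * t)) qone"
  have A: "A \<noteq> 0" using good_basis_nonzero[OF assms] by blast
  have h: "of_int U = 2 * q0 i" "of_int V = 2 * q0 j" "of_int W = 2 * q0 k"
    using t[unfolded qtab_def] by auto
  have U: "2 * q0 i' = of_int (U + 2 * B * t + W * s)" "2 * q0 j' = of_int (V + 2 * A * s + W * t)"
    "2 * q0 k = of_int W"
    by (simp_all add: i'_def j'_def h algebra_simps)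
  have jk: "qmult a b j' k = qscale (of_int A) (qconj i')"
  proof -
    have j'k: "qmult a b j' k = qmult a b (qcomb (of_int (A * s + W * t)) 0 1 (- of_int t) i j k) (qcomb 0 0 0 1 i j k)"
      by (rule arg_cong2[where f = "qmult a b"]; rule quat_eqI; simp add: j'_def)
    show ?thesis unfolding j'k qtab_mult[OF t]
      by (rule quat_eqI) (simp_all add: i'_def h algebra_simps)
  qed
  have nj: "qnorm a b j' = of_int A * of_int (C + A * s\<^sup>2 + B * t\<^sup>2 + U * t + V * s + W * s * t)"
  proof -
    have "q0 (qmult a b j k) = of_int A * q0 i" using t' by simp
    then have ip: "qip a b j k = q0 j * q0 k - of_int A * q0 i"
      by (simp add: qmult_sel qip_def algebra_simps)
    have ij: "qip a b j j = of_int A * of_int C - q0 j ^ 2" "qip a b k k = of_int A * of_int B - q0 k ^ 2"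
      using t' unfolding qnorm_eq by linarith+
    have "qnorm a b j' = (q0 j - of_int t * q0 k + of_int (A * s + W * t)) ^ 2
       + qip a b j j - 2 * of_int t * qip a b j k + of_int t ^ 2 * qip a b k k"
      by (simp add: qnorm_eq qip_def j'_def power2_eq_square algebra_simps)
    also have "\<dots> = of_int A * of_int (C + A * s\<^sup>2 + B * t\<^sup>2 + U * t + V * s + W * s * t)"
      unfolding ip ij by (simp add: h power2_eq_square algebra_simps)
    finally show ?thesis .
  qed
  have "qtab a b i' j' k (of_int A) (of_int B) (of_int (C + A * s\<^sup>2 + B * t\<^sup>2 + U * t + V * s + W * s * t))
     (2 * q0 i') (2 * q0 j') (2 * q0 k)"
    using t' A by (intro qtab_of_product[OF assms(1,2) jk _ _ nj]) simp_all
  moreover have "qspan i' j' k = qspan i j k" "qdet i' j' k = qdet i j k"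
    unfolding i'_def j'_def by (rule qspan_shear)+
  ultimately have "good_basis a b R i' j' k A B (C + A * s\<^sup>2 + B * t\<^sup>2 + U * t + V * s + W * s * t)
     (U + 2 * B * t + W * s) (V + 2 * A * s + W * t) W"
    using g unfolding U good_basis_def by simp
  then show ?thesis by blast
qed

lemma basis_trace_int:
  assumes "is_order a b R" and R: "R = qspan i j k" "qdet i j k \<noteq> 0"
  shows "2 * q0 i \<in> \<int>"
proof -
  have "i \<in> R" unfolding R by (rule qspan_basis)
  then have "qmult a b i i \<in> R" using assms(1) by (auto simp: is_order_def)
  moreover have "qmult a b i i = qcomb (- qnorm a b i) (2 * q0 i) 0 0 i j k"
    unfolding qmult_self by (rule quat_eqI) simp_all
  ultimately show ?thesis by (simp add: R(1) qcomb_in_qspan[OF R(2)])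
qed

text \<open>Attaches a ternary form to an order. After integer translations j k lies in Z + Z i;
  membership of further products in R then forces the divisibilities that bring the table into the
  required shape.\<close>

lemma order_good_basis:
  assumes "a < 0" "b < 0" "is_order a b R"
  obtains i j k A B C U V W where "good_basis a b R i j k A B C U V W"
proof -
  obtain i j0 k0 where R0: "R = qspan i j0 k0" "qdet i j0 k0 \<noteq> 0"
    by (rule order_basis[OF assms(3)])
  have mult: "\<And>x y. x \<in> R \<Longrightarrow> y \<in> R \<Longrightarrow> qmult a b x y \<in> R" using assms(3) by (simp add: is_order_def)
  obtain r0 l0 m0 n0 :: int where j0k0: "qmult a b j0 k0 = qcomb (of_int r0) (of_int l0) (of_int m0) (of_int n0) i j0 k0"
  proof -
    have "j0 \<in> R" "k0 \<in> R" unfolding R0(1) by (rule qspan_basis)+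
    then have "qmult a b j0 k0 \<in> R" by (rule mult)
    then show ?thesis using that unfolding R0(1) qspan_def by blast
  qed
  \<comment> \<open>These translations remove the j and k components of the product: (j0 - n0)(k0 -
    m0) lies in Z + Z i.\<close>
  define j where "j = j0 - qscale (of_int n0) qone"
  define k where "k = k0 - qscale (of_int m0) qone"
  have "qspan j k i = qspan j0 k0 i" "qdet j k i = qdet j0 k0 i"
    using qspan_shear[where i = j0 and j = k0 and k = i and s = 0 and t = 0 and c = "- n0" and d = "- m0"]
    by (simp_all add: j_def k_def qscale_def qone_def plus_quat_def minus_quat_def)
  then have R1: "R = qspan i j k" and det: "qdet i j k \<noteq> 0"
    using R0 qspan_cycle[of i j k] qspan_cycle[of i j0 k0] by (simp_all add: qdet_def algebra_simps)
  define r :: rat where "r = of_int r0 + of_int m0 * of_int n0"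
  define A where "A = - l0"
  have jk: "qmult a b j k = qcomb r (- of_int A) 0 0 i j k"
  proof -
    have "qmult a b j k = qmult a b j0 k0 - qscale (of_int n0) k0 - qscale (of_int m0) j0 + qscale (of_int (m0 * n0)) qone"
      by (rule quat_eqI) (simp_all add: j_def k_def qmult_sel algebra_simps)
    also have "\<dots> = qcomb r (- of_int A) 0 0 i j k"
      unfolding j0k0 by (rule quat_eqI) (simp_all add: j_def k_def r_def A_def algebra_simps)
    finally show ?thesis .
  qed
  define V where "V = 2 * q0 j" define u where "u = 2 * q0 i" define W where "W = 2 * q0 k"
  \<comment> \<open>If A = 0, then multiplying j k = r by conj(j) gives N(j) k = r conj(j), against
    independence.\<close>
  have A: "A \<noteq> 0"
  proof
    assume "A = 0"
    then have "qmult a b j k = qscale r qone" unfolding jk by (intro quat_eqI) simp_all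
    then have "qmult a b (qconj j) (qmult a b j k) = qscale r (qconj j)" by (simp add: qmult_scale)
    then have "qscale (qnorm a b j) k = qscale r (qconj j)"
      by (simp add: qmult_assoc[symmetric] qmult_conj qmult_scale)
    then have "qcomb 0 0 0 (qnorm a b j) i j k = qcomb (r * V) 0 (- r) 0 i j k"
      by (simp add: qconj_eq qcomb_def V_def algebra_simps quatvs.scale_right_diff_distrib)
    then have "qnorm a b j = 0" by (simp add: qcomb_eq_iff[OF det])
    moreover have "j \<noteq> 0" using qdet_zero[OF det] by blast
    ultimately show False using qnorm_pos[OF assms(1,2)] by force
  qed
  have inR: "i \<in> R" "j \<in> R" "k \<in> R"
    unfolding R1 by (rule qspan_basis)+
  have "u \<in> \<int>" using basis_trace_int[OF assms(3) R1 det] by (simp add: u_def)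
  have cyc: "R = qspan j k i" "qdet j k i \<noteq> 0" "R = qspan k i j" "qdet k i j \<noteq> 0"
    using R1 det qspan_cycle[of i j k] qspan_cycle[of j k i] by (auto simp: qdet_def algebra_simps)
  have "V \<in> \<int>" using basis_trace_int[OF assms(3) cyc(1,2)] by (simp add: V_def)
  have "W \<in> \<int>" using basis_trace_int[OF assms(3) cyc(3,4)] by (simp add: W_def)
  have Ar: "of_int A \<noteq> (0::rat)" using A by simp
  \<comment> \<open>Obtained from A i = r - j k. As j i lies in R, its coordinates show that A
    divides r and N(j).\<close>
  have ji: "qmult a b j i = qcomb (- V * r / of_int A) V (r / of_int A) (qnorm a b j / of_int A) i j k"
  proof -
    have "qscale (of_int A) i = qscale r qone - qmult a b j k"
      unfolding jk by (rule quat_eqI) simp_all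
    then have "qscale (of_int A) (qmult a b j i) = qmult a b j (qscale r qone - qmult a b j k)"
      by (metis qmult_scale(2))
    also have "\<dots> = qscale r j - qmult a b (qmult a b j j) k"
      unfolding qmult_assoc by (rule quat_eqI) (simp_all add: qmult_sel algebra_simps)
    also have "\<dots> = qscale r j - (qscale V (qmult a b j k) - qscale (qnorm a b j) k)"
      unfolding qmult_self[of a b j] V_def
      by (rule quat_eqI) (simp_all add: qmult_sel algebra_simps)
    also have "\<dots> = qscale (of_int A) (qcomb (- V * r / of_int A) V (r / of_int A) (qnorm a b j / of_int A) i j k)"
      unfolding jk using Ar by (intro quat_eqI) (simp_all add: field_simps)
    finally show ?thesis using quatvs.scale_left_imp_eq[OF Ar] by blast
  qed
  have "qmult a b j i \<in> R" by (intro mult inR)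
  then have "r / of_int A \<in> \<int>" "qnorm a b j / of_int A \<in> \<int>"
    unfolding ji R1 qcomb_in_qspan[OF det] by auto
  then obtain m C :: int where m: "r / of_int A - u = of_int m" and C: "qnorm a b j / of_int A = of_int C"
    using \<open>u \<in> \<int>\<close> by (metis Ints_cases Ints_diff)
  \<comment> \<open>With m = r/A - tr(i), the conjugate of i + m is r/A - i, so that j k = A
    conj(i').\<close>
  define i' where "i' = i + qscale (of_int m) qone"
  have R2: "R = qspan i' j k" and det2: "qdet i' j k \<noteq> 0"
    using qspan_shear[where i = i and j = j and k = k and s = 0 and t = 0 and c = m and d = 0] R1 det
    by (simp_all add: i'_def)
  have jk': "qmult a b j k = qscale (of_int A) (qconj i')"
    unfolding jk i'_def m[symmetric] using Ar by (intro quat_eqI) (simp_all add: u_def field_simps)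
  have tab: "qtab a b i' j k (of_int A) (qnorm a b k / of_int A) (of_int C) (2 * q0 i') (2 * q0 j) (2 * q0 k)"
    using Ar C by (intro qtab_of_product[OF assms(1,2) jk' Ar]) (auto simp: field_simps)
  have "i' \<in> R" unfolding R2 by (rule qspan_basis)
  then have "qmult a b k i' \<in> R" by (intro mult inR)
  then have "qnorm a b k / of_int A \<in> \<int>"
    unfolding qtab_products(5)[OF tab] R2 qcomb_in_qspan[OF det2] by auto
  then obtain B :: int where B: "qnorm a b k / of_int A = of_int B" by (auto elim: Ints_cases)
  have "2 * q0 i' = u + 2 * of_int m" by (simp add: i'_def u_def)
  then have "2 * q0 i' \<in> \<int>" using \<open>u \<in> \<int>\<close> by simp
  then obtain U' V' W' :: int where "2 * q0 i' = of_int U'" "V = of_int V'" "W = of_int W'"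
    using \<open>V \<in> \<int>\<close> \<open>W \<in> \<int>\<close> by (auto elim!: Ints_cases)
  then have "good_basis a b R i' j k A B C U' V' W'"
    using tab R2 det2 unfolding B good_basis_def V_def W_def by simp
  then show ?thesis by (rule that)
qed

section \<open>Ternary forms\<close>

definition tform :: "int \<Rightarrow> int \<Rightarrow> int \<Rightarrow> int \<Rightarrow> int \<Rightarrow> int \<Rightarrow> int \<Rightarrow> int \<Rightarrow> int \<Rightarrow> int" where
  "tform A B C U V W x y z = A * x\<^sup>2 + B * y\<^sup>2 + C * z\<^sup>2 + U * y * z + V * x * z + W * x * y"

text \<open>Half of the determinant of the Gram matrix of f, which is the reduced discriminant of the order.\<close>

definition tdisc :: "int \<Rightarrow> int \<Rightarrow> int \<Rightarrow> int \<Rightarrow> int \<Rightarrow> int \<Rightarrow> int" where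
  "tdisc A B C U V W = 4 * A * B * C + U * V * W - A * U\<^sup>2 - B * V\<^sup>2 - C * W\<^sup>2"

lemma solve_mod_prime:
  fixes l e c :: int
  assumes "prime l" "\<not> l dvd e"
  shows "\<exists>s. l dvd e * s - c"
proof -
  have "coprime l e" using assms by (simp add: prime_imp_coprime)
  then obtain u v where uv: "u * l + v * e = 1" using bezout_int[of l e] by (auto simp: coprime_iff_gcd_eq_1)
  have "e * (v * c) - c = - c * u * l"
    using arg_cong[OF uv, of "\<lambda>x. c * x"] by (simp add: algebra_simps)
  then show ?thesis by (metis dvd_triv_right)
qed

section \<open>Ternary forms modulo a prime l, for a class P closed under cyclic permutations and
  shears\<close>

context
  fixes P :: "int \<Rightarrow> int \<Rightarrow> int \<Rightarrow> int \<Rightarrow> int \<Rightarrow> int \<Rightarrow> bool" and l :: int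
  assumes cycle: "\<And>A B C U V W. P A B C U V W \<Longrightarrow> P B C A V W U"
    and shear: "\<And>A B C U V W s t. P A B C U V W \<Longrightarrow>
      P A B (C + A * s\<^sup>2 + B * t\<^sup>2 + U * t + V * s + W * s * t) (U + 2 * B * t + W * s) (V + 2 * A * s + W * t) W"
    and no_double: "\<And>A B C U V W. P A B C U V W \<Longrightarrow> \<not> (l dvd U \<and> l dvd V \<and> l\<^sup>2 dvd C)"
    and no_plane: "\<And>A B C U V W. P A B C U V W \<Longrightarrow> \<not> (l dvd A \<and> l dvd C \<and> l dvd V)"
    and l: "prime l"
begin

private lemma prime_dvd_cancel: "l dvd x * y \<Longrightarrow> \<not> l dvd x \<Longrightarrow> l dvd y"
  using prime_dvd_multD[OF l] by blast

private lemma not_dvd_2: "l \<noteq> 2 \<Longrightarrow> \<not> l dvd 2"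
  using zdvd_imp_le[of l 2] prime_gt_1_int[OF l] by auto

private lemma shear_x:
  assumes "P A B C U V W"
  shows "P (A + B * s\<^sup>2 + C * t\<^sup>2 + V * t + W * s + U * s * t) B C U (V + 2 * C * t + U * s) (W + 2 * B * s + U * t)"
  using cycle[OF cycle[OF shear[OF cycle[OF assms], of s t]]] .

private lemma shear_y:
  assumes "P A B C U V W"
  shows "P A (B + C * s\<^sup>2 + A * t\<^sup>2 + W * t + U * s + V * s * t) C (U + 2 * C * s + V * t) V (W + 2 * A * t + V * s)"
  using cycle[OF shear[OF cycle[OF cycle[OF assms]], of s t]] .

text \<open>The vector e lies in the radical of f modulo l, and f(e) vanishes modulo l. As e3 is
  invertible, e is proportional modulo l to (s, t, 1), and the shear by s and t makes this the third
  basis vector.\<close>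

private lemma radical_vector:
  assumes P: "P A B C U V W" and e: "\<not> l dvd e3" "l dvd tform A B C U V W e1 e2 e3"
    "l dvd 2 * A * e1 + W * e2 + V * e3" "l dvd W * e1 + 2 * B * e2 + U * e3"
  shows "\<exists>A' B' C' U' V' W'. P A' B' C' U' V' W' \<and> tdisc A' B' C' U' V' W' = tdisc A B C U V W \<and>
    l dvd C' \<and> l dvd U' \<and> l dvd V'"
proof -
  obtain s where "l dvd e3 * s - e1" using solve_mod_prime[OF l e(1)] by blast
  then obtain x where "e3 * s - e1 = l * x" by (elim dvdE)
  then have x: "e1 = e3 * s - l * x" by simp
  obtain t where "l dvd e3 * t - e2" using solve_mod_prime[OF l e(1)] by blast
  then obtain y where "e3 * t - e2 = l * y" by (elim dvdE)
  then have y: "e2 = e3 * t - l * y" by simp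
  define C' U' V' where "C' = C + A * s\<^sup>2 + B * t\<^sup>2 + U * t + V * s + W * s * t"
    and "U' = U + 2 * B * t + W * s" and "V' = V + 2 * A * s + W * t"
  have "e3 * U' = (W * e1 + 2 * B * e2 + U * e3) + l * (W * x + 2 * B * y)"
    unfolding x y U'_def by (simp add: algebra_simps)
  then have "l dvd e3 * U'" using e(4) by simp
  then have U': "l dvd U'" using e(1) by (rule prime_dvd_cancel)
  have "e3 * V' = (2 * A * e1 + W * e2 + V * e3) + l * (W * y + 2 * A * x)"
    unfolding x y V'_def by (simp add: algebra_simps)
  then have "l dvd e3 * V'" using e(3) by simp
  then have V': "l dvd V'" using e(1) by (rule prime_dvd_cancel)
  have "e3 * e3 * C' = tform A B C U V W e1 e2 e3 + l * (x * (2 * A * e3 * s - A * l * x + V * e3 + W * e3 * t)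
      + y * (2 * B * e3 * t - B * l * y + U * e3 + W * e3 * s - W * l * x))"
    unfolding x y C'_def tform_def by (simp add: algebra_simps power2_eq_square)
  then have "l dvd e3 * e3 * C'" using e(2) by simp
  then have C': "l dvd C'" using e(1) prime_dvd_cancel by (metis mult.assoc)
  have "tdisc A B C' U' V' W = tdisc A B C U V W"
    by (simp add: tdisc_def C'_def U'_def V'_def algebra_simps power2_eq_square)
  moreover have "P A B C' U' V' W" using shear[OF P, of s t] by (simp add: C'_def U'_def V'_def)
  ultimately show ?thesis using U' V' C' by blast
qed

private lemma radical_vector':
  assumes P: "P A B C U V W" and e: "\<not> (l dvd e1 \<and> l dvd e2 \<and> l dvd e3)" "l dvd tform A B C U V W e1 e2 e3"
    "l dvd 2 * A * e1 + W * e2 + V * e3" "l dvd W * e1 + 2 * B * e2 + U * e3" "l dvd V * e1 + U * e2 + 2 * C * e3"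
  shows "\<exists>A' B' C' U' V' W'. P A' B' C' U' V' W' \<and> tdisc A' B' C' U' V' W' = tdisc A B C U V W \<and>
    l dvd C' \<and> l dvd U' \<and> l dvd V'"
proof -
  have t: "tform B C A V W U e2 e3 e1 = tform A B C U V W e1 e2 e3"
    "tform C A B W U V e3 e1 e2 = tform A B C U V W e1 e2 e3"
    by (simp_all add: tform_def algebra_simps)
  have d: "tdisc B C A V W U = tdisc A B C U V W" "tdisc C A B W U V = tdisc A B C U V W"
    by (simp_all add: tdisc_def algebra_simps)
  consider "\<not> l dvd e3" | "\<not> l dvd e1" | "\<not> l dvd e2" using e(1) by blast
  then show ?thesis
  proof cases
    case 1 then show ?thesis by (rule radical_vector[OF P _ e(2-4)])
  next
    case 2
    have "l dvd tform B C A V W U e2 e3 e1" using e(2) unfolding t .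
    moreover have "l dvd 2 * B * e2 + U * e3 + W * e1" "l dvd U * e2 + 2 * C * e3 + V * e1"
      using e(4,5) by (simp_all add: add_ac)
    ultimately show ?thesis using radical_vector[OF cycle[OF P] 2] unfolding d by blast
  next
    case 3
    have "l dvd tform C A B W U V e3 e1 e2" using e(2) unfolding t .
    moreover have "l dvd 2 * C * e3 + V * e1 + U * e2" "l dvd V * e3 + 2 * A * e1 + W * e2"
      using e(3,5) by (simp_all add: add_ac)
    ultimately show ?thesis using radical_vector[OF cycle[OF cycle[OF P]] 3] unfolding d by blast
  qed
qed

text \<open>If all 2 x 2 minors of the Gram matrix vanish modulo l, then f is a multiple of the square of a
  linear form modulo l and hence vanishes on a plane.\<close>

private lemma minors_not_all_zero:
  assumes P: "P A B C U V W" and m: "l dvd 4 * B * C - U\<^sup>2" "l dvd 4 * A * C - V\<^sup>2" "l dvd 4 * A * B - W\<^sup>2"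
    "l dvd V * W - 2 * A * U" and A: "\<not> l dvd A"
  shows False
proof -
  have "\<exists>s t. l dvd B + A * t\<^sup>2 + W * t \<and> l dvd C + A * s\<^sup>2 + V * s \<and> l dvd U + V * t + W * s + 2 * A * t * s"
  proof (cases "l = 2")
    case True
    have sq: "even (x\<^sup>2) \<longleftrightarrow> even x" for x :: int by simp
    have ev: "even U" "even V" "even W"
      using m(1-3) unfolding True by (auto simp: sq)
    have "odd A" using A True by simp
    \<comment> \<open>Modulo 2 every number is its own square, so t = B and s = C are the required
      roots.\<close>
    then have "even (B + A * B\<^sup>2 + W * B)" "even (C + A * C\<^sup>2 + V * C)" "even (U + V * B + W * C + 2 * A * B * C)"
      using ev by auto
    then show ?thesis unfolding True by blast
  next
    case False
    have l2: "\<not> l dvd 2" using False by (rule not_dvd_2)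
    then have A2: "\<not> l dvd 2 * A" using A l2 prime_dvd_cancel by blast
    have A4: "\<not> l dvd 4 * A" using prime_dvd_cancel[of 2 "2 * A"] l2 A2 by auto
    \<comment> \<open>For odd l, the values t = -W/(2A) and s = -V/(2A) complete the squares; the
      vanishing minors remove what is left.\<close>
    obtain t where "l dvd (2 * A) * t - (- W)" using solve_mod_prime[OF l A2] by blast
    then obtain y where y: "2 * A * t + W = l * y" by (auto elim: dvdE)
    obtain s where "l dvd (2 * A) * s - (- V)" using solve_mod_prime[OF l A2] by blast
    then obtain x where x: "2 * A * s + V = l * x" by (auto elim: dvdE)
    have "4 * A * (B + A * t\<^sup>2 + W * t) = (2 * A * t + W)\<^sup>2 + (4 * A * B - W\<^sup>2)"
      by (simp add: algebra_simps power2_eq_square)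
    also have "l dvd \<dots>" using m(3) unfolding y by (simp add: power2_eq_square)
    finally have 1: "l dvd B + A * t\<^sup>2 + W * t" using A4 by (rule prime_dvd_cancel)
    have "4 * A * (C + A * s\<^sup>2 + V * s) = (2 * A * s + V)\<^sup>2 + (4 * A * C - V\<^sup>2)"
      by (simp add: algebra_simps power2_eq_square)
    also have "l dvd \<dots>" using m(2) unfolding x by (simp add: power2_eq_square)
    finally have 2: "l dvd C + A * s\<^sup>2 + V * s" using A4 by (rule prime_dvd_cancel)
    have "2 * A * (U + V * t + W * s + 2 * A * t * s) = (2 * A * t + W) * (2 * A * s + V) - (V * W - 2 * A * U)"
      by (simp add: algebra_simps power2_eq_square)
    also have "l dvd \<dots>" using m(4) unfolding x y by simp
    finally have 3: "l dvd U + V * t + W * s + 2 * A * t * s" using A2 by (rule prime_dvd_cancel)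
    show ?thesis using 1 2 3 by blast
  qed
  then obtain s t where st: "l dvd B + A * t\<^sup>2 + W * t" "l dvd C + A * s\<^sup>2 + V * s"
    "l dvd U + V * t + W * s + 2 * A * t * s" by blast
  from shear[OF shear_y[OF P, of 0 t], of s 0]
  have "P A (B + A * t\<^sup>2 + W * t) (C + A * s\<^sup>2 + V * s) (U + V * t + W * s + 2 * A * t * s) (V + 2 * A * s) (W + 2 * A * t)"
    by (simp add: algebra_simps)
  from no_plane[OF cycle[OF cycle[OF this]]] st show False by blast
qed

text \<open>The triple is a column of the adjugate of the Gram matrix of f. Gram matrix times
  adjugate is 2 \<open>tdisc\<close>, so the column lies in the radical modulo l, and f takes there
  the value \<open>tdisc\<close> times a minor. If it were nonzero modulo l,
  \<open>radical_vector'\<close> would give the normal form.\<close>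

private lemma minor_column:
  assumes P: "P A B C U V W" and dvd: "l dvd tdisc A B C U V W"
    and no: "\<nexists>A' B' C' U' V' W'. P A' B' C' U' V' W' \<and> tdisc A' B' C' U' V' W' = tdisc A B C U V W \<and>
      l dvd C' \<and> l dvd U' \<and> l dvd V'"
  shows "l dvd 4 * B * C - U\<^sup>2 \<and> l dvd U * V - 2 * C * W \<and> l dvd U * W - 2 * B * V"
proof (rule ccontr)
  assume n: "\<not> ?thesis"
  have "tform A B C U V W (4 * B * C - U\<^sup>2) (U * V - 2 * C * W) (U * W - 2 * B * V)
      = tdisc A B C U V W * (4 * B * C - U\<^sup>2)"
    "2 * A * (4 * B * C - U\<^sup>2) + W * (U * V - 2 * C * W) + V * (U * W - 2 * B * V) = 2 * tdisc A B C U V W"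
    "W * (4 * B * C - U\<^sup>2) + 2 * B * (U * V - 2 * C * W) + U * (U * W - 2 * B * V) = 0"
    "V * (4 * B * C - U\<^sup>2) + U * (U * V - 2 * C * W) + 2 * C * (U * W - 2 * B * V) = 0"
    by (simp_all add: tform_def tdisc_def algebra_simps power2_eq_square)
  then show False using radical_vector'[OF P n] dvd no by simp
qed

text \<open>Without a normal form, all minors vanish modulo l by \<open>minor_column\<close>. Then l
  divides A and C, because \<open>minors_not_all_zero\<close> excludes a coefficient prime to l, and
  V^2 = 4AC modulo l shows that l divides V as well, which \<open>no_plane\<close> forbids.\<close>

lemma radical_normal_form:
  assumes P: "P A B C U V W" and dvd: "l dvd tdisc A B C U V W"
  shows "\<exists>A' B' C' U' V' W'. P A' B' C' U' V' W' \<and> tdisc A' B' C' U' V' W' = tdisc A B C U V W \<and>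
    l dvd C' \<and> l dvd U' \<and> l dvd V'"
proof (rule ccontr)
  assume no: "\<not> ?thesis"
  note P' = cycle[OF P] and P'' = cycle[OF cycle[OF P]]
  have d: "tdisc B C A V W U = tdisc A B C U V W" "tdisc C A B W U V = tdisc A B C U V W"
    by (simp_all add: tdisc_def algebra_simps)
  note m = minor_column[OF P dvd no] minor_column[OF P', unfolded d, OF dvd no] minor_column[OF P'', unfolded d, OF dvd no]
  have "l dvd A"
    using minors_not_all_zero[OF P] m by (auto simp: algebra_simps)
  moreover have "l dvd C"
    using minors_not_all_zero[OF P''] m by (auto simp: algebra_simps)
  moreover have "l dvd V"
  proof -
    have "l dvd 4 * C * A" using \<open>l dvd A\<close> by simp
    then have "l dvd 4 * C * A - (4 * C * A - V\<^sup>2)" using m dvd_diff by blast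
    then show ?thesis using prime_dvd_power[OF l, of V 2] by simp
  qed
  ultimately show False using no_plane[OF P] by blast
qed

text \<open>In normal form f reduces modulo l to a binary form q(x, y), and C is divisible by l
  exactly once. A shear could move a nontrivial zero of q to the first basis vector, which would
  span with the third a plane forbidden by \<open>no_plane\<close>; so q has none. At a zero of f
  modulo l^2, therefore, l divides x and y, then l^2 divides C z^2, and finally l divides z.\<close>

lemma radical_anisotropic:
  assumes P: "P A B C U V W" and d: "l dvd C" "l dvd U" "l dvd V"
  shows "\<not> l\<^sup>2 dvd C" and "l dvd A * x\<^sup>2 + W * x * y + B * y\<^sup>2 \<Longrightarrow> l dvd x \<and> l dvd y"
    and "\<not> l dvd 4 * A * B - W\<^sup>2" and "\<not> l\<^sup>2 dvd tdisc A B C U V W"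
    and "l\<^sup>2 dvd tform A B C U V W x y z \<Longrightarrow> l dvd x \<and> l dvd y \<and> l dvd z"
proof -
  show C: "\<not> l\<^sup>2 dvd C" using no_double[OF P] d by blast
  show q: "l dvd x \<and> l dvd y" if q: "l dvd A * x\<^sup>2 + W * x * y + B * y\<^sup>2" for x y
  proof -
    have x: "l dvd x"
    proof (rule ccontr)
      assume x: "\<not> l dvd x"
      obtain s where "l dvd x * s - y" using solve_mod_prime[OF l x] by blast
      then obtain m where "x * s - y = l * m" by (elim dvdE)
      then have y: "y = x * s - l * m" by simp
      have "x * x * (A + B * s\<^sup>2 + W * s) = (A * x\<^sup>2 + W * x * y + B * y\<^sup>2) + l * (m * (W * x + 2 * B * x * s - B * l * m))"
        unfolding y by (simp add: algebra_simps power2_eq_square)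
      then have "l dvd x * x * (A + B * s\<^sup>2 + W * s)" using q by simp
      then have "l dvd A + B * s\<^sup>2 + W * s" using x prime_dvd_cancel by (metis mult.assoc)
      moreover have "P (A + B * s\<^sup>2 + W * s) B C U (V + U * s) (W + 2 * B * s)"
        using shear_x[OF P, of s 0] by (simp add: algebra_simps)
      ultimately show False using no_plane d(1,3) dvd_add[OF d(3) dvd_mult2[OF d(2)]] by blast
    qed
    then have "l dvd A * x\<^sup>2 + W * x * y" by (simp add: power2_eq_square)
    then have "l dvd B * y\<^sup>2" using q by (simp add: dvd_add_right_iff)
    moreover have "\<not> l dvd B" using no_plane[OF cycle[OF cycle[OF P]]] d by blast
    ultimately have "l dvd y\<^sup>2" by (rule prime_dvd_cancel)
    then have "l dvd y" by (rule prime_dvd_power[OF l])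
    with x show ?thesis ..
  qed
  show D: "\<not> l dvd 4 * A * B - W\<^sup>2"
  proof
    assume D: "l dvd 4 * A * B - W\<^sup>2"
    show False
    proof (cases "l = 2")
      case True
      then have "even W" using D by simp
      \<comment> \<open>For even W, (B, A) is a zero of q modulo 2, because A B (A + B) is
        even.\<close>
      then have "l dvd A * B\<^sup>2 + W * B * A + B * A\<^sup>2" unfolding True by auto
      then have "l dvd A" using q by blast
      then have "l dvd A * 1\<^sup>2 + W * 1 * 0 + B * 0\<^sup>2" by simp
      from q[OF this] show False using True by simp
    next
      case False
      \<comment> \<open>(2B, -W) is annihilated modulo l by the Gram matrix of q, hence is a zero of
        q.\<close>
      have "A * (2 * B)\<^sup>2 + W * (2 * B) * (- W) + B * (- W)\<^sup>2 = B * (4 * A * B - W\<^sup>2)"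
        by (simp add: algebra_simps power2_eq_square)
      then have "l dvd A * (2 * B)\<^sup>2 + W * (2 * B) * (- W) + B * (- W)\<^sup>2" using D by simp
      then have "l dvd 2 * B" using q by blast
      moreover have "\<not> l dvd 2" using False by (rule not_dvd_2)
      ultimately have "l dvd B" using prime_dvd_cancel by blast
      then have "l dvd A * 0\<^sup>2 + W * 0 * 1 + B * 1\<^sup>2" by simp
      from q[OF this] show False using l by (simp add: prime_int_iff)
    qed
  qed
  obtain u v where uv: "U = l * u" "V = l * v" using d(2,3) by (elim dvdE)
  show "\<not> l\<^sup>2 dvd tdisc A B C U V W"
  proof
    assume "l\<^sup>2 dvd tdisc A B C U V W"
    moreover have "tdisc A B C U V W = C * (4 * A * B - W\<^sup>2) + l\<^sup>2 * (u * v * W - A * u\<^sup>2 - B * v\<^sup>2)"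
      unfolding uv tdisc_def by (simp add: algebra_simps power2_eq_square)
    ultimately have "l\<^sup>2 dvd C * (4 * A * B - W\<^sup>2)" by (simp add: dvd_add_left_iff)
    moreover have "coprime (l\<^sup>2) (4 * A * B - W\<^sup>2)" using D l by (simp add: prime_imp_coprime)
    ultimately show False using C by (simp add: coprime_dvd_mult_left_iff)
  qed
  assume f: "l\<^sup>2 dvd tform A B C U V W x y z"
  then have "l dvd tform A B C U V W x y z" unfolding power2_eq_square by (rule dvd_mult_left)
  moreover have "tform A B C U V W x y z = (A * x\<^sup>2 + W * x * y + B * y\<^sup>2) + (C * z\<^sup>2 + U * y * z + V * x * z)"
    by (simp add: tform_def)
  moreover have "l dvd C * z\<^sup>2 + U * y * z + V * x * z" using d by (simp add: dvd_add)
  ultimately have "l dvd A * x\<^sup>2 + W * x * y + B * y\<^sup>2" by (simp add: dvd_add_left_iff)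
  then have xy: "l dvd x" "l dvd y" using q by blast+
  then obtain x' y' where x'y': "x = l * x'" "y = l * y'" by (elim dvdE)
  have "tform A B C U V W x y z = C * z\<^sup>2 + l\<^sup>2 * (A * x'\<^sup>2 + W * x' * y' + B * y'\<^sup>2 + u * y' * z + v * x' * z)"
    unfolding x'y' uv tform_def by (simp add: algebra_simps power2_eq_square)
  then have "l\<^sup>2 dvd C * z\<^sup>2" using f by (simp add: dvd_add_left_iff)
  have "l dvd z"
  proof (rule ccontr)
    assume "\<not> l dvd z"
    then have "coprime (l\<^sup>2) (z\<^sup>2)" using l by (simp add: prime_imp_coprime)
    then show False using \<open>l\<^sup>2 dvd C * z\<^sup>2\<close> C by (simp add: coprime_dvd_mult_left_iff)
  qed
  with xy show "l dvd x \<and> l dvd y \<and> l dvd z" by blast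
qed

end

section \<open>The discriminant of a maximal order\<close>

lemma qtab_scale:
  assumes "qtab a b i j k A B C U V W" "s \<noteq> 0" "t \<noteq> 0" "r \<noteq> 0"
  shows "qtab a b (qscale s i) (qscale t j) (qscale r k)
    (A * t * r / s) (B * r * s / t) (C * s * t / r) (s * U) (t * V) (r * W)"
proof -
  note T = assms(1)[unfolded qtab_def]
  have n: "qnorm a b (qscale c x) = c^2 * qnorm a b x" for c x
    by (simp add: qnorm_eq qip_def power2_eq_square algebra_simps)
  have c: "qconj (qscale c x) = qscale c (qconj x)" for c x by (rule quat_eqI) simp_all
  show ?thesis unfolding qtab_def n c qmult_scale
    using T assms(2-4) by (simp add: power2_eq_square mult_ac)
qed

lemma qspan_order:
  assumes "qdet i j k \<noteq> 0" "qtab a b i j k (of_int A) (of_int B) (of_int C) (of_int U) (of_int V) (of_int W)"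
  shows "is_order a b (qspan i j k)"
  unfolding is_order_def
proof (intro conjI ballI)
  show "full_lattice (qspan i j k)" by (rule full_lattice_qspan[OF assms(1)])
  have "qone = qcomb 1 0 0 0 i j k" by (rule quat_eqI) simp_all
  also have "\<dots> \<in> qspan i j k" unfolding qcomb_in_qspan[OF assms(1)] by simp
  finally show "qone \<in> qspan i j k" .
  fix x y assume "x \<in> qspan i j k" "y \<in> qspan i j k"
  then obtain n1 x1 y1 z1 n2 x2 y2 z2 :: int where
    "x = qcomb (of_int n1) (of_int x1) (of_int y1) (of_int z1) i j k"
    "y = qcomb (of_int n2) (of_int x2) (of_int y2) (of_int z2) i j k"
    unfolding qspan_def by blast
  then show "qmult a b x y \<in> qspan i j k"
    by (simp add: qtab_mult[OF assms(2)] qcomb_in_qspan[OF assms(1)])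
qed

text \<open>Replacing i by i/S and j by j/T rescales the table as in \<open>qtab_scale\<close>, and
  the five divisibilities keep it integral. The new basis spans an order that contains R and j/T, so
  T > 1 contradicts maximality.\<close>

lemma maximal_no_enlargement:
  assumes "is_maximal_order a b R" and g: "good_basis a b R i j k A B C U V W"
    and ST: "S > 0" "T > 1" and d: "A * S = T * A'" "B * T = S * B'" "C = S * T * C'" "U = S * U'" "V = T * V'"
  shows False
proof -
  have R: "R = qspan i j k" and det: "qdet i j k \<noteq> 0"
    and tab: "qtab a b i j k (of_int A) (of_int B) (of_int C) (of_int U) (of_int V) (of_int W)"
    using g by (auto simp: good_basis_def)
  have ST': "of_int S \<noteq> (0::rat)" "of_int T \<noteq> (0::rat)" using ST by auto
  define i' j' where "i' = qscale (1 / of_int S) i" and "j' = qscale (1 / of_int T) j"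
  have e: "of_int A * (1 / of_int T) * 1 / (1 / of_int S) = (of_int A' :: rat)"
    "of_int B * 1 * (1 / of_int S) / (1 / of_int T) = (of_int B' :: rat)"
    "of_int C * (1 / of_int S) * (1 / of_int T) / 1 = (of_int C' :: rat)"
    "1 / of_int S * of_int U = (of_int U' :: rat)" "1 / of_int T * of_int V = (of_int V' :: rat)"
    using ST' d(3-5) arg_cong[OF d(1), of "of_int :: int \<Rightarrow> rat"] arg_cong[OF d(2), of "of_int :: int \<Rightarrow> rat"]
    by (simp_all add: field_simps)
  have "k = qscale 1 k" by (rule quat_eqI) simp_all
  then have tab': "qtab a b i' j' k (of_int A') (of_int B') (of_int C') (of_int U') (of_int V') (of_int W)"
    using qtab_scale[OF tab, of "1 / of_int S" "1 / of_int T" 1] ST' unfolding e i'_def j'_def by simp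
  have "qdet i' j' k = qdet i j k / (of_int S * of_int T)"
    using ST' by (simp add: i'_def j'_def qdet_def field_simps)
  then have det': "qdet i' j' k \<noteq> 0" using det ST' by simp
  have "R \<subseteq> qspan i' j' k"
  proof
    fix x assume "x \<in> R"
    then obtain n x1 y1 z1 :: int where
      "x = qcomb (of_int n) (of_int x1) (of_int y1) (of_int z1) i j k"
      unfolding R qspan_def by blast
    also have "\<dots> = qcomb (of_int n) (of_int (S * x1)) (of_int (T * y1)) (of_int z1) i' j' k"
      using ST' by (intro quat_eqI) (simp_all add: i'_def j'_def)
    finally show "x \<in> qspan i' j' k" unfolding qspan_def by blast
  qed
  then have eq: "qspan i' j' k = R"
    using assms(1) qspan_order[OF det' tab'] by (auto simp: is_maximal_order_def)
  have "j' = qcomb 0 0 (1 / of_int T) 0 i j k" by (rule quat_eqI) (simp_all add: j'_def)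
  moreover have "j' \<in> qspan i j k" using eq qspan_basis(2) R by blast
  ultimately have "1 / of_int T \<in> (\<int> :: rat set)" by (simp add: qcomb_in_qspan[OF det])
  then obtain n where "1 / of_int T = (of_int n :: rat)" by (auto elim: Ints_cases)
  then have "of_int (n * T) = (1 :: rat)" using ST' by (simp add: field_simps)
  then have "n * T = 1" by linarith
  then show False using ST(2) by (metis pos_zmult_eq_1_iff mult.commute zero_less_one less_trans less_irrefl)
qed

text \<open>Up to the factor 4, the Gram matrix of i, j, k under \<open>qip\<close> is the adjugate
  of the Gram matrix of f. This duality is the source of the later determinant and minor
  formulas.\<close>

lemma good_basis_gram:
  assumes "good_basis a b R i j k A B C U V W"
  shows "4 * qip a b i i = of_int (4 * B * C - U\<^sup>2)" "4 * qip a b j j = of_int (4 * A * C - V\<^sup>2)"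
    "4 * qip a b k k = of_int (4 * A * B - W\<^sup>2)" "4 * qip a b i j = of_int (U * V - 2 * C * W)"
    "4 * qip a b i k = of_int (U * W - 2 * B * V)" "4 * qip a b j k = of_int (V * W - 2 * A * U)"
    "4 * qip a b j i = of_int (U * V - 2 * C * W)"
    "4 * qip a b k i = of_int (U * W - 2 * B * V)" "4 * qip a b k j = of_int (V * W - 2 * A * U)"
proof -
  note t = assms[unfolded good_basis_def qtab_def]
  have h: "of_int U = 2 * q0 i" "of_int V = 2 * q0 j" "of_int W = 2 * q0 k" using t by auto
  have n: "qip a b i i = of_int B * of_int C - (q0 i)^2" "qip a b j j = of_int A * of_int C - (q0 j)^2"
    "qip a b k k = of_int A * of_int B - (q0 k)^2"
    using t unfolding qnorm_eq by linarith+
  have m: "qip a b x y = q0 x * q0 y - q0 (qmult a b x y)" for x y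
    by (simp add: qip_def qmult_sel algebra_simps)
  have sym: "qip a b x y = qip a b y x" for x y by (simp add: qip_def algebra_simps)
  have c: "qip a b i j = q0 i * q0 j - of_int C * q0 k" "qip a b k i = q0 k * q0 i - of_int B * q0 j"
    "qip a b j k = q0 j * q0 k - of_int A * q0 i"
    using t unfolding m by simp_all
  show "4 * qip a b i i = of_int (4 * B * C - U\<^sup>2)" "4 * qip a b j j = of_int (4 * A * C - V\<^sup>2)"
    "4 * qip a b k k = of_int (4 * A * B - W\<^sup>2)"
    unfolding n by (simp_all add: h power2_eq_square)
  show 1: "4 * qip a b i j = of_int (U * V - 2 * C * W)"
    "4 * qip a b k i = of_int (U * W - 2 * B * V)" "4 * qip a b j k = of_int (V * W - 2 * A * U)"
    unfolding c by (simp_all add: h)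
  show "4 * qip a b i k = of_int (U * W - 2 * B * V)" "4 * qip a b k j = of_int (V * W - 2 * A * U)"
    "4 * qip a b j i = of_int (U * V - 2 * C * W)"
    using 1 sym by metis+
qed

text \<open>The Gram matrix of f has determinant 2 \<open>tdisc\<close>, so its adjugate has
  determinant 4 \<open>tdisc\<close>^2; the factor 4 in \<open>good_basis_gram\<close> contributes
  4^3.\<close>

lemma good_basis_disc:
  assumes "good_basis a b R i j k A B C U V W"
  shows "(of_int a * of_int b * qdet i j k)\<^sup>2 * 16 = of_int ((tdisc A B C U V W)\<^sup>2)"
proof -
  note G = good_basis_gram[OF assms]
  have "(of_int a * of_int b * qdet i j k)\<^sup>2 * 64 =
      (4 * qip a b i i) * (4 * qip a b j j) * (4 * qip a b k k) + 2 * (4 * qip a b i j) * (4 * qip a b i k) * (4 * qip a b j k)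
     - (4 * qip a b i i) * (4 * qip a b j k)^2 - (4 * qip a b j j) * (4 * qip a b i k)^2 - (4 * qip a b k k) * (4 * qip a b i j)^2"
    unfolding qip_gram_det[symmetric] by (simp add: power2_eq_square algebra_simps)
  also have "\<dots> = of_int (4 * (tdisc A B C U V W)\<^sup>2)"
    unfolding G by (simp add: tdisc_def power2_eq_square algebra_simps)
  finally show ?thesis by simp
qed

lemma good_basis_disc_nonzero:
  assumes "a < 0" "b < 0" "good_basis a b R i j k A B C U V W"
  shows "tdisc A B C U V W \<noteq> 0"
proof
  assume "tdisc A B C U V W = 0"
  then have "(of_int a * of_int b * qdet i j k)\<^sup>2 = 0" using good_basis_disc[OF assms(3)] by simp
  then show False using assms by (auto simp: good_basis_def)
qed

section \<open>Anisotropy modulo l^2 implies ramification at l\<close>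

lemma anisotropic_descent:
  fixes l :: int
  assumes aniso: "\<And>x y z. l\<^sup>2 dvd tform A B C U V W x y z \<Longrightarrow> l dvd x \<and> l dvd y \<and> l dvd z" and "l \<noteq> 0"
  shows "l ^ (2 * n) dvd tform A B C U V W x y z \<Longrightarrow> l ^ n dvd x \<and> l ^ n dvd y \<and> l ^ n dvd z"
proof (induction n arbitrary: x y z)
  case (Suc n)
  have e: "l ^ (2 * Suc n) = l\<^sup>2 * l ^ (2 * n)" by (simp add: power2_eq_square)
  have "l\<^sup>2 dvd tform A B C U V W x y z" using Suc.prems unfolding e by (rule dvd_mult_left)
  then obtain x' y' z' where xyz: "x = l * x'" "y = l * y'" "z = l * z'" using aniso by (meson dvdE)
  have "tform A B C U V W x y z = l\<^sup>2 * tform A B C U V W x' y' z'"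
    unfolding xyz tform_def by (simp add: power2_eq_square algebra_simps)
  then have "l ^ (2 * n) dvd tform A B C U V W x' y' z'"
    using Suc.prems \<open>l \<noteq> 0\<close> unfolding e by simp
  then show ?case using Suc.IH unfolding xyz by simp
qed simp

text \<open>A solution of the conic modulo l^(2n) gives a pure quaternion in R with norm divisible
  by l^(2n). Multiplying its coordinate vector g by the adjugate gives a vector h with f(h)
  divisible by l^(2n), so anisotropy makes h divisible by l^n. Multiplying back by the Gram matrix
  shows that 2Ng is divisible by l^n. Since the solution is primitive, this bounds n.\<close>

lemma anisotropic_ramified:
  fixes l :: nat
  assumes ab: "a < 0" "b < 0" and "is_order a b R" and g: "good_basis a b R i j k A B C U V W" and l: "prime l"
    and aniso: "\<And>x y z. (int l)\<^sup>2 dvd tform A B C U V W x y z \<Longrightarrow> int l dvd x \<and> int l dvd y \<and> int l dvd z"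
  shows "ramified_at a b l"
proof (rule ccontr)
  assume "\<not> ramified_at a b l"
  then have iso: "\<And>n. \<exists>x y z. \<not> (int l dvd x \<and> int l dvd y \<and> int l dvd z) \<and> int l ^ n dvd a * x\<^sup>2 + b * y\<^sup>2 - z\<^sup>2"
    unfolding ramified_at_def by blast
  have R: "R = qspan i j k" using g by (simp add: good_basis_def)
  have lp: "prime (int l)" using l by simp
  have l0: "int l \<noteq> 0" using lp by (metis not_prime_0)
  have fl: "full_lattice R" using assms(3) by (simp add: is_order_def)
  obtain m :: int where m: "m > 0"
    "\<And>x. x \<in> R \<Longrightarrow> of_int m * q0 x \<in> \<int> \<and> of_int m * q1 x \<in> \<int> \<and> of_int m * q2 x \<in> \<int> \<and> of_int m * q3 x \<in> \<int>"
    "\<And>x0 x1 x2 x3 :: int. qscale (of_int m) (Quat (of_int x0) (of_int x1) (of_int x2) (of_int x3)) \<in> R"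
    using fl by (rule full_latticeE) metis
  define N where "N = tdisc A B C U V W"
  \<comment> \<open>Collects the factors lost on the way; what matters is that M is nonzero and
    independent of n.\<close>
  define M where "M = 2 * N * m\<^sup>2 * a * b"
  have M: "M \<noteq> 0" using good_basis_disc_nonzero[OF ab g] ab m(1) by (simp add: M_def N_def)
  have dvdM: "int l ^ n dvd M" for n
  proof -
    obtain X Y Z where prim: "\<not> (int l dvd X \<and> int l dvd Y \<and> int l dvd Z)"
      and conic: "int l ^ (2 * n) dvd a * X\<^sup>2 + b * Y\<^sup>2 - Z\<^sup>2" using iso by blast
    \<comment> \<open>Its norm is -m^2 a b (a X^2 + b Y^2 - Z^2), which is where the conic
      enters.\<close>
    define \<xi> where "\<xi> = qscale (of_int m) (Quat (of_int 0) (of_int (b * Y)) (of_int (a * X)) (of_int Z))"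
    have "\<xi> \<in> R" unfolding \<xi>_def by (rule m(3))
    then obtain n0 x y z :: int where \<xi>: "\<xi> = qcomb (of_int n0) (of_int x) (of_int y) (of_int z) i j k"
      unfolding R qspan_def by blast
    define h1 h2 h3 where "h1 = (4 * B * C - U\<^sup>2) * x + (U * V - 2 * C * W) * y + (U * W - 2 * B * V) * z"
      and "h2 = (U * V - 2 * C * W) * x + (4 * A * C - V\<^sup>2) * y + (V * W - 2 * A * U) * z"
      and "h3 = (U * W - 2 * B * V) * x + (V * W - 2 * A * U) * y + (4 * A * B - W\<^sup>2) * z"
    have "of_int (x * h1 + y * h2 + z * h3) = 4 * qip a b \<xi> \<xi>"
    proof -
      have "4 * qip a b \<xi> \<xi> = of_int x^2 * (4 * qip a b i i) + of_int y^2 * (4 * qip a b j j) + of_int z^2 * (4 * qip a b k k)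
         + 2 * of_int x * of_int y * (4 * qip a b i j) + 2 * of_int x * of_int z * (4 * qip a b i k)
         + 2 * of_int y * of_int z * (4 * qip a b j k)"
        unfolding \<xi> by (simp add: qip_def power2_eq_square algebra_simps)
      also have "\<dots> = of_int (x * h1 + y * h2 + z * h3)"
        unfolding good_basis_gram[OF g] h1_def h2_def h3_def by (simp add: power2_eq_square algebra_simps)
      finally show ?thesis by simp
    qed
    also have "\<dots> = of_int (- 4 * m\<^sup>2 * a * b * (a * X\<^sup>2 + b * Y\<^sup>2 - Z\<^sup>2))"
      by (simp add: \<xi>_def qip_def power2_eq_square algebra_simps)
    finally have gGg: "x * h1 + y * h2 + z * h3 = - 4 * m\<^sup>2 * a * b * (a * X\<^sup>2 + b * Y\<^sup>2 - Z\<^sup>2)"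
      by (simp only: of_int_eq_iff)
    \<comment> \<open>For the Gram matrix G of f, h is adj(G) g, and adj(G) G adj(G) = 2N
      adj(G).\<close>
    have "tform A B C U V W h1 h2 h3 = N * (x * h1 + y * h2 + z * h3)"
      by (simp add: N_def tdisc_def tform_def h1_def h2_def h3_def power2_eq_square algebra_simps)
    then have "int l ^ (2 * n) dvd tform A B C U V W h1 h2 h3" unfolding gGg using conic by simp
    note this' = this
    have "int l ^ n dvd h1 \<and> int l ^ n dvd h2 \<and> int l ^ n dvd h3"
      by (rule anisotropic_descent; fact aniso l0 this')
    then have h: "int l ^ n dvd h1" "int l ^ n dvd h2" "int l ^ n dvd h3" by blast+
    have "2 * N * x = 2 * A * h1 + W * h2 + V * h3" "2 * N * y = W * h1 + 2 * B * h2 + U * h3"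
      "2 * N * z = V * h1 + U * h2 + 2 * C * h3"
      by (simp_all add: N_def tdisc_def h1_def h2_def h3_def power2_eq_square algebra_simps)
    then have g': "int l ^ n dvd 2 * N * x" "int l ^ n dvd 2 * N * y" "int l ^ n dvd 2 * N * z"
      using h by simp_all
    have comp: "int l ^ n dvd 2 * N * m * t"
      if f: "of_int m * f i \<in> \<int>" "of_int m * f j \<in> \<int>" "of_int m * f k \<in> \<int>" 
        "of_int t = of_int x * f i + of_int y * f j + of_int z * f k" for f :: "quat \<Rightarrow> rat" and t
    proof -
      obtain u v w :: int where uvw: "of_int m * f i = of_int u" "of_int m * f j = of_int v" "of_int m * f k = of_int w"
        using f by (auto elim!: Ints_cases)
      have "of_int (2 * N * m * t) = of_int (2 * N) * (of_int x * (of_int m * f i) + of_int y * (of_int m * f j) + of_int z * (of_int m * f k))"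
        using f(4) by (simp add: algebra_simps)
      also have "\<dots> = of_int (2 * N * x * u + 2 * N * y * v + 2 * N * z * w)"
        unfolding uvw by (simp add: algebra_simps)
      finally have "2 * N * m * t = 2 * N * x * u + 2 * N * y * v + 2 * N * z * w" by (simp only: of_int_eq_iff)
      then show ?thesis using g' by simp
    qed
    have den: "of_int m * q1 v \<in> \<int>" "of_int m * q2 v \<in> \<int>" "of_int m * q3 v \<in> \<int>" if "v \<in> {i, j, k}" for v
    proof -
      have "v \<in> R" using that qspan_basis R by blast
      then show "of_int m * q1 v \<in> \<int>" "of_int m * q2 v \<in> \<int>" "of_int m * q3 v \<in> \<int>" using m(2) by blast+
    qed
    have "int l ^ n dvd 2 * N * m * (m * (b * Y))"
      using arg_cong[OF \<xi>, of q1] by (intro comp[of q1] den) (simp_all add: \<xi>_def)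
    then have "int l ^ n dvd a * (2 * N * m * (m * (b * Y)))" by simp
    then have Y: "int l ^ n dvd M * Y" by (simp add: M_def power2_eq_square mult_ac)
    have "int l ^ n dvd 2 * N * m * (m * (a * X))"
      using arg_cong[OF \<xi>, of q2] by (intro comp[of q2] den) (simp_all add: \<xi>_def)
    then have "int l ^ n dvd b * (2 * N * m * (m * (a * X)))" by simp
    then have X: "int l ^ n dvd M * X" by (simp add: M_def power2_eq_square mult_ac)
    have "int l ^ n dvd 2 * N * m * (m * Z)"
      using arg_cong[OF \<xi>, of q3] by (intro comp[of q3] den) (simp_all add: \<xi>_def)
    then have "int l ^ n dvd a * b * (2 * N * m * (m * Z))" by simp
    then have Z: "int l ^ n dvd M * Z" by (simp add: M_def power2_eq_square mult_ac)
    have "int l ^ n dvd M" if "\<not> int l dvd t" "int l ^ n dvd M * t" for t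
    proof -
      have "coprime (int l ^ n) t" using that(1) lp by (simp add: prime_imp_coprime)
      then show ?thesis using that(2) by (simp add: coprime_dvd_mult_left_iff)
    qed
    then show ?thesis using prim X Y Z by blast
  qed
  have "int l ^ nat \<bar>M\<bar> \<le> \<bar>M\<bar>" using dvd_imp_le_int[OF M dvdM] by simp
  moreover have "int l ^ nat \<bar>M\<bar> \<ge> 2 ^ nat \<bar>M\<bar>" using prime_ge_2_nat[OF l] by (intro power_mono) auto
  moreover have "\<bar>M\<bar> < 2 ^ nat \<bar>M\<bar>"
  proof -
    have "int (nat \<bar>M\<bar>) < int (2 ^ nat \<bar>M\<bar>)" using less_exp[of "nat \<bar>M\<bar>"] by linarith
    then show ?thesis by simp
  qed
  ultimately show False by linarith
qed

lemma maximal_order_disc: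
  assumes p: "is_Bp p a b" and R: "is_maximal_order a b R" and g: "good_basis a b R i j k A B C U V W" and "prime p"
  shows "\<bar>tdisc A B C U V W\<bar> = 1 \<or> \<bar>tdisc A B C U V W\<bar> = int p"
proof -
  have ab: "a < 0" "b < 0" using p by (auto simp: is_Bp_def ramified_infty_def)
  have ord: "is_order a b R" using R by (simp add: is_maximal_order_def)
  \<comment> \<open>The coefficients of all good bases of the fixed order R: the class to which the
    normal form is applied.\<close>
  define P where "P A B C U V W \<longleftrightarrow> (\<exists>i j k. good_basis a b R i j k A B C U V W)" for A B C U V W
  let ?N = "tdisc A B C U V W"
  have key: "l = int p \<and> \<not> l\<^sup>2 dvd ?N" if l: "prime l" "l dvd ?N" for l :: int
  proof -
    have l1: "l > 1" using l(1) prime_gt_1_int by blast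
    have c: "P A B C U V W \<Longrightarrow> P B C A V W U" for A B C U V W
      unfolding P_def using good_basis_cycle by blast
    have s: "P A B C U V W \<Longrightarrow> P A B (C + A * s\<^sup>2 + B * t\<^sup>2 + U * t + V * s + W * s * t)
       (U + 2 * B * t + W * s) (V + 2 * A * s + W * t) W" for A B C U V W s t
      unfolding P_def using good_basis_shear[OF ab] by blast
    \<comment> \<open>Otherwise i/l and j/l could be adjoined, with S = T = l.\<close>
    have d: "\<not> (l dvd U \<and> l dvd V \<and> l\<^sup>2 dvd C)" if P: "P A B C U V W" for A B C U V W
    proof
      assume "l dvd U \<and> l dvd V \<and> l\<^sup>2 dvd C"
      then obtain u v c where "U = l * u" "V = l * v" "C = l * l * c"
        unfolding power2_eq_square by (elim conjE dvdE)
      moreover obtain i j k where "good_basis a b R i j k A B C U V W" using P unfolding P_def by (elim exE)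
      ultimately show False using l1
        by (intro maximal_no_enlargement[OF R, of i j k A B C U V W l l A B c u v]) simp_all
    qed
    \<comment> \<open>Otherwise j/l could be adjoined, with S = 1 and T = l; B is then replaced by B
      l.\<close>
    have e: "\<not> (l dvd A \<and> l dvd C \<and> l dvd V)" if P: "P A B C U V W" for A B C U V W
    proof
      assume "l dvd A \<and> l dvd C \<and> l dvd V"
      then obtain a' c v where "A = l * a'" "V = l * v" "C = l * c" by (elim conjE dvdE)
      moreover obtain i j k where "good_basis a b R i j k A B C U V W" using P unfolding P_def by (elim exE)
      ultimately show False using l1
        by (intro maximal_no_enlargement[OF R, of i j k A B C U V W 1 l a' "B * l" c U v]) simp_all
    qed
    have P: "P A B C U V W" unfolding P_def using g by blast
    obtain A' B' C' U' V' W' where P': "P A' B' C' U' V' W'" "tdisc A' B' C' U' V' W' = ?N"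
      "l dvd C'" "l dvd U'" "l dvd V'"
    proof -
      have "\<exists>A' B' C' U' V' W'. P A' B' C' U' V' W' \<and> tdisc A' B' C' U' V' W' = ?N \<and>
          l dvd C' \<and> l dvd U' \<and> l dvd V'"
        by (rule radical_normal_form[where P = P and l = l]; fact c s d e l P)
      then show ?thesis using that by (elim exE conjE)
    qed
    have an4: "\<not> l\<^sup>2 dvd tdisc A' B' C' U' V' W'"
      by (rule radical_anisotropic(4)[where P = P and l = l]; fact c s d e l P')
    have an5: "l dvd x \<and> l dvd y \<and> l dvd z" if "l\<^sup>2 dvd tform A' B' C' U' V' W' x y z" for x y z
      by (rule radical_anisotropic(5)[where P = P and l = l]; fact c s d e l P' that)
    obtain i' j' k' where g': "good_basis a b R i' j' k' A' B' C' U' V' W'" using P'(1) unfolding P_def by (elim exE)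
    have ln: "l = int (nat l)" "prime (nat l)" using l1 l(1) by auto
    have "ramified_at a b (nat l)"
      by (rule anisotropic_ramified[OF ab ord g' ln(2)]) (use an5 ln(1) in simp)
    then have "nat l = p" using p ln(2) by (auto simp: is_Bp_def)
    then show ?thesis using an4 P'(2) ln(1) by auto
  qed
  have N0: "?N \<noteq> 0" by (rule good_basis_disc_nonzero[OF ab g])
  show ?thesis
  proof (cases "\<bar>?N\<bar> = 1")
    case False
    have "\<not> is_unit ?N" using False by simp
    then obtain l where l: "prime l" "l dvd ?N" using prime_divisor_exists[OF N0] by blast
    then have lp: "l = int p" "\<not> l\<^sup>2 dvd ?N" using key by auto
    obtain M where M: "?N = l * M" using l(2) by (elim dvdE)
    \<comment> \<open>A further prime factor would again be p, and p^2 would divide the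
      discriminant.\<close>
    have "is_unit M"
    proof (rule ccontr)
      assume "\<not> is_unit M"
      then obtain l' where l': "prime l'" "l' dvd M" using prime_divisor_exists[of M] N0 M by auto
      then have "l' = int p" using key[of l'] M by simp
      then have "l\<^sup>2 dvd ?N" using l'(2) lp M by (simp add: power2_eq_square)
      then show False using lp by blast
    qed
    then show ?thesis using M lp by (simp add: abs_mult)
  qed simp
qed

section \<open>The Gross lattice\<close>

text \<open>Generators may be 0, so that \<open>lat u 0 0\<close> and \<open>lat u v 0\<close> are
  the line and the plane generated by the first basis vectors.\<close>

definition lat :: "quat \<Rightarrow> quat \<Rightarrow> quat \<Rightarrow> quat set" where
  "lat u v w = {qcomb 0 (of_int x) (of_int y) (of_int z) u v w | x y z. True}"

lemma qip_comm: "qip a b x y = qip a b y x"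
  by (simp add: qip_def algebra_simps)

lemma qip_linear:
  "qip a b (x + y) z = qip a b x z + qip a b y z" "qip a b z (x + y) = qip a b z x + qip a b z y"
  "qip a b (x - y) z = qip a b x z - qip a b y z" "qip a b z (x - y) = qip a b z x - qip a b z y"
  "qip a b (qscale c x) z = c * qip a b x z" "qip a b z (qscale c x) = c * qip a b z x"
  "qip a b (- x) z = - qip a b x z" "qip a b z (- x) = - qip a b z x"
  "qip a b 0 z = 0" "qip a b z 0 = 0" "qip a b qone z = 0" "qip a b z qone = 0"
  by (simp_all add: qip_def algebra_simps)

lemma qip_qcomb:
  "qip a b (qcomb n x y z u v w) (qcomb n' x' y' z' u v w) =
     x * x' * qip a b u u + y * y' * qip a b v v + z * z' * qip a b w w
     + (x * y' + y * x') * qip a b u v + (x * z' + z * x') * qip a b u w + (y * z' + z * y') * qip a b v w"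
  by (simp add: qcomb_def qip_linear qip_comm[of a b v u] qip_comm[of a b w u] qip_comm[of a b w v] algebra_simps)

lemma qcomb_add: "qcomb n x y z u v w + qcomb n' x' y' z' u v w = qcomb (n + n') (x + x') (y + y') (z + z') u v w"
  and qcomb_diff: "qcomb n x y z u v w - qcomb n' x' y' z' u v w = qcomb (n - n') (x - x') (y - y') (z - z') u v w"
  and qcomb_scale: "qscale c (qcomb n x y z u v w) = qcomb (c * n) (c * x) (c * y) (c * z) u v w"
  by (rule quat_eqI; simp add: algebra_simps)+

lemma lat_group:
  "x \<in> lat u v w \<Longrightarrow> y \<in> lat u v w \<Longrightarrow> x + y \<in> lat u v w"
  "x \<in> lat u v w \<Longrightarrow> y \<in> lat u v w \<Longrightarrow> x - y \<in> lat u v w"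
  "x \<in> lat u v w \<Longrightarrow> qscale (of_int n) x \<in> lat u v w"
  "0 \<in> lat u v w" "x \<in> lat u v w \<Longrightarrow> - x \<in> lat u v w"
  "u \<in> lat u v w" "v \<in> lat u v w" "w \<in> lat u v w"
proof -
  have I: "qcomb 0 n m k u v w \<in> lat u v w" if "n \<in> \<int>" "m \<in> \<int>" "k \<in> \<int>" for n m k
    using that unfolding lat_def by (auto elim!: Ints_cases)
  show 1: "x + y \<in> lat u v w" "x - y \<in> lat u v w" if xy: "x \<in> lat u v w" "y \<in> lat u v w" for x y
  proof -
    from xy obtain x1 x2 x3 y1 y2 y3 where
      "x = qcomb 0 (of_int x1) (of_int x2) (of_int x3) u v w"
      "y = qcomb 0 (of_int y1) (of_int y2) (of_int y3) u v w"
      unfolding lat_def by blast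
    then have "x + y = qcomb 0 (of_int (x1 + y1)) (of_int (x2 + y2)) (of_int (x3 + y3)) u v w"
      "x - y = qcomb 0 (of_int (x1 - y1)) (of_int (x2 - y2)) (of_int (x3 - y3)) u v w"
      by (simp_all add: qcomb_add qcomb_diff)
    then show "x + y \<in> lat u v w" "x - y \<in> lat u v w" by (auto intro!: I)
  qed
  show "qscale (of_int n) x \<in> lat u v w" if x: "x \<in> lat u v w"
  proof -
    from x obtain x1 x2 x3 where "x = qcomb 0 (of_int x1) (of_int x2) (of_int x3) u v w"
      unfolding lat_def by blast
    then have "qscale (of_int n) x = qcomb 0 (of_int (n * x1)) (of_int (n * x2)) (of_int (n * x3)) u v w"
      by (simp add: qcomb_scale)
    then show ?thesis by (auto intro!: I)
  qed
  have "0 = qcomb 0 (of_int 0) (of_int 0) (of_int 0) u v w" by (rule quat_eqI) simp_all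
  then show 0: "0 \<in> lat u v w" using I[of 0 0 0] by simp
  show "- x \<in> lat u v w" if "x \<in> lat u v w"
    using 1(2)[OF 0 that] by simp

  have "u = qcomb 0 (of_int 1) (of_int 0) (of_int 0) u v w" "v = qcomb 0 (of_int 0) (of_int 1) (of_int 0) u v w"
    "w = qcomb 0 (of_int 0) (of_int 0) (of_int 1) u v w"
    by (rule quat_eqI; simp)+
  then show "u \<in> lat u v w" "v \<in> lat u v w" "w \<in> lat u v w" using I[of 1 0 0] I[of 0 1 0] I[of 0 0 1] by simp_all
qed

definition gross :: "quat set \<Rightarrow> quat set" where
  "gross R = (\<lambda>x. Quat 0 (2 * q1 x) (2 * q2 x) (2 * q3 x)) ` R"

text \<open>In the application, L is the Gross lattice of an order of reduced discriminant m.\<close>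

locale gross_lattice =
  fixes a b :: int and L :: "quat set" and m :: int
  assumes neg: "a < 0" "b < 0" and m_pos: "m > 0"
    and lattice: "\<exists>u v w. L = lat u v w \<and> qdet u v w \<noteq> 0 \<and> q0 u = 0 \<and> q0 v = 0 \<and> q0 w = 0 \<and>
      (of_int a * of_int b * qdet u v w)\<^sup>2 = of_int (4 * m\<^sup>2)"
    and norm: "v \<in> L \<Longrightarrow> \<exists>D::int. qip a b v v = of_int D \<and> (4 dvd D \<or> 4 dvd D + 1)"
    and ip: "v \<in> L \<Longrightarrow> w \<in> L \<Longrightarrow> qip a b v w \<in> \<int>"
    and minor: "v \<in> L \<Longrightarrow> w \<in> L \<Longrightarrow> \<exists>k::int. qip a b v v * qip a b w w - (qip a b v w)\<^sup>2 = of_int (4 * m * k)"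

text \<open>The trace is integral on the basis; the constant coordinate of x^2 = tr(x) x - N(x), an
  element of R, then shows that N(x) is an integer.\<close>

lemma norm_trace_int:
  assumes "is_order a b R" "good_basis a b R i j k A B C U V W" "x \<in> R"
  shows "2 * q0 x \<in> \<int>" "qnorm a b x \<in> \<int>"
proof -
  have R: "R = qspan i j k" "qdet i j k \<noteq> 0" and t: "of_int U = 2 * q0 i" "of_int V = 2 * q0 j" "of_int W = 2 * q0 k"
    using assms(2) by (auto simp: good_basis_def qtab_def)
  obtain n x1 y1 z1 :: int where x: "x = qcomb (of_int n) (of_int x1) (of_int y1) (of_int z1) i j k"
    using assms(3) unfolding R qspan_def by blast
  have tr: "2 * q0 x = of_int (2 * n + x1 * U + y1 * V + z1 * W)"
    unfolding x by (simp add: t algebra_simps)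
  then show "2 * q0 x \<in> \<int>" by simp
  have "qmult a b x x \<in> R" using assms(1,3) by (simp add: is_order_def)
  have "qcomb (of_int (2 * n + x1 * U + y1 * V + z1 * W) * of_int n - qnorm a b x)
     (of_int (2 * n + x1 * U + y1 * V + z1 * W) * of_int x1) (of_int (2 * n + x1 * U + y1 * V + z1 * W) * of_int y1)
     (of_int (2 * n + x1 * U + y1 * V + z1 * W) * of_int z1) i j k = qmult a b x x"
    unfolding qmult_self tr unfolding x by (rule quat_eqI) (simp_all add: algebra_simps)
  then have "of_int (2 * n + x1 * U + y1 * V + z1 * W) * of_int n - qnorm a b x \<in> \<int>"
    using \<open>qmult a b x x \<in> R\<close> qcomb_in_qspan[OF R(2)] unfolding R(1) by metis
  then have "of_int ((2 * n + x1 * U + y1 * V + z1 * W) * n) - (of_int (2 * n + x1 * U + y1 * V + z1 * W) * of_int n - qnorm a b x) \<in> \<int>"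
    by (metis Ints_diff Ints_of_int)
  then show "qnorm a b x \<in> \<int>" by simp
qed

text \<open>This is minus the discriminant of the characteristic polynomial of x.\<close>

lemma gross_norm: "qip a b (Quat 0 (2 * q1 x) (2 * q2 x) (2 * q3 x)) (Quat 0 (2 * q1 x) (2 * q2 x) (2 * q3 x))
   = 4 * qnorm a b x - (2 * q0 x)^2"
  by (simp add: qnorm_eq qip_def power2_eq_square algebra_simps)

lemma square_mod_4:
  fixes t :: int
  shows "4 dvd t\<^sup>2 \<or> 4 dvd t\<^sup>2 - 1"
proof (cases "even t")
  case True
  then obtain s where "t = 2 * s" by (elim evenE)
  then have "t\<^sup>2 = 4 * s\<^sup>2" by (simp add: power2_eq_square)
  then show ?thesis by simp
next
  case False
  then obtain s where "t = 2 * s + 1" by (elim oddE)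
  then have "t\<^sup>2 - 1 = 4 * (s\<^sup>2 + s)" by (simp add: power2_eq_square algebra_simps)
  then show ?thesis by simp
qed

text \<open>The Gram matrix of the Gross lattice is exactly the adjugate of that of f: doubling the
  imaginary parts absorbs the 4 of \<open>good_basis_gram\<close>.\<close>

lemma gross_is_gross_lattice:
  assumes ab: "a < 0" "b < 0" and ord: "is_order a b R" and g: "good_basis a b R i j k A B C U V W"
  shows "gross_lattice a b (gross R) \<bar>tdisc A B C U V W\<bar>"
proof
  let ?N = "tdisc A B C U V W"
  show "a < 0" "b < 0" by fact+
  show "\<bar>?N\<bar> > 0" using good_basis_disc_nonzero[OF ab g] by simp
  have R: "R = qspan i j k" "qdet i j k \<noteq> 0" using g by (auto simp: good_basis_def)
  define d where "d x = Quat 0 (2 * q1 x) (2 * q2 x) (2 * q3 x)" for x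
  have dq: "d (qcomb n x y z i j k) = qcomb 0 x y z (d i) (d j) (d k)" for n x y z
    by (rule quat_eqI) (simp_all add: d_def algebra_simps)
  have L: "gross R = lat (d i) (d j) (d k)"
  proof
    show "gross R \<subseteq> lat (d i) (d j) (d k)"
      unfolding gross_def R(1) qspan_def lat_def d_def[symmetric] using dq by blast
    show "lat (d i) (d j) (d k) \<subseteq> gross R"
    proof
      fix v assume "v \<in> lat (d i) (d j) (d k)"
      then obtain x y z :: int where "v = d (qcomb (of_int 0) (of_int x) (of_int y) (of_int z) i j k)"
        unfolding lat_def dq by auto
      then show "v \<in> gross R" unfolding gross_def R(1) qspan_def d_def by blast
    qed
  qed
  have det: "qdet (d i) (d j) (d k) = 8 * qdet i j k" by (simp add: d_def qdet_def algebra_simps)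
  show "\<exists>u v w. gross R = lat u v w \<and> qdet u v w \<noteq> 0 \<and> q0 u = 0 \<and> q0 v = 0 \<and> q0 w = 0 \<and>
      (of_int a * of_int b * qdet u v w)\<^sup>2 = of_int (4 * \<bar>?N\<bar>\<^sup>2)"
  proof (intro exI conjI)
    show "gross R = lat (d i) (d j) (d k)" by (rule L)
    show "qdet (d i) (d j) (d k) \<noteq> 0" unfolding det using R(2) by simp
    show "(of_int a * of_int b * qdet (d i) (d j) (d k))\<^sup>2 = of_int (4 * \<bar>?N\<bar>\<^sup>2)"
      using good_basis_disc[OF g] unfolding det by (simp add: power2_eq_square algebra_simps)
  qed (simp_all add: d_def)
  show "\<exists>D::int. qip a b v v = of_int D \<and> (4 dvd D \<or> 4 dvd D + 1)" if v: "v \<in> gross R" for v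
  proof -
    from v obtain x where x: "x \<in> R" "v = Quat 0 (2 * q1 x) (2 * q2 x) (2 * q3 x)" unfolding gross_def by blast
    obtain t n where tn: "2 * q0 x = of_int t" "qnorm a b x = of_int n"
      using norm_trace_int[OF ord g x(1)] by (auto elim!: Ints_cases)
    have "qip a b v v = of_int (4 * n - t\<^sup>2)" unfolding x(2) gross_norm tn by simp
    moreover have "4 dvd 4 * n - t\<^sup>2 \<or> 4 dvd 4 * n - t\<^sup>2 + 1"
    proof -
      have "4 * n - t\<^sup>2 + 1 = 4 * n - (t\<^sup>2 - 1)" by simp
      then show ?thesis using square_mod_4[of t] by (metis dvd_diff dvd_triv_left)
    qed
    ultimately show ?thesis by blast
  qed
  note G = good_basis_gram[OF g]
  have dd: "qip a b (d x) (d y) = 4 * qip a b x y" for x y by (simp add: d_def qip_def)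
  have I: "\<exists>x y z. v = qcomb 0 (of_int x) (of_int y) (of_int z) (d i) (d j) (d k)" if "v \<in> gross R" for v
    using that unfolding L lat_def by blast
  show "qip a b v w \<in> \<int>" if vw: "v \<in> gross R" "w \<in> gross R" for v w
  proof -
    obtain x y z x' y' z' where e: "v = qcomb 0 (of_int x) (of_int y) (of_int z) (d i) (d j) (d k)"
      "w = qcomb 0 (of_int x') (of_int y') (of_int z') (d i) (d j) (d k)"
      using I[OF vw(1)] I[OF vw(2)] by blast
    show ?thesis unfolding e qip_qcomb dd G by simp
  qed
  show "\<exists>k::int. qip a b v v * qip a b w w - (qip a b v w)\<^sup>2 = of_int (4 * \<bar>?N\<bar> * k)"
    if vw: "v \<in> gross R" "w \<in> gross R" for v w
  proof -
    obtain x y z x' y' z' where e: "v = qcomb 0 (of_int x) (of_int y) (of_int z) (d i) (d j) (d k)"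
      "w = qcomb 0 (of_int x') (of_int y') (of_int z') (d i) (d j) (d k)"
      using I[OF vw(1)] I[OF vw(2)] by blast
    define Q where "Q x y z x' y' z' = x * x' * (4 * B * C - U\<^sup>2) + y * y' * (4 * A * C - V\<^sup>2) + z * z' * (4 * A * B - W\<^sup>2)
      + (x * y' + y * x') * (U * V - 2 * C * W) + (x * z' + z * x') * (U * W - 2 * B * V) + (y * z' + z * y') * (V * W - 2 * A * U)"
      for x y z x' y' z' :: int
    have q: "qip a b (qcomb 0 (of_int x) (of_int y) (of_int z) (d i) (d j) (d k))
       (qcomb 0 (of_int x') (of_int y') (of_int z') (d i) (d j) (d k)) = of_int (Q x y z x' y' z')" for x y z x' y' z'
      unfolding qip_qcomb dd G Q_def by simp
    \<comment> \<open>Minors of an adjugate lead back to the original matrix G: the Gram determinant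
      of two vectors is det(G) times the value of G on their cross product, that is, 2N times
      2f.\<close>
    have "Q x y z x y z * Q x' y' z' x' y' z' - (Q x y z x' y' z')\<^sup>2
       = 4 * ?N * tform A B C U V W (y * z' - z * y') (z * x' - x * z') (x * y' - y * x')"
      unfolding Q_def tdisc_def tform_def power2_eq_square by algebra
    also have "\<dots> = 4 * \<bar>?N\<bar> * (sgn ?N * tform A B C U V W (y * z' - z * y') (z * x' - x * z') (x * y' - y * x'))"
      by (metis (no_types, lifting) mult.assoc abs_mult_sgn)
    finally have "qip a b v v * qip a b w w - (qip a b v w)\<^sup>2 =
       of_int (4 * \<bar>?N\<bar> * (sgn ?N * tform A B C U V W (y * z' - z * y') (z * x' - x * z') (x * y' - y * x')))"
      unfolding e q by (metis of_int_diff of_int_mult of_int_power)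
    then show ?thesis by blast
  qed
qed

text \<open>If y in R has the same imaginary part as x, then tr(x)^2 - tr(y)^2 = 4 (N(x) - N(y)). So
  integral traces and norms force the traces to have the same parity, and x - y is an integer. The
  order is thus recovered from its Gross lattice.\<close>

lemma in_order_iff_gross:
  assumes ord: "is_order a b R" and g: "good_basis a b R i j k A B C U V W"
  shows "x \<in> R \<longleftrightarrow> Quat 0 (2 * q1 x) (2 * q2 x) (2 * q3 x) \<in> gross R \<and>
    (\<exists>t n :: int. 2 * q0 x = of_int t \<and> qnorm a b x = of_int n)"
proof
  assume "x \<in> R"
  then show "Quat 0 (2 * q1 x) (2 * q2 x) (2 * q3 x) \<in> gross R \<and> (\<exists>t n :: int. 2 * q0 x = of_int t \<and> qnorm a b x = of_int n)"
    using norm_trace_int[OF ord g] by (auto simp: gross_def elim!: Ints_cases)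
next
  assume r: "Quat 0 (2 * q1 x) (2 * q2 x) (2 * q3 x) \<in> gross R \<and> (\<exists>t n :: int. 2 * q0 x = of_int t \<and> qnorm a b x = of_int n)"
  then obtain t n :: int where tn: "2 * q0 x = of_int t" "qnorm a b x = of_int n" by blast
  obtain y where y: "y \<in> R" "q1 y = q1 x" "q2 y = q2 x" "q3 y = q3 x" using r by (auto simp: gross_def)
  obtain t' n' :: int where tn': "2 * q0 y = of_int t'" "qnorm a b y = of_int n'"
    using norm_trace_int[OF ord g y(1)] by (auto elim!: Ints_cases)
  have "4 * qnorm a b x - (2 * q0 x)^2 = 4 * qnorm a b y - (2 * q0 y)^2"
    using y by (simp add: qnorm_eq qip_def power2_eq_square)
  then have "of_int (4 * n - t\<^sup>2) = (of_int (4 * n' - t'\<^sup>2) :: rat)" unfolding tn tn' by simp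
  then have "t\<^sup>2 - t'\<^sup>2 = 2 * (2 * (n - n'))" unfolding of_int_eq_iff by simp
  then have "even (t\<^sup>2 - t'\<^sup>2)" by simp
  then have "even (t - t')" by simp
  then obtain s where s: "t - t' = 2 * s" by (elim evenE)
  have "q0 x = q0 y + of_int s" using tn(1) tn'(1) arg_cong[OF s, of "of_int :: int \<Rightarrow> rat"] by simp
  then have "x = y + qscale (of_int s) qone" using y by (intro quat_eqI) simp_all
  moreover have "full_lattice R" "qone \<in> R" using ord by (auto simp: is_order_def)
  then have "y + qscale (of_int s) qone \<in> R" using y(1)
    by - (erule full_latticeE, metis)
  ultimately show "x \<in> R" by simp
qed

section \<open>Reduced bases\<close>

text \<open>The excluded sublattices consist of the lattice vectors dependent on the previous basis
  vectors, so the three norms are the successive minima.\<close>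

definition reduced_basis :: "int \<Rightarrow> int \<Rightarrow> quat set \<Rightarrow> quat \<Rightarrow> quat \<Rightarrow> quat \<Rightarrow> bool" where
  "reduced_basis a b L u v w \<longleftrightarrow> L = lat u v w \<and> qdet u v w \<noteq> 0 \<and> q0 u = 0 \<and> q0 v = 0 \<and> q0 w = 0 \<and>
     (\<forall>x\<in>L. x \<noteq> 0 \<longrightarrow> qip a b u u \<le> qip a b x x) \<and>
     (\<forall>x\<in>L. x \<notin> lat u 0 0 \<longrightarrow> qip a b v v \<le> qip a b x x) \<and>
     (\<forall>x\<in>L. x \<notin> lat u v 0 \<longrightarrow> qip a b w w \<le> qip a b x x)"

lemma qdet_qcomb:
  "qdet (qcomb n x y z u v w) s t = x * qdet u s t + y * qdet v s t + z * qdet w s t"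
  "qdet s (qcomb n x y z u v w) t = x * qdet s u t + y * qdet s v t + z * qdet s w t"
  "qdet s t (qcomb n x y z u v w) = x * qdet s t u + y * qdet s t v + z * qdet s t w"
  by (simp_all add: qdet_def algebra_simps)

lemma qdet_alt [simp]: "qdet u u w = 0" "qdet u w u = 0" "qdet w u u = 0"
  by (simp_all add: qdet_def algebra_simps)

text \<open>The squared lengths h2 and h3 of v and w after projection away from the previous vectors
  control how short a vector becomes when its coordinates are rounded from last to first.\<close>

lemma gram_schmidt:
  assumes ab: "a < 0" "b < 0" and det: "qdet u v w \<noteq> 0"
  obtains h2 h3 r s t where "h2 > 0" "h3 > 0"
    "\<And>x y z. qip a b (qcomb 0 x y z u v w) (qcomb 0 x y z u v w) =
        qip a b u u * (x + r * y + s * z)\<^sup>2 + h2 * (y + t * z)\<^sup>2 + h3 * z\<^sup>2"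
    "qip a b u u * h2 = qip a b u u * qip a b v v - (qip a b u v)\<^sup>2"
    "qip a b u u * h2 * h3 = (of_int a * of_int b * qdet u v w)\<^sup>2"
proof -
  have pos: "qip a b x x > 0" if "qdet x y z \<noteq> 0" for x y z
  proof -
    have "qip a b x x \<noteq> 0" using that qip_pos(2)[OF ab, of x] by (auto simp: qdet_def)
    then show ?thesis using qip_pos(1)[OF ab, of x] by simp
  qed
  define D where "D = qip a b u u"
  have D: "D > 0" unfolding D_def by (rule pos[OF det])
  define r where "r = qip a b u v / D"
  define v' where "v' = v - qscale r u"
  define h2 where "h2 = qip a b v' v'"
  have uv': "qip a b u v' = 0" using D by (simp add: v'_def qip_linear r_def D_def)
  have "qdet v' w u = qdet u v w" by (simp add: v'_def qdet_def algebra_simps)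
  then have h2: "h2 > 0" unfolding h2_def using pos[of v' w u] det by simp
  define s where "s = qip a b u w / D"
  define t where "t = qip a b v' w / h2"
  define w' where "w' = w - qscale s u - qscale t v'"
  define h3 where "h3 = qip a b w' w'"
  have uw': "qip a b u w' = 0" using D uv' by (simp add: w'_def qip_linear s_def D_def)
  have vw': "qip a b v' w' = 0" using h2 uv' 
    by (simp add: w'_def qip_linear t_def h2_def qip_comm[of a b v' u])
  have "qdet w' u v' = qdet u v w" by (simp add: w'_def v'_def qdet_def algebra_simps)
  then have h3: "h3 > 0" unfolding h3_def using pos[of w' u v'] det by simp
  have "qdet u v' w' = qdet u v w" by (simp add: w'_def v'_def qdet_def algebra_simps)
  then have "(of_int a * of_int b * qdet u v w)\<^sup>2 = D * h2 * h3"
    using qip_gram_det[of a b u v' w'] by (simp add: uv' uw' vw' D_def h2_def h3_def)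
  moreover have "D * h2 = D * qip a b v v - (qip a b u v)\<^sup>2"
  proof -
    have "h2 = qip a b v v - 2 * r * qip a b u v + r^2 * D"
      by (simp add: h2_def v'_def qip_linear qip_comm[of a b v u] D_def power2_eq_square algebra_simps)
    then show ?thesis using D by (simp add: r_def field_simps power2_eq_square)
  qed
  moreover have "qip a b (qcomb 0 x y z u v w) (qcomb 0 x y z u v w) =
      D * (x + r * y + s * z)\<^sup>2 + h2 * (y + t * z)\<^sup>2 + h3 * z\<^sup>2" for x y z
  proof -
    have "qcomb 0 x y z u v w = qcomb 0 (x + r * y + s * z) (y + t * z) z u v' w'"
      by (rule quat_eqI) (simp_all add: v'_def w'_def algebra_simps)
    then show ?thesis
      by (simp add: qip_qcomb uv' uw' vw' D_def h2_def h3_def power2_eq_square)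
  qed
  ultimately show ?thesis using that[OF h2 h3, of r s t] by (simp add: D_def)
qed

lemma round_sq: "\<exists>n::int. (c - of_int n)\<^sup>2 \<le> (1/4 :: rat)"
proof -
  have "\<bar>of_int (round c) - c\<bar> \<le> 1/2" by (rule of_int_round_abs_le)
  then have "\<bar>c - of_int (round c)\<bar> \<le> 1/2" by (simp only: abs_minus_commute)
  then have "\<bar>c - of_int (round c)\<bar>\<^sup>2 \<le> (1/2)\<^sup>2" by (intro power_mono) simp_all
  then show ?thesis by (intro exI[of _ "round c"]) (simp add: power2_eq_square)
qed

text \<open>The second conjunct ensures that rounding a fractional last coordinate does not land in
  the span of the earlier basis vectors.\<close>

lemma rat_int_or_nonzero_frac: "\<exists>n::int. (c - of_int n)\<^sup>2 \<le> (1/4 :: rat) \<and> (c \<in> \<int> \<or> c - of_int n \<noteq> 0)"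
  using round_sq[of c] by (metis Ints_of_int diff_add_cancel add_0)

context gross_lattice
begin

abbreviation (input) nm where "nm x \<equiv> qip a b x x"

lemma closed:
  "x \<in> L \<Longrightarrow> y \<in> L \<Longrightarrow> x + y \<in> L" "x \<in> L \<Longrightarrow> y \<in> L \<Longrightarrow> x - y \<in> L"
  "x \<in> L \<Longrightarrow> qscale (of_int n) x \<in> L" "0 \<in> L" "x \<in> L \<Longrightarrow> - x \<in> L"
  "x \<in> L \<Longrightarrow> q0 x = 0"
proof -
  obtain u v w where L: "L = lat u v w" and q: "q0 u = 0" "q0 v = 0" "q0 w = 0" using lattice by blast
  show "x \<in> L \<Longrightarrow> y \<in> L \<Longrightarrow> x + y \<in> L" "x \<in> L \<Longrightarrow> y \<in> L \<Longrightarrow> x - y \<in> L"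
    "x \<in> L \<Longrightarrow> qscale (of_int n) x \<in> L" "0 \<in> L" "x \<in> L \<Longrightarrow> - x \<in> L"
    unfolding L by (fact lat_group)+
  show "x \<in> L \<Longrightarrow> q0 x = 0" unfolding L lat_def using q by auto
qed

lemma nm_eq_0: "x \<in> L \<Longrightarrow> nm x = 0 \<longleftrightarrow> x = 0"
  using qip_pos(2)[OF neg, of x] closed(6)[of x] by (auto intro: quat_eqI)

lemma nm_pos: "x \<in> L \<Longrightarrow> x \<noteq> 0 \<Longrightarrow> nm x > 0"
  using nm_eq_0 qip_pos(1)[OF neg, of x] by force

lemma nm_minimum:
  assumes "S \<subseteq> L" "s \<in> S"
  obtains v where "v \<in> S" "\<And>w. w \<in> S \<Longrightarrow> nm v \<le> nm w"
proof -
  obtain v where v: "v \<in> S" "\<And>w. w \<in> S \<Longrightarrow> nat \<lfloor>nm v\<rfloor> \<le> nat \<lfloor>nm w\<rfloor>"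
    using ex_has_least_nat[of "\<lambda>x. x \<in> S" s "\<lambda>x. nat \<lfloor>nm x\<rfloor>"] assms(2) by blast
  have "nm v \<le> nm w" if w: "w \<in> S" for w
  proof -
    obtain D E where DE: "nm v = of_int D" "nm w = of_int E" using norm v(1) w assms(1) by blast
    have "nm v \<ge> 0" "nm w \<ge> 0" using qip_pos(1)[OF neg] by auto
    then show ?thesis using v(2)[OF w] DE by simp
  qed
  then show ?thesis using that v(1) by blast
qed

text \<open>In rank three, vectors attaining the successive minima generate L. A lattice vector with
  fractional last coordinate could be rounded to one of norm at most (D1 + h2 + h3)/4 \<le> 3/4 D3,
  still independent of u and v, against the minimality of w. The other two coordinates are treated
  in the same way with fewer terms.\<close>

lemma reduced_basis_exists: "\<exists>u v w. reduced_basis a b L u v w"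
proof -
  obtain l1 l2 l3 where l: "L = lat l1 l2 l3" "qdet l1 l2 l3 \<noteq> 0" using lattice by blast
  have lL: "l1 \<in> L" "l2 \<in> L" "l3 \<in> L" unfolding l(1) by (rule lat_group)+
  have span: "\<exists>n x y z. q = qcomb n x y z l1 l2 l3" for q using qcomb_exists[OF l(2)] by metis
  have l10: "l1 \<noteq> 0" using qdet_zero[OF l(2)] by blast
  obtain u where u: "u \<in> L" "u \<noteq> 0" and umin: "\<And>x. x \<in> L \<Longrightarrow> x \<noteq> 0 \<Longrightarrow> nm u \<le> nm x"
    by (rule nm_minimum[of "{x \<in> L. x \<noteq> 0}" l1]) (use lL l10 in auto)
  \<comment> \<open>Independence of u and x is expressed by a third vector that completes
    them.\<close>
  define S2 where "S2 = {x \<in> L. \<exists>y. qdet u x y \<noteq> 0}"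
  have "\<exists>s. s \<in> S2"
  proof -
    obtain n x y z where q: "u = qcomb n x y z l1 l2 l3" using span by blast
    have u123: "qdet u l2 l3 = x * qdet l1 l2 l3" "qdet u l3 l1 = y * qdet l1 l2 l3" "qdet u l1 l2 = z * qdet l1 l2 l3"
      unfolding q by (simp_all add: qdet_qcomb) (simp_all add: qdet_def algebra_simps)
    have "x \<noteq> 0 \<or> y \<noteq> 0 \<or> z \<noteq> 0"
    proof (rule ccontr)
      assume "\<not> ?thesis"
      then have "u = 0" using q closed(6)[OF u(1)] by (auto intro!: quat_eqI)
      then show False using u(2) by blast
    qed
    then have "qdet u l2 l3 \<noteq> 0 \<or> qdet u l3 l1 \<noteq> 0 \<or> qdet u l1 l2 \<noteq> 0"
      unfolding u123 using l(2) by auto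
    then show ?thesis unfolding S2_def using lL by blast
  qed
  then obtain s2 where s2: "s2 \<in> S2" by blast
  have S2L: "S2 \<subseteq> L" by (auto simp: S2_def)
  obtain v where v: "v \<in> S2" and vmin: "\<And>x. x \<in> S2 \<Longrightarrow> nm v \<le> nm x"
    using nm_minimum[OF S2L s2] by blast
  define S3 where "S3 = {x \<in> L. qdet u v x \<noteq> 0}"
  have "\<exists>s. s \<in> S3"
  proof (rule ccontr)
    assume "\<not> ?thesis"
    then have z: "qdet u v l1 = 0" "qdet u v l2 = 0" "qdet u v l3 = 0" using lL by (auto simp: S3_def)
    obtain y where y: "qdet u v y \<noteq> 0" using v by (auto simp: S2_def)
    obtain n c1 c2 c3 where "y = qcomb n c1 c2 c3 l1 l2 l3" using span by blast
    then show False using y z by (simp add: qdet_qcomb)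
  qed
  then obtain s3 where s3: "s3 \<in> S3" by blast
  have S3L: "S3 \<subseteq> L" by (auto simp: S3_def)
  obtain w where w: "w \<in> S3" and wmin: "\<And>x. x \<in> S3 \<Longrightarrow> nm w \<le> nm x"
    using nm_minimum[OF S3L s3] by blast
  have uvw: "u \<in> L" "v \<in> L" "w \<in> L" using u v w S2L S3L by auto
  have det: "qdet u v w \<noteq> 0" using w by (simp add: S3_def)
  obtain h2 h3 r s t where h: "h2 > 0" "h3 > 0"
    and gs: "\<And>x y z. nm (qcomb 0 x y z u v w) = nm u * (x + r * y + s * z)\<^sup>2 + h2 * (y + t * z)\<^sup>2 + h3 * z\<^sup>2"
    by (rule gram_schmidt[OF neg det]) blast
  define D1 D2 D3 where "D1 = nm u" and "D2 = nm v" and "D3 = nm w"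
  note gs = gs[folded D1_def]
  have D1: "D1 > 0" unfolding D1_def by (rule nm_pos[OF u])
  have uc: "qcomb 0 1 0 0 u v w = u" "qcomb 0 0 1 0 u v w = v" "qcomb 0 0 0 1 u v w = w"
    by (rule quat_eqI; simp)+
  have "D2 = D1 * r^2 + h2" using gs[of 0 1 0] unfolding uc D2_def by simp
  then have h2D: "h2 \<le> D2" using D1 by simp
  have "D3 = D1 * s^2 + h2 * t^2 + h3" using gs[of 0 0 1] unfolding uc D3_def by simp
  then have h3D: "h3 \<le> D3" using D1 h by simp
  have "v \<noteq> 0" using qdet_zero[OF det] by blast
  then have D12: "D1 \<le> D2" unfolding D1_def D2_def using umin uvw by blast
  have "qdet u w v \<noteq> 0" using det by (simp add: qdet_def algebra_simps)
  then have "w \<in> S2" using uvw by (auto simp: S2_def)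
  then have D23: "D2 \<le> D3" unfolding D3_def D2_def by (rule vmin)
  have inS2: "q \<in> S2" if "q \<in> L" "q = qcomb 0 x y z u v w" "y \<noteq> 0 \<or> z \<noteq> 0" for q x y z
  proof -
    have "qdet u q w = y * qdet u v w" "qdet u q v = - z * qdet u v w"
      unfolding that(2) by (simp_all add: qdet_qcomb) (simp add: qdet_def algebra_simps)
    then have "qdet u q w \<noteq> 0 \<or> qdet u q v \<noteq> 0" using that(3) det by auto
    then show ?thesis using that(1) by (auto simp: S2_def)
  qed
  have inS3: "q \<in> S3" if "q \<in> L" "q = qcomb 0 x y z u v w" "z \<noteq> 0" for q x y z
    using that det by (simp add: S3_def qdet_qcomb)
  have quarter: "h * c\<^sup>2 \<le> h / 4" if "h > 0" "c\<^sup>2 \<le> 1/4" for h c :: rat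
    using mult_left_mono[OF that(2), of h] that(1) by simp
  have gen: "x \<in> \<int> \<and> y \<in> \<int> \<and> z \<in> \<int>" if q: "qcomb 0 x y z u v w \<in> L" for x y z
  proof -
    obtain n3 where n3: "(z - of_int n3)\<^sup>2 \<le> 1/4" "z \<in> \<int> \<or> z - of_int n3 \<noteq> 0"
      using rat_int_or_nonzero_frac by blast
    obtain n2 where n2: "((y + t * (z - of_int n3)) - of_int n2)\<^sup>2 \<le> 1/4" using round_sq by blast
    obtain n1 where n1: "((x + r * (y - of_int n2) + s * (z - of_int n3)) - of_int n1)\<^sup>2 \<le> 1/4" using round_sq by blast
    have sub: "qcomb 0 (x - of_int l1) (y - of_int l2) (z - of_int l3) u v w \<in> L" for l1 l2 l3
    proof -
      have "qcomb 0 (x - of_int l1) (y - of_int l2) (z - of_int l3) u v w =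
        qcomb 0 x y z u v w - (qscale (of_int l1) u + qscale (of_int l2) v + qscale (of_int l3) w)"
        by (rule quat_eqI) (simp_all add: algebra_simps)
      then show ?thesis using q uvw closed by simp
    qed
    note L1 = sub[of n1 n2 n3]
    have z: "z \<in> \<int>"
    proof (rule ccontr)
      assume "z \<notin> \<int>"
      then have "qcomb 0 (x - of_int n1) (y - of_int n2) (z - of_int n3) u v w \<in> S3"
        using inS3[OF L1 refl] n3(2) by blast
      then have "D3 \<le> nm (qcomb 0 (x - of_int n1) (y - of_int n2) (z - of_int n3) u v w)"
        unfolding D3_def by (rule wmin)
      also have "\<dots> = D1 * ((x + r * (y - of_int n2) + s * (z - of_int n3)) - of_int n1)\<^sup>2
         + h2 * ((y + t * (z - of_int n3)) - of_int n2)\<^sup>2 + h3 * (z - of_int n3)\<^sup>2"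
        unfolding gs by (simp add: algebra_simps)
      also have "\<dots> \<le> D1 / 4 + h2 / 4 + h3 / 4"
        using quarter[OF D1 n1] quarter[OF h(1) n2] quarter[OF h(2) n3(1)] by linarith
      finally show False using D1 h2D h3D D12 D23 by linarith
    qed
    then obtain k3 where k3: "z = of_int k3" by (auto elim: Ints_cases)
    obtain m2 where m2: "(y - of_int m2)\<^sup>2 \<le> 1/4" "y \<in> \<int> \<or> y - of_int m2 \<noteq> 0"
      using rat_int_or_nonzero_frac by blast
    obtain m1 where m1: "((x + r * (y - of_int m2)) - of_int m1)\<^sup>2 \<le> 1/4" using round_sq by blast
    have L2: "qcomb 0 (x - of_int m1) (y - of_int m2) 0 u v w \<in> L" using sub[of m1 m2 k3] k3 by simp
    have y: "y \<in> \<int>"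
    proof (rule ccontr)
      assume "y \<notin> \<int>"
      then have "qcomb 0 (x - of_int m1) (y - of_int m2) 0 u v w \<in> S2"
        using inS2[OF L2 refl] m2(2) by blast
      then have "D2 \<le> nm (qcomb 0 (x - of_int m1) (y - of_int m2) 0 u v w)"
        unfolding D2_def by (rule vmin)
      also have "\<dots> = D1 * ((x + r * (y - of_int m2)) - of_int m1)\<^sup>2 + h2 * (y - of_int m2)\<^sup>2"
        unfolding gs by (simp add: algebra_simps)
      also have "\<dots> \<le> D1 / 4 + h2 / 4"
        using quarter[OF D1 m1] quarter[OF h(1) m2(1)] by linarith
      finally show False using D1 h2D D12 by linarith
    qed
    then obtain k2 where k2: "y = of_int k2" by (auto elim: Ints_cases)
    obtain j1 where j1: "(x - of_int j1)\<^sup>2 \<le> 1/4" "x \<in> \<int> \<or> x - of_int j1 \<noteq> 0"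
      using rat_int_or_nonzero_frac by blast
    have L3: "qcomb 0 (x - of_int j1) 0 0 u v w \<in> L" using sub[of j1 k2 k3] k2 k3 by simp
    have x: "x \<in> \<int>"
    proof (rule ccontr)
      assume "x \<notin> \<int>"
      then have "x - of_int j1 \<noteq> 0" using j1(2) by blast
      moreover have "0 = qcomb 0 0 0 0 u v w" by (rule quat_eqI) simp_all
      ultimately have "qcomb 0 (x - of_int j1) 0 0 u v w \<noteq> 0" using qcomb_eq_iff[OF det] by metis
      then have "D1 \<le> nm (qcomb 0 (x - of_int j1) 0 0 u v w)"
        unfolding D1_def using umin[OF L3] by blast
      also have "\<dots> = D1 * (x - of_int j1)\<^sup>2" unfolding gs by simp
      also have "\<dots> \<le> D1 / 4" by (rule quarter[OF D1 j1(1)])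
      finally show False using D1 by linarith
    qed
    show ?thesis using x y z by blast
  qed
  have coords: "\<exists>x y z :: int. q = qcomb 0 (of_int x) (of_int y) (of_int z) u v w" if q: "q \<in> L" for q
  proof -
    obtain n x y z where e: "q = qcomb n x y z u v w" using qcomb_exists[OF det] by metis
    have "n = 0" using arg_cong[OF e, of q0] closed(6) q uvw by simp
    then show ?thesis using gen[of x y z] q e by (auto elim!: Ints_cases)
  qed
  have "L = lat u v w"
  proof
    show "L \<subseteq> lat u v w" unfolding lat_def using coords by blast
    show "lat u v w \<subseteq> L"
    proof
      fix q assume "q \<in> lat u v w"
      then obtain x y z :: int where "q = qcomb 0 (of_int x) (of_int y) (of_int z) u v w" by (auto simp: lat_def)
      then have "q = qscale (of_int x) u + qscale (of_int y) v + qscale (of_int z) w"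
        by (intro quat_eqI) simp_all
      then show "q \<in> L" using uvw closed by simp
    qed
  qed
  moreover have "nm v \<le> nm q" if q: "q \<in> L" "q \<notin> lat u 0 0" for q
  proof -
    obtain x y z :: int where e: "q = qcomb 0 (of_int x) (of_int y) (of_int z) u v w" using coords[OF q(1)] by blast
    have "y \<noteq> 0 \<or> z \<noteq> 0"
    proof (rule ccontr)
      assume "\<not> ?thesis"
      then have "q = qcomb 0 (of_int x) (of_int 0) (of_int 0) u 0 0" unfolding e by (intro quat_eqI) simp_all
      then show False using q(2) unfolding lat_def by blast
    qed
    then show ?thesis using vmin inS2[OF q(1) e] by simp
  qed
  moreover have "nm w \<le> nm q" if q: "q \<in> L" "q \<notin> lat u v 0" for q
  proof -
    obtain x y z :: int where e: "q = qcomb 0 (of_int x) (of_int y) (of_int z) u v w" using coords[OF q(1)] by blast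
    have "z \<noteq> 0"
    proof
      assume "z = 0"
      then have "q = qcomb 0 (of_int x) (of_int y) (of_int 0) u v 0" unfolding e by (intro quat_eqI) simp_all
      then show False using q(2) unfolding lat_def by blast
    qed
    then show ?thesis using wmin inS3[OF q(1) e] by simp
  qed
  ultimately show ?thesis using det umin closed(6) uvw unfolding reduced_basis_def by blast
qed

end

section \<open>Invariants of reduced bases\<close>

text \<open>The last clause says that D3 is at most (D1 + D2)/4 plus the squared distance of the third basis
  vector from the plane of the first two.\<close>

definition rdata :: "int \<Rightarrow> int \<Rightarrow> int \<Rightarrow> int \<Rightarrow> int \<Rightarrow> int \<Rightarrow> int \<Rightarrow> bool" where
  "rdata m D1 D2 D3 x y z \<longleftrightarrow> 3 \<le> D1 \<and> D1 \<le> D2 \<and> D2 \<le> D3 \<and>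
     2 * \<bar>x\<bar> \<le> D1 \<and> 2 * \<bar>y\<bar> \<le> D1 \<and> 2 * \<bar>z\<bar> \<le> D2 \<and>
     (4 dvd D1 \<or> 4 dvd D1 + 1) \<and> (4 dvd D2 \<or> 4 dvd D2 + 1) \<and> (4 dvd D3 \<or> 4 dvd D3 + 1) \<and>
     D1 * D2 - x\<^sup>2 > 0 \<and> 4 * m dvd D1 * D2 - x\<^sup>2 \<and> 4 * m dvd D1 * D3 - y\<^sup>2 \<and> 4 * m dvd D2 * D3 - z\<^sup>2 \<and>
     D1 * D2 * D3 + 2 * x * y * z - D1 * z\<^sup>2 - D2 * y\<^sup>2 - D3 * x\<^sup>2 = 4 * m\<^sup>2 \<and>
     4 * D3 * (D1 * D2 - x\<^sup>2) \<le> 16 * m\<^sup>2 + (D1 + D2) * (D1 * D2 - x\<^sup>2)"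

lemma small_multiple: "p dvd t \<Longrightarrow> \<bar>t\<bar> < p \<Longrightarrow> t = 0" for p t :: int
  using dvd_imp_le_int[of t p] by auto

lemma even_if_4_dvd: "4 dvd t \<Longrightarrow> even t" for t :: int
  by presburger

text \<open>Dividing the last clause of \<open>rdata\<close> by 4m turns it into a bound on the
  multiple k of 4m that occurs as first minor. A large D3 leaves only very small k.\<close>

lemma rdata_minor_bound:
  assumes r: "rdata m D1 D2 D3 x y z" and m: "m > 0"
  obtains k where "k > 0" "D1 * D2 - x\<^sup>2 = 4 * m * k" "4 * D3 * k \<le> 4 * m + (D1 + D2) * k" "D3 * k \<le> 2 * m"
proof -
  note r' = r[unfolded rdata_def]
  obtain k where k: "D1 * D2 - x\<^sup>2 = 4 * m * k" using r' by (auto elim!: dvdE)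
  have "4 * m * k > 0" using r' k by simp
  then have k0: "k > 0" using m by (simp add: zero_less_mult_iff)
  have "(4 * m) * (4 * D3 * k) = 4 * D3 * (D1 * D2 - x\<^sup>2)" unfolding k by simp
  also have "\<dots> \<le> 16 * m\<^sup>2 + (D1 + D2) * (D1 * D2 - x\<^sup>2)" using r' by blast
  also have "\<dots> = (4 * m) * (4 * m + (D1 + D2) * k)" unfolding k by (simp add: power2_eq_square algebra_simps)
  finally have 1: "4 * D3 * k \<le> 4 * m + (D1 + D2) * k" using m by simp
  have "(D1 + D2) * k \<le> (2 * D3) * k" using r' k0 by (intro mult_right_mono) auto
  then have "D3 * k \<le> 2 * m" using 1 by (simp add: algebra_simps)
  then show ?thesis using that k0 k 1 by blast
qed

text \<open>The least positive norm that is 0 or 3 modulo 4 is 3, while m = 1 gives D3 \<le>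
  2.\<close>

lemma rdata_ne_1: "rdata 1 D1 D2 D3 x y z \<Longrightarrow> False"
proof -
  assume r: "rdata 1 D1 D2 D3 x y z"
  obtain k where k: "k > 0" "D3 * k \<le> 2 * 1" by (rule rdata_minor_bound[OF r]) auto
  have "3 \<le> D3" using r by (simp add: rdata_def)
  then have "3 * 1 \<le> D3 * k" using k by (intro mult_mono) auto
  then show False using k by simp
qed

text \<open>D3 \<ge> p leaves k = 1 or k = 2. For k = 2 the inequalities are sharp and D1 = D2 = D3
  = p; then x^2 = p (p - 8), so p divides x, whence x = 0 and p = 8.\<close>

lemma rdata_large:
  assumes r: "rdata p D1 D2 D3 x y z" and p: "prime p" and "p \<le> D3"
  shows "D1 * D2 - x\<^sup>2 = 4 * p"
proof -
  note r' = r[unfolded rdata_def]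
  have p0: "p > 1" using p prime_gt_1_int by blast
  obtain k where k: "k > 0" "D1 * D2 - x\<^sup>2 = 4 * p * k" "4 * D3 * k \<le> 4 * p + (D1 + D2) * k" "D3 * k \<le> 2 * p"
    by (rule rdata_minor_bound[OF r]) (use p0 in auto)
  have "p * k \<le> p * 2" using k(4) mult_right_mono[OF assms(3), of k] k(1) by linarith
  then have "k \<le> 2" using p0 by simp
  moreover have "k \<noteq> 2"
  proof
    assume k2: "k = 2"
    then have D3: "D3 = p" using k(4) assms(3) by simp
    then have D12: "D1 = p" "D2 = p" using k(3) k2 r' by auto
    have "p * p - x\<^sup>2 = 8 * p" using k(2) k2 D12 by simp
    then have x: "x\<^sup>2 = p * (p - 8)" by (simp add: algebra_simps)
    then have "p dvd x\<^sup>2" by simp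
    then have "p dvd x" using p prime_dvd_power by blast
    have "\<bar>x\<bar> < p" using r' D12 p0 by auto
    then have "x = 0" using \<open>p dvd x\<close> small_multiple by blast
    then have "p = 8" using x p0 by simp
    then show False using p prime_odd_int[of p] by simp
  qed
  ultimately have "k = 1" using k(1) by linarith
  then show ?thesis using k(2) by simp
qed

lemma sq_eq_if_cong:
  fixes p x x' :: int
  assumes p: "prime p" and "p dvd x\<^sup>2 - x'\<^sup>2" "\<bar>x\<bar> + \<bar>x'\<bar> < p"
  shows "x = x' \<or> x = - x'"
proof -
  have "p dvd (x - x') * (x + x')" using assms(2) by (simp add: power2_eq_square algebra_simps)
  then consider "p dvd x - x'" | "p dvd x + x'" using p prime_dvd_multD by blast
  then show ?thesis
  proof cases
    case 1
    then have "x - x' = 0" using assms(3) by (intro small_multiple) auto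
    then show ?thesis by simp
  next
    case 2
    then have "x + x' = 0" using assms(3) by (intro small_multiple) auto
    then show ?thesis by simp
  qed
qed

text \<open>The equation D1 D2 - x^2 = 4p and 4 x^2 \<le> D1^2 give 3 D1 \<le> 16. This settles the
  range D2 \<ge> p, where the representation numbers below p say nothing about the second
  vector.\<close>

lemma rdata_large_first:
  assumes r: "rdata p D1 D2 D3 x y z" and p: "prime p" and D2: "p \<le> D2"
  shows "D1 = 3 \<or> (D1 = 4 \<and> D2 = p \<and> x = 0)"
proof -
  note r' = r[unfolded rdata_def]
  have p0: "p > 1" using p prime_gt_1_int by blast
  have D: "D1 * D2 - x\<^sup>2 = 4 * p" using r' D2 by (intro rdata_large[OF r p]) linarith
  have "(2 * \<bar>x\<bar>)\<^sup>2 \<le> D1\<^sup>2" using r' by (intro power_mono) auto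
  then have "4 * x\<^sup>2 \<le> D1 * D1" by (simp add: power2_eq_square)
  moreover have "D1 * D1 \<le> D1 * D2" using r' by (intro mult_left_mono) auto
  ultimately have "3 * (D1 * D2) \<le> 16 * p" using D by linarith
  moreover have "D1 * p \<le> D1 * D2" using r' D2 by (intro mult_left_mono) auto
  ultimately have "p * (3 * D1) \<le> p * 16" by (simp add: algebra_simps)
  then have "3 * D1 \<le> 16" using p0 by simp
  then have "D1 = 3 \<or> D1 = 4 \<or> D1 = 5" using r' by auto
  moreover have "D1 \<noteq> 5" using r' by auto
  moreover have "D2 = p \<and> x = 0" if D1: "D1 = 4"
  proof -
    have x: "4 * D2 = 4 * p + x\<^sup>2" using D D1 by simp
    then have "x\<^sup>2 = 2 * (2 * (D2 - p))" by simp
    then have "even (x\<^sup>2)" by simp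
    then have "even x" by simp
    moreover have "\<bar>x\<bar> \<le> 2" using r' D1 by auto
    ultimately have "x = 0 \<or> x = 2 \<or> x = -2" by presburger
    \<comment> \<open>Here D2 = p + 1, and the residue condition on D2 makes p = 3 modulo 4. The
      determinant forces z = 0 or z = e modulo p, with e = xy/4 equal to 1 or -1; the resulting D3
      violates D2 \<le> D3 or the minor condition on D2 D3 - z^2.\<close>
    moreover have False if x2: "x = 2 \<or> x = -2"
    proof -
      have Dp: "D2 = p + 1" using x x2 by auto
      have det: "4 * p * D3 = 4 * p\<^sup>2 + 4 * z\<^sup>2 + (p + 1) * y\<^sup>2 - 2 * x * y * z"
      proof -
        have "D3 * (D1 * D2 - x\<^sup>2) = 4 * p\<^sup>2 + D1 * z\<^sup>2 + D2 * y\<^sup>2 - 2 * x * y * z"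
          using r' by (simp add: algebra_simps)
        then show ?thesis unfolding D unfolding D1 Dp by (simp add: algebra_simps)
      qed
      have pm: "4 dvd p + 1"
      proof -
        have "p \<noteq> 2" using Dp r' D1 by linarith
        then have "odd p" using p p0 prime_odd_int[of p] by simp
        moreover have "4 dvd p + 1 \<or> 4 dvd p + 1 + 1" using r' unfolding Dp by blast
        ultimately show ?thesis by presburger
      qed
      obtain q where q: "p + 1 = 4 * q" using pm by (elim dvdE)
      have "even y"
      proof -
        have "4 dvd 4 * D3 - y\<^sup>2" using r' D1 by (meson dvd_mult_left)
        then have "even (4 * D3 - y\<^sup>2)" by (rule even_if_4_dvd)
        then show ?thesis by simp
      qed
      moreover have "\<bar>y\<bar> \<le> 2" using r' D1 by auto
      ultimately have "y = 0 \<or> y = 2 \<or> y = -2" by presburger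
      then consider "y = 0" | e where "x * y = 4 * e" "e = 1 \<or> e = -1" "y\<^sup>2 = 4"
        using x2 by (elim disjE) auto
      then show False
      proof cases
        case 1
        then have "p * D3 = p * p + z\<^sup>2" using det by (simp add: power2_eq_square)
        then have "z\<^sup>2 = p * (D3 - p)" by (simp add: algebra_simps)
        then have "p dvd z\<^sup>2" by simp
        then have "p dvd z" using p prime_dvd_power by blast
        moreover have "\<bar>z\<bar> < p" using r' Dp q by auto
        ultimately have "z = 0" using small_multiple by blast
        then have "D3 = p" using \<open>p * D3 = p * p + z\<^sup>2\<close> p0 by simp
        then show False using r' Dp by auto
      next
        case 2
        have xyz: "2 * x * y * z = 8 * e * z" using 2(1) by (simp add: mult.assoc)
        have "p * D3 = p * p + p + (z\<^sup>2 + 1 - 2 * e * z)"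
          using det unfolding 2(3) xyz by (simp add: power2_eq_square algebra_simps)
        also have "z\<^sup>2 + 1 - 2 * e * z = (z - e)\<^sup>2" using 2(2) by (auto simp: power2_eq_square algebra_simps)
        finally have zp: "p * D3 = p * p + p + (z - e)\<^sup>2" .
        then have "(z - e)\<^sup>2 = p * (D3 - p - 1)" by (simp add: algebra_simps)
        then have "p dvd (z - e)\<^sup>2" by simp
        then have pz: "p dvd z - e" using p prime_dvd_power by blast
        \<comment> \<open>The congruence z = e modulo p becomes an equality through |z - e| < p,
          which the bound on z yields for p \<ge> 7; for p = 3 a bound on D3 takes its
          place.\<close>
        show False
        proof (cases "p = 3")
          case True
          have "D3 * 4 * 12 \<le> 16 * 9 + (4 + 4) * 12"
            using r' D unfolding Dp D1 True by (simp add: power2_eq_square)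
          then have "D3 \<le> 5" by simp
          moreover have "4 \<le> D3" "4 dvd D3 \<or> 4 dvd D3 + 1" using r' Dp True by auto
          ultimately have "D3 = 4" by presburger
          then have "(z - e)\<^sup>2 = 0" using zp True by simp
          then have "z = e" by simp
          then have "z\<^sup>2 = 1" using 2(2) by auto
          then show False using r' \<open>D3 = 4\<close> Dp True by auto
        next
          case False
          have "2 * \<bar>z\<bar> \<le> p + 1" using r' Dp by simp
          moreover have "p \<ge> 7" using q False p0 by presburger
          ultimately have "\<bar>z - e\<bar> < p" using 2(2) by auto
          then have "z = e" using small_multiple[OF pz] by simp
          then have "p * D3 = p * (p + 1)" using zp by (simp add: algebra_simps)
          then have D3: "D3 = p + 1" using p0 by simp
          have "z\<^sup>2 = 1" using \<open>z = e\<close> 2(2) by auto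
          then have "p * 4 dvd p * (p + 2)" using r' D3 Dp by (simp add: algebra_simps)
          then have "4 dvd p + 2" using p0 by simp
          then show False using pm by presburger
        qed
      qed
    qed
    ultimately show ?thesis using x by auto
  qed
  ultimately show ?thesis by blast
qed

text \<open>The coordinates (s, t) of the projection of the third basis vector to the plane of the first two
  are S/2 and T/2; their parities are determined by D1 and D2.\<close>

lemma rdata_projection:
  assumes r: "rdata p D1 D2 D3 x y z" and D: "D1 * D2 - x\<^sup>2 = 4 * p" and p: "p > 0"
  obtains S T where "D2 * y - x * z = 2 * p * S" "D1 * z - x * y = 2 * p * T"
    "2 * y = D1 * S + x * T" "2 * z = x * S + D2 * T" "4 dvd S\<^sup>2 + D2" "4 dvd T\<^sup>2 + D1"
proof -
  note r' = r[unfolded rdata_def]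
  have det: "D1 * D2 * D3 + 2 * x * y * z - D1 * z\<^sup>2 - D2 * y\<^sup>2 - D3 * x\<^sup>2 = 4 * p\<^sup>2" using r' by blast
  obtain k where k: "D1 * D3 - y\<^sup>2 = 4 * p * k" using r' by (auto elim!: dvdE)
  obtain j where j: "D2 * D3 - z\<^sup>2 = 4 * p * j" using r' by (auto elim!: dvdE)
  \<comment> \<open>Jacobi's identity for a symmetric 3 x 3 matrix: the square of an off-diagonal
    cofactor is the product of two diagonal cofactors minus an entry times the determinant.\<close>
  have "(D2 * y - x * z)\<^sup>2 = (D1 * D2 - x\<^sup>2) * (D2 * D3 - z\<^sup>2)
     - D2 * (D1 * D2 * D3 + 2 * x * y * z - D1 * z\<^sup>2 - D2 * y\<^sup>2 - D3 * x\<^sup>2)"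
    by (simp add: power2_eq_square algebra_simps)
  also have "\<dots> = (2 * p)\<^sup>2 * (4 * j - D2)"
    unfolding D det j by (simp add: power2_eq_square algebra_simps)
  finally have S2: "(D2 * y - x * z)\<^sup>2 = (2 * p)\<^sup>2 * (4 * j - D2)" .
  then have "(2 * p)\<^sup>2 dvd (D2 * y - x * z)\<^sup>2" by simp
  then have "2 * p dvd D2 * y - x * z" by (rule iffD1[OF pow_divides_pow_iff[OF pos2]])
  then obtain S where S: "D2 * y - x * z = 2 * p * S" by (elim dvdE)
  have "(D1 * z - x * y)\<^sup>2 = (D1 * D2 - x\<^sup>2) * (D1 * D3 - y\<^sup>2)
     - D1 * (D1 * D2 * D3 + 2 * x * y * z - D1 * z\<^sup>2 - D2 * y\<^sup>2 - D3 * x\<^sup>2)"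
    by (simp add: power2_eq_square algebra_simps)
  also have "\<dots> = (2 * p)\<^sup>2 * (4 * k - D1)"
    unfolding D det k by (simp add: power2_eq_square algebra_simps)
  finally have T2: "(D1 * z - x * y)\<^sup>2 = (2 * p)\<^sup>2 * (4 * k - D1)" .
  then have "(2 * p)\<^sup>2 dvd (D1 * z - x * y)\<^sup>2" by simp
  then have "2 * p dvd D1 * z - x * y" by (rule iffD1[OF pow_divides_pow_iff[OF pos2]])
  then obtain T where T: "D1 * z - x * y = 2 * p * T" by (elim dvdE)
  have "S\<^sup>2 = 4 * j - D2" using S2 p unfolding S by (simp add: power_mult_distrib)
  moreover have "T\<^sup>2 = 4 * k - D1" using T2 p unfolding T by (simp add: power_mult_distrib)
  moreover have "2 * p * (2 * y) = 2 * p * (D1 * S + x * T)"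
  proof -
    have "2 * p * (D1 * S + x * T) = D1 * (2 * p * S) + x * (2 * p * T)" by (simp add: algebra_simps)
    also have "\<dots> = (D1 * D2 - x\<^sup>2) * y" unfolding S[symmetric] T[symmetric] by (simp add: power2_eq_square algebra_simps)
    finally show ?thesis unfolding D by algebra
  qed
  moreover have "2 * p * (2 * z) = 2 * p * (x * S + D2 * T)"
  proof -
    have "2 * p * (x * S + D2 * T) = x * (2 * p * S) + D2 * (2 * p * T)" by (simp add: algebra_simps)
    also have "\<dots> = (D1 * D2 - x\<^sup>2) * z" unfolding S[symmetric] T[symmetric] by (simp add: power2_eq_square algebra_simps)
    finally show ?thesis unfolding D by algebra
  qed
  ultimately show ?thesis using that[OF S T] p by simp
qed

text \<open>S^2 = -D2 and T^2 = -D1 modulo 4 fix the parities of S and T, so the two projections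
  differ by a vector g u + h v of the plane lattice. The determinant then fixes D3.\<close>

lemma rdata_shift:
  assumes r: "rdata p D1 D2 D3 x y z" "rdata p D1 D2 D3' x y' z'" and D: "D1 * D2 - x\<^sup>2 = 4 * p" and p: "p > 0"
  obtains g h where "y = y' + g * D1 + h * x" "z = z' + g * x + h * D2"
    "D3 = D3' + g\<^sup>2 * D1 + h\<^sup>2 * D2 + 2 * g * h * x + 2 * g * y' + 2 * h * z'"
proof -
  obtain S T where ST: "D2 * y - x * z = 2 * p * S" "D1 * z - x * y = 2 * p * T"
    "2 * y = D1 * S + x * T" "2 * z = x * S + D2 * T" "4 dvd S\<^sup>2 + D2" "4 dvd T\<^sup>2 + D1"
    by (rule rdata_projection[OF r(1) D p])
  obtain S' T' where ST': "D2 * y' - x * z' = 2 * p * S'" "D1 * z' - x * y' = 2 * p * T'"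
    "2 * y' = D1 * S' + x * T'" "2 * z' = x * S' + D2 * T'" "4 dvd S'\<^sup>2 + D2" "4 dvd T'\<^sup>2 + D1"
    by (rule rdata_projection[OF r(2) D p])
  have "4 dvd (S\<^sup>2 + D2) - (S'\<^sup>2 + D2)" "4 dvd (T\<^sup>2 + D1) - (T'\<^sup>2 + D1)" using ST ST' dvd_diff by blast+
  then have "even ((S\<^sup>2 + D2) - (S'\<^sup>2 + D2))" "even ((T\<^sup>2 + D1) - (T'\<^sup>2 + D1))"
    using even_if_4_dvd by blast+
  then have "even (S - S')" "even (T - T')" by simp_all
  then obtain g h where gh: "S - S' = 2 * g" "T - T' = 2 * h" by (meson evenE)
  have S: "S = S' + 2 * g" "T = T' + 2 * h" using gh by auto
  have y: "y = y' + g * D1 + h * x" using ST(3) ST'(3) unfolding S by (simp add: algebra_simps)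
  have z: "z = z' + g * x + h * D2" using ST(4) ST'(4) unfolding S by (simp add: algebra_simps)
  have d: "(D1 * D2 - x\<^sup>2) * D3 = 4 * p\<^sup>2 + D1 * z\<^sup>2 + D2 * y\<^sup>2 - 2 * x * y * z"
    "(D1 * D2 - x\<^sup>2) * D3' = 4 * p\<^sup>2 + D1 * z'\<^sup>2 + D2 * y'\<^sup>2 - 2 * x * y' * z'"
    using r unfolding rdata_def by (auto simp: algebra_simps)
  have "(D1 * D2 - x\<^sup>2) * D3 = (D1 * D2 - x\<^sup>2) * (D3' + g\<^sup>2 * D1 + h\<^sup>2 * D2 + 2 * g * h * x + 2 * g * y' + 2 * h * z')"
    unfolding d(1) distrib_left[of "D1 * D2 - x\<^sup>2"] d(2) y z by (simp add: power2_eq_square algebra_simps)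
  then have "D3 = D3' + g\<^sup>2 * D1 + h\<^sup>2 * D2 + 2 * g * h * x + 2 * g * y' + 2 * h * z'"
    using D p by simp
  then show ?thesis using that y z by blast
qed

text \<open>The minors fix x^2, y^2 and z^2 modulo p, and D2 < p makes x, y, z small enough to be
  fixed up to sign. The determinant fixes the product x y z, which is exactly what allows the signs
  to come from sign changes of the three basis vectors.\<close>

lemma rdata_small_signs:
  assumes r: "rdata p D1 D2 D3 x y z" "rdata p D1 D2 D3 x' y' z'" and p: "prime p" and "D2 < p"
  obtains e1 e2 e3 :: int where "e1 \<in> {1, -1}" "e2 \<in> {1, -1}" "e3 \<in> {1, -1}"
    "x = e1 * e2 * x'" "y = e1 * e3 * y'" "z = e2 * e3 * z'"
proof -
  note r1 = r(1)[unfolded rdata_def] and r2 = r(2)[unfolded rdata_def]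
  have dv: "p dvd s\<^sup>2 - t\<^sup>2" if "4 * p dvd q - s\<^sup>2" "4 * p dvd q - t\<^sup>2" for q s t :: int
  proof -
    have "4 * p dvd (q - t\<^sup>2) - (q - s\<^sup>2)" using that dvd_diff by blast
    then have "4 * p dvd s\<^sup>2 - t\<^sup>2" by simp
    then show ?thesis by (rule dvd_mult_right)
  qed
  have x: "x = x' \<or> x = - x'"
    by (rule sq_eq_if_cong[OF p dv[of "D1 * D2"]]) (use r1 r2 assms(4) in auto)
  have y: "y = y' \<or> y = - y'"
    by (rule sq_eq_if_cong[OF p dv[of "D1 * D3"]]) (use r1 r2 assms(4) in auto)
  have z: "z = z' \<or> z = - z'"
    by (rule sq_eq_if_cong[OF p dv[of "D2 * D3"]]) (use r1 r2 assms(4) in auto)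
  have sq: "x\<^sup>2 = x'\<^sup>2" "y\<^sup>2 = y'\<^sup>2" "z\<^sup>2 = z'\<^sup>2" using x y z by auto
  have xyz: "x * y * z = x' * y' * z'"
  proof -
    have "2 * (x * y * z) = 2 * (x' * y' * z')" using r1 r2 unfolding sq by (simp add: mult.assoc)
    then show ?thesis by simp
  qed
  obtain ex ey ez :: int where e: "ex \<in> {1, -1}" "ey \<in> {1, -1}" "ez \<in> {1, -1}"
    "x = ex * x'" "y = ey * y'" "z = ez * z'" using x y z by (metis insertCI minus_mult_minus mult_1 mult_minus_left)
  \<comment> \<open>A vanishing entry has no sign, which leaves one condition on e1, e2, e3
    free.\<close>
  consider "x' = 0" | "y' = 0" | "z' = 0" | "x' \<noteq> 0" "y' \<noteq> 0" "z' \<noteq> 0" by blast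
  then show ?thesis
  proof cases
    case 1 then show ?thesis using e that[of ey ez 1] by auto
  next
    case 2 then show ?thesis using e that[of ex 1 ez] by auto
  next
    case 3 then show ?thesis using e that[of 1 ex ey] by auto
  next
    case 4
    have "ex * ey * ez * (x' * y' * z') = 1 * (x' * y' * z')" using xyz unfolding e(4-6) by (simp add: mult_ac)
    then have "ex * ey * ez = 1" using 4 mult_right_cancel[of "x' * y' * z'" "ex * ey * ez" 1] by simp
    then have "ez = ex * ey" using e(1-3) by auto
    then show ?thesis using e that[of 1 ex ey] by auto
  qed
qed

lemma qcomb_basis:
  "qcomb 0 1 0 0 u v w = u" "qcomb 0 0 1 0 u v w = v" "qcomb 0 0 0 1 u v w = w"
  by (rule quat_eqI; simp)+

lemma lat_sub:
  assumes det: "qdet u v w \<noteq> 0"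
  shows "qcomb n x y z u v w \<in> lat u 0 0 \<longleftrightarrow> n = 0 \<and> x \<in> \<int> \<and> y = 0 \<and> z = 0"
    and "qcomb n x y z u v w \<in> lat u v 0 \<longleftrightarrow> n = 0 \<and> x \<in> \<int> \<and> y \<in> \<int> \<and> z = 0"
proof -
  have 1: "qcomb 0 (of_int i) (of_int j) (of_int k) u 0 0 = qcomb 0 (of_int i) 0 0 u v w"
    "qcomb 0 (of_int i) (of_int j) (of_int k) u v 0 = qcomb 0 (of_int i) (of_int j) 0 u v w" for i j k :: int
    by (rule quat_eqI; simp)+
  show "qcomb n x y z u v w \<in> lat u 0 0 \<longleftrightarrow> n = 0 \<and> x \<in> \<int> \<and> y = 0 \<and> z = 0"
    "qcomb n x y z u v w \<in> lat u v 0 \<longleftrightarrow> n = 0 \<and> x \<in> \<int> \<and> y \<in> \<int> \<and> z = 0"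
    unfolding lat_def 1 mem_Collect_eq qcomb_eq_iff[OF det] by (auto elim!: Ints_cases)
qed

lemma qdet_three_qcomb:
  "qdet (qcomb n x1 x2 x3 u v w) (qcomb m y1 y2 y3 u v w) (qcomb k z1 z2 z3 u v w)
     = (x1 * (y2 * z3 - y3 * z2) - x2 * (y1 * z3 - y3 * z1) + x3 * (y1 * z2 - y2 * z1)) * qdet u v w"
proof -
  have p: "qdet u w v = - qdet u v w" "qdet v u w = - qdet u v w" "qdet v w u = qdet u v w"
    "qdet w u v = qdet u v w" "qdet w v u = - qdet u v w"
    by (simp_all add: qdet_def algebra_simps)
  show ?thesis by (simp add: qdet_qcomb p algebra_simps)
qed

text \<open>Each basis is an integral combination of the other, so the two transition determinants
  are integers with product 1.\<close>

lemma lat_qdet: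
  assumes "lat u v w = lat u' v' w'" "qdet u v w \<noteq> 0" "qdet u' v' w' \<noteq> 0"
  shows "(qdet u v w)\<^sup>2 = (qdet u' v' w')\<^sup>2"
proof -
  have *: "\<exists>n::int. qdet r s t = of_int n * qdet u v w" if "r \<in> lat u v w" "s \<in> lat u v w" "t \<in> lat u v w" for r s t u v w
  proof -
    obtain x1 x2 x3 y1 y2 y3 z1 z2 z3 where
      e: "r = qcomb 0 (of_int x1) (of_int x2) (of_int x3) u v w" "s = qcomb 0 (of_int y1) (of_int y2) (of_int y3) u v w"
      "t = qcomb 0 (of_int z1) (of_int z2) (of_int z3) u v w"
      using \<open>r \<in> _\<close> \<open>s \<in> _\<close> \<open>t \<in> _\<close> unfolding lat_def by blast
    have "qdet r s t = of_int (x1 * (y2 * z3 - y3 * z2) - x2 * (y1 * z3 - y3 * z1) + x3 * (y1 * z2 - y2 * z1)) * qdet u v w"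
      unfolding e qdet_three_qcomb by simp
    then show ?thesis by blast
  qed
  obtain n where n: "qdet u' v' w' = of_int n * qdet u v w"
    using *[of u' u v w v' w'] assms(1) lat_group(6-8) by metis
  obtain n' where n': "qdet u v w = of_int n' * qdet u' v' w'"
    using *[of u u' v' w' v w] assms(1) lat_group(6-8) by metis
  have "of_int (n * n') * qdet u v w = 1 * qdet u v w" using n n' by (simp add: mult_ac)
  then have "of_int (n * n') = (1 :: rat)" using assms(2) using mult_right_cancel by blast
  then have "n * n' = 1" by linarith
  then have "n = 1 \<or> n = -1" using zmult_eq_1_iff by blast
  then show ?thesis using n by auto
qed

context gross_lattice
begin

lemma reduced_basis_rdata:
  assumes red: "reduced_basis a b L u v w"
  obtains D1 D2 D3 x y z where "rdata m D1 D2 D3 x y z"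
    "nm u = of_int D1" "nm v = of_int D2" "nm w = of_int D3"
    "qip a b u v = of_int x" "qip a b u w = of_int y" "qip a b v w = of_int z"
proof -
  have L: "L = lat u v w" and det: "qdet u v w \<noteq> 0"
    and min1: "\<And>q. q \<in> L \<Longrightarrow> q \<noteq> 0 \<Longrightarrow> nm u \<le> nm q"
    and min2: "\<And>q. q \<in> L \<Longrightarrow> q \<notin> lat u 0 0 \<Longrightarrow> nm v \<le> nm q"
    and min3: "\<And>q. q \<in> L \<Longrightarrow> q \<notin> lat u v 0 \<Longrightarrow> nm w \<le> nm q"
    using red unfolding reduced_basis_def by blast+
  have uL: "u \<in> L" "v \<in> L" "w \<in> L" unfolding L by (rule lat_group)+
  have nz: "u \<noteq> 0" "v \<noteq> 0" "w \<noteq> 0" using qdet_zero[OF det] by blast+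
  obtain D1 where D1: "nm u = of_int D1" "4 dvd D1 \<or> 4 dvd D1 + 1" using norm[OF uL(1)] by blast
  obtain D2 where D2: "nm v = of_int D2" "4 dvd D2 \<or> 4 dvd D2 + 1" using norm[OF uL(2)] by blast
  obtain D3 where D3: "nm w = of_int D3" "4 dvd D3 \<or> 4 dvd D3 + 1" using norm[OF uL(3)] by blast
  obtain x where x: "qip a b u v = of_int x" using ip[OF uL(1,2)] by (auto elim: Ints_cases)
  obtain y where y: "qip a b u w = of_int y" using ip[OF uL(1,3)] by (auto elim: Ints_cases)
  obtain z where z: "qip a b v w = of_int z" using ip[OF uL(2,3)] by (auto elim: Ints_cases)
  have "D1 > 0" using nm_pos[OF uL(1) nz(1)] D1(1) by simp
  then have D13: "3 \<le> D1" using D1(2) by presburger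
  have D12: "D1 \<le> D2" using min1[OF uL(2) nz(2)] D1 D2 by simp
  note sub = lat_sub[OF det]
  have in2: "q \<notin> lat u 0 0" if "q = qcomb 0 x y z u v w" "y \<noteq> 0 \<or> z \<noteq> 0" for q x y z
    using that sub(1) by simp
  have in3: "q \<notin> lat u v 0" if "q = qcomb 0 x y z u v w" "z \<noteq> 0" for q x y z
    using that sub(2) by simp
  have D23: "D2 \<le> D3" using min2[OF uL(3) in2[of w 0 0 1]] D3 D2 by (simp add: qcomb_basis)
  \<comment> \<open>Minimality of t against t + q and t - q bounds their inner product by half the
    norm of q.\<close>
  have abs: "2 * \<bar>of_int r\<bar> \<le> nm q"
    if "nm t \<le> nm (t + q)" "nm t \<le> nm (t - q)" "qip a b q t = of_int r" for t q :: quat and r :: int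
    using that by (simp add: qip_linear qip_comm[of a b t q])
  have pm: "v + u = qcomb 0 1 1 0 u v w" "v - u = qcomb 0 (-1) 1 0 u v w" "w + u = qcomb 0 1 0 1 u v w"
    "w - u = qcomb 0 (-1) 0 1 u v w" "w + v = qcomb 0 0 1 1 u v w" "w - v = qcomb 0 0 (-1) 1 u v w"
    by (rule quat_eqI; simp)+
  have "nm v \<le> nm (v + u)" "nm v \<le> nm (v - u)"
    using uL closed in2[OF pm(1)] in2[OF pm(2)] by (auto intro!: min2)
  from abs[OF this x] have bx: "2 * \<bar>x\<bar> \<le> D1" unfolding D1 by linarith
  have "nm w \<le> nm (w + u)" "nm w \<le> nm (w - u)"
    using uL closed in3[OF pm(3)] in3[OF pm(4)] by (auto intro!: min3)
  from abs[OF this y] have byy: "2 * \<bar>y\<bar> \<le> D1" unfolding D1 by linarith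
  have "nm w \<le> nm (w + v)" "nm w \<le> nm (w - v)"
    using uL closed in3[OF pm(5)] in3[OF pm(6)] by (auto intro!: min3)
  from abs[OF this z] have bz: "2 * \<bar>z\<bar> \<le> D2" unfolding D2 by linarith
  have "4 * m dvd D1 * D2 - x\<^sup>2"
  proof -
    obtain k where "of_int (D1 * D2 - x\<^sup>2) = (of_int (4 * m * k) :: rat)"
      using minor[OF uL(1,2)] unfolding D1 D2 x by auto
    then show ?thesis unfolding of_int_eq_iff by simp
  qed
  moreover have "4 * m dvd D1 * D3 - y\<^sup>2"
  proof -
    obtain k where "of_int (D1 * D3 - y\<^sup>2) = (of_int (4 * m * k) :: rat)"
      using minor[OF uL(1,3)] unfolding D1 D3 y by auto
    then show ?thesis unfolding of_int_eq_iff by simp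
  qed
  moreover have "4 * m dvd D2 * D3 - z\<^sup>2"
  proof -
    obtain k where "of_int (D2 * D3 - z\<^sup>2) = (of_int (4 * m * k) :: rat)"
      using minor[OF uL(2,3)] unfolding D3 D2 z by auto
    then show ?thesis unfolding of_int_eq_iff by simp
  qed
  moreover have det4: "(of_int a * of_int b * qdet u v w)\<^sup>2 = of_int (4 * m\<^sup>2)"
  proof -
    obtain u' v' w' where l: "L = lat u' v' w'" "qdet u' v' w' \<noteq> 0"
      "(of_int a * of_int b * qdet u' v' w')\<^sup>2 = of_int (4 * m\<^sup>2)" using lattice by blast
    have "(qdet u v w)\<^sup>2 = (qdet u' v' w')\<^sup>2" using lat_qdet[OF _ det l(2)] L l(1) by simp
    then show ?thesis using l(3) by (simp add: power_mult_distrib)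
  qed
  moreover have "D1 * D2 * D3 + 2 * x * y * z - D1 * z\<^sup>2 - D2 * y\<^sup>2 - D3 * x\<^sup>2 = 4 * m\<^sup>2"
  proof -
    have "of_int (D1 * D2 * D3 + 2 * x * y * z - D1 * z\<^sup>2 - D2 * y\<^sup>2 - D3 * x\<^sup>2) = (of_int (4 * m\<^sup>2) :: rat)"
      using qip_gram_det[of a b u v w] unfolding det4 D1(1) D2(1) D3(1) x y z by simp
    then show ?thesis by (simp only: of_int_eq_iff)
  qed
  moreover have "D1 * D2 - x\<^sup>2 > 0 \<and> 4 * D3 * (D1 * D2 - x\<^sup>2) \<le> 16 * m\<^sup>2 + (D1 + D2) * (D1 * D2 - x\<^sup>2)"
  proof -
    obtain h2 h3 r s t where h: "h2 > 0" "h3 > 0"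
      and gs: "\<And>x y z. nm (qcomb 0 x y z u v w) = nm u * (x + r * y + s * z)\<^sup>2 + h2 * (y + t * z)\<^sup>2 + h3 * z\<^sup>2"
      and h2: "nm u * h2 = nm u * nm v - (qip a b u v)\<^sup>2"
      and h3: "nm u * h2 * h3 = (of_int a * of_int b * qdet u v w)\<^sup>2"
      by (rule gram_schmidt[OF neg det]) blast
    define \<Delta> where "\<Delta> = D1 * D2 - x\<^sup>2"
    have D1p: "of_int D1 > (0::rat)" using \<open>D1 > 0\<close> by simp
    have \<Delta>: "of_int D1 * h2 = of_int \<Delta>" using h2 unfolding D1 D2 x \<Delta>_def by simp
    then have "of_int \<Delta> > (0::rat)" using D1p h(1) by (metis mult_pos_pos)
    then have \<Delta>0: "\<Delta> > 0" by simp
    have \<Delta>3: "of_int \<Delta> * h3 = of_int (4 * m\<^sup>2)" using h3 unfolding D1 det4 \<Delta> .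
    have "nm v = nm u * r\<^sup>2 + h2" using gs[of 0 1 0] unfolding qcomb_basis by simp
    then have h2D: "h2 \<le> of_int D2" using D1p unfolding D1 D2 by simp
    \<comment> \<open>Subtracting suitable multiples of v and u from w leaves a projection to the
      plane of norm at most (D1 + h2)/4. Minimality of D3 against the result is the last clause of
      \<open>rdata\<close>.\<close>
    obtain n2 where n2: "(t - of_int n2)\<^sup>2 \<le> 1/4" using round_sq by blast
    obtain n1 where n1: "((s + r * (- of_int n2)) - of_int n1)\<^sup>2 \<le> 1/4" using round_sq by blast
    define q where "q = qcomb 0 (- of_int n1) (- of_int n2) 1 u v w"
    have "q \<in> L"
    proof -
      have "q = w - qscale (of_int n1) u - qscale (of_int n2) v" unfolding q_def by (rule quat_eqI) simp_all
      then show ?thesis using closed uL by simp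
    qed
    then have "nm w \<le> nm q" using min3 in3[OF q_def] by simp
    also have "\<dots> = of_int D1 * ((s + r * (- of_int n2)) - of_int n1)\<^sup>2 + h2 * (t - of_int n2)\<^sup>2 + h3"
      unfolding q_def gs D1 by (simp add: algebra_simps)
    also have "\<dots> \<le> of_int D1 * (1/4) + h2 * (1/4) + h3"
      using D1p h n1 n2 by (intro add_mono mult_left_mono) auto
    also have "\<dots> \<le> of_int D1 * (1/4) + of_int D2 * (1/4) + h3" using h2D by simp
    finally have "4 * of_int D3 \<le> of_int D1 + of_int D2 + 4 * h3" unfolding D3 by simp
    then have "of_int \<Delta> * (4 * of_int D3) \<le> of_int \<Delta> * (of_int D1 + of_int D2 + 4 * h3)"
      using \<Delta>0 by (intro mult_left_mono) auto
    also have "\<dots> = of_int (16 * m\<^sup>2 + (D1 + D2) * \<Delta>)"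
      using \<Delta>3 by (simp add: algebra_simps)
    finally have "of_int (4 * D3 * \<Delta>) \<le> (of_int (16 * m\<^sup>2 + (D1 + D2) * \<Delta>) :: rat)" by (simp add: mult_ac)
    then show ?thesis using \<Delta>0 unfolding \<Delta>_def of_int_le_iff by blast
  qed
  ultimately have "rdata m D1 D2 D3 x y z"
    unfolding rdata_def using D13 D12 D23 bx byy bz D1(2) D2(2) D3(2) by blast
  then show ?thesis using that D1(1) D2(1) D3(1) x y z by blast
qed

lemma qip_cauchy:
  shows "(qip a b x y)\<^sup>2 \<le> nm x * nm y"
proof (cases "nm y = 0")
  case True
  then have "qip a b x y = 0" using qip_pos(2)[OF neg, of y] by (simp add: qip_def)
  then show ?thesis using True by simp
next
  case False
  then have "nm y > 0" using qip_pos(1)[OF neg, of y] by simp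
  have "0 \<le> nm (qscale (nm y) x - qscale (qip a b x y) y)" using qip_pos(1)[OF neg] by blast
  also have "\<dots> = nm y * (nm x * nm y - (qip a b x y)\<^sup>2)"
    by (simp add: qip_linear qip_comm[of a b y x] power2_eq_square algebra_simps)
  finally show ?thesis using \<open>nm y > 0\<close> by (simp add: zero_le_mult_iff)
qed

text \<open>A vector is determined by its inner products with a basis; these are integers, and
  Cauchy-Schwarz bounds them.\<close>

lemma finite_norm: "finite {x \<in> L. nm x = of_int D}"
proof -
  obtain u v w where L: "L = lat u v w" and det: "qdet u v w \<noteq> 0" using lattice by blast
  have uL: "u \<in> L" "v \<in> L" "w \<in> L" unfolding L by (rule lat_group)+
  let ?S = "{x \<in> L. nm x = of_int D}"
  define f where "f x = (\<lfloor>qip a b x u\<rfloor>, \<lfloor>qip a b x v\<rfloor>, \<lfloor>qip a b x w\<rfloor>)" for x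
  have bound: "\<exists>B::int. \<forall>x\<in>?S. \<bar>\<lfloor>qip a b x t\<rfloor>\<bar> \<le> B" if t: "t \<in> L" for t
  proof -
    obtain E where E: "nm t = of_int E" using norm[OF t] by blast
    have "\<bar>\<lfloor>qip a b x t\<rfloor>\<bar> \<le> D * E" if x: "x \<in> L" "nm x = of_int D" for x
    proof -
      obtain i where i: "qip a b x t = of_int i" using ip[OF x(1) t] by (auto elim: Ints_cases)
      have "of_int (i\<^sup>2) \<le> (of_int (D * E) :: rat)" using qip_cauchy[of x t] x E i by simp
      then have "i\<^sup>2 \<le> D * E" by (simp only: of_int_le_iff)
      moreover have "\<bar>i\<bar> \<le> i\<^sup>2"
      proof (cases "i = 0")
        case False
        then have "\<bar>i\<bar> * 1 \<le> \<bar>i\<bar> * \<bar>i\<bar>" by (intro mult_left_mono) auto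
        then show ?thesis by (simp add: power2_eq_square abs_mult_self_eq)
      qed simp
      ultimately show ?thesis using i by simp
    qed
    then show ?thesis by blast
  qed
  obtain B1 B2 B3 where B: "\<forall>x\<in>?S. \<bar>\<lfloor>qip a b x u\<rfloor>\<bar> \<le> B1" "\<forall>x\<in>?S. \<bar>\<lfloor>qip a b x v\<rfloor>\<bar> \<le> B2"
    "\<forall>x\<in>?S. \<bar>\<lfloor>qip a b x w\<rfloor>\<bar> \<le> B3"
    using bound[OF uL(1)] bound[OF uL(2)] bound[OF uL(3)] by (elim exE)
  have "f ` ?S \<subseteq> {-B1..B1} \<times> {-B2..B2} \<times> {-B3..B3}"
    using B by (force simp: f_def abs_le_iff)
  then have fin: "finite (f ` ?S)" by (rule finite_subset) simp
  have inj: "inj_on f ?S"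
  proof (rule inj_onI)
    fix x y assume xy: "x \<in> ?S" "y \<in> ?S" "f x = f y"
    then have xyL: "x \<in> L" "y \<in> L" by auto
    have fl: "of_int \<lfloor>qip a b q t\<rfloor> = qip a b q t" if "q \<in> L" "t \<in> L" for q t
      using ip[OF that] by (auto elim: Ints_cases)
    have eq: "qip a b x t = qip a b y t" if "t \<in> {u, v, w}" for t
    proof -
      have "\<lfloor>qip a b x t\<rfloor> = \<lfloor>qip a b y t\<rfloor>" using xy(3) that by (auto simp: f_def)
      moreover have "t \<in> L" using that uL by auto
      ultimately show ?thesis using fl xyL by metis
    qed
    define d where "d = x - y"
    have dL: "d \<in> L" unfolding d_def using closed xyL by blast
    then obtain i j k where "d = qcomb 0 (of_int i) (of_int j) (of_int k) u v w" unfolding L lat_def by blast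
    then have "qip a b d d = of_int i * qip a b d u + of_int j * qip a b d v + of_int k * qip a b d w"
      by (simp add: qcomb_def qip_linear)
    also have "\<dots> = 0" using eq by (simp add: d_def qip_linear)
    finally have "d = 0" using nm_eq_0[OF dL] by simp
    then show "x = y" by (simp add: d_def)
  qed
  show ?thesis using finite_imageD[OF fin inj] .
qed

end

section \<open>Lattices with equal representation numbers\<close>

lemma lat_subset:
  assumes "r \<in> lat u v w" "s \<in> lat u v w" "t \<in> lat u v w"
  shows "lat r s t \<subseteq> lat u v w"
proof
  fix q assume "q \<in> lat r s t"
  then obtain x y z :: int where q: "q = qcomb 0 (of_int x) (of_int y) (of_int z) r s t" unfolding lat_def by blast
  have "q = qscale (of_int x) r + qscale (of_int y) s + qscale (of_int z) t"
    unfolding q by (rule quat_eqI) simp_all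
  then show "q \<in> lat u v w" using assms by (simp add: lat_group)
qed

lemma card_range_Collect: "inj f \<Longrightarrow> card {q \<in> range f. P q} = card {t. P (f t)}"
proof -
  assume f: "inj f"
  have "{q \<in> range f. P q} = f ` {t. P (f t)}" by auto
  then show ?thesis using f by (simp add: card_image inj_on_subset)
qed

text \<open>Only the Gram matrix of the plane enters on the right, so planes in different lattices
  have equal counts as soon as their Gram matrices agree.\<close>

lemma lat_plane_card:
  assumes det: "qdet u v w \<noteq> 0"
  shows "card {q \<in> lat u v 0. qip a b q q = D} = card {t :: int \<times> int.
    of_int (fst t) ^ 2 * qip a b u u + of_int (snd t) ^ 2 * qip a b v v
      + 2 * of_int (fst t) * of_int (snd t) * qip a b u v = D}"
proof -
  define f :: "int \<times> int \<Rightarrow> quat" where "f t = qcomb 0 (of_int (fst t)) (of_int (snd t)) 0 u v w" for t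
  have n: "qip a b (f t) (f t) = of_int (fst t) ^ 2 * qip a b u u + of_int (snd t) ^ 2 * qip a b v v
      + 2 * of_int (fst t) * of_int (snd t) * qip a b u v" for t
    unfolding f_def by (simp add: qip_qcomb power2_eq_square algebra_simps)
  have e: "qcomb 0 (of_int x) (of_int y) (of_int z) u v 0 = f (x, y)" for x y z
    unfolding f_def by (rule quat_eqI) simp_all
  have "lat u v 0 = range f" unfolding lat_def e by auto
  moreover have "inj f"
    unfolding inj_def f_def qcomb_eq_iff[OF det] of_int_eq_iff by (simp add: prod_eq_iff)
  ultimately show ?thesis using card_range_Collect[of f "\<lambda>q. qip a b q q = D"] by (simp only: n)
qed

lemma lat_line_card:
  assumes det: "qdet u v w \<noteq> 0"
  shows "card {q \<in> lat u 0 0. qip a b q q = D} = card {x :: int. of_int x ^ 2 * qip a b u u = D}"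
proof -
  define f :: "int \<Rightarrow> quat" where "f x = qcomb 0 (of_int x) 0 0 u v w" for x
  have n: "qip a b (f x) (f x) = of_int x ^ 2 * qip a b u u" for x
    unfolding f_def by (simp add: qip_qcomb power2_eq_square)
  have e: "qcomb 0 (of_int x) (of_int y) (of_int z) u 0 0 = f x" for x y z
    unfolding f_def by (rule quat_eqI) simp_all
  have "lat u 0 0 = range f" unfolding lat_def e by auto
  moreover have "inj f"
    unfolding inj_def f_def qcomb_eq_iff[OF det] of_int_eq_iff by simp
  ultimately show ?thesis using card_range_Collect[of f "\<lambda>q. qip a b q q = D"] by (simp only: n)
qed

text \<open>A vector of norm D outside S means, by finiteness, that L has strictly more vectors of
  norm D than S; equal counts carry this over to L' and S'. With S generated by the previous basis
  vectors, it transfers the successive minima.\<close>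

lemma norm_outside_sublattice:
  assumes L: "gross_lattice a b L m" and L': "gross_lattice a b L' m"
    and r: "card {q \<in> L. qip a b q q = of_int D} = card {q \<in> L'. qip a b q q = of_int D}"
    and S: "S \<subseteq> L" "S' \<subseteq> L'" "card {q \<in> S. qip a b q q = of_int D} = card {q \<in> S'. qip a b q q = of_int D}"
    and v: "v \<in> L" "v \<notin> S" "qip a b v v = of_int D"
  shows "\<exists>v'\<in>L'. v' \<notin> S' \<and> qip a b v' v' = of_int D"
proof (rule ccontr)
  assume no: "\<not> ?thesis"
  have f: "finite {q \<in> L. qip a b q q = of_int D}" by (rule gross_lattice.finite_norm[OF L])
  have "q \<in> S'" if "q \<in> L'" "qip a b q q = of_int D" for q
    using no that by auto
  then have "{q \<in> L'. qip a b q q = of_int D} = {q \<in> S'. qip a b q q = of_int D}" using S(2) by auto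
  then have "card {q \<in> S. qip a b q q = of_int D} = card {q \<in> L. qip a b q q = of_int D}"
    using r S(3) by simp
  moreover have "{q \<in> S. qip a b q q = of_int D} \<subseteq> {q \<in> L. qip a b q q = of_int D}" using S(1) by auto
  ultimately have "{q \<in> S. qip a b q q = of_int D} = {q \<in> L. qip a b q q = of_int D}"
    by (intro card_subset_eq[OF f])
  moreover have "v \<in> {q \<in> L. qip a b q q = of_int D}" using v by simp
  ultimately have "v \<in> {q \<in> S. qip a b q q = of_int D}" by (simp only:)
  then show False using v(2) by simp
qed

lemma lat_sublattices: "lat u 0 0 \<subseteq> lat u v w" "lat u v 0 \<subseteq> lat u v w"
  by (rule lat_subset; simp only: lat_group(4,6,7,8))+

section \<open>Comparison of the successive minima below p\<close>

context
  fixes a b p :: int and L L' :: "quat set"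
  assumes L: "gross_lattice a b L p" and L': "gross_lattice a b L' p"
    and count: "\<And>D::int. D < p \<Longrightarrow> card {q \<in> L. qip a b q q = of_int D} = card {q \<in> L'. qip a b q q = of_int D}"
begin

text \<open>Only one inequality is shown, for a minimum below p. Exchanging the lattices gives the
  other, so the minima agree as soon as either is below p.\<close>

lemma first_minimum_le:
  assumes red: "reduced_basis a b L u v w" "reduced_basis a b L' u' v' w'" and D: "qip a b u u = of_int D" "D < p"
  shows "qip a b u' u' \<le> qip a b u u"
proof -
  have r: "L = lat u v w" "qdet u v w \<noteq> 0"
    and min: "\<And>q. q \<in> L' \<Longrightarrow> q \<noteq> 0 \<Longrightarrow> qip a b u' u' \<le> qip a b q q"
    using red unfolding reduced_basis_def by blast+
  have u: "u \<in> L" "u \<notin> {0}" unfolding r(1) using lat_group(6) qdet_zero[OF r(2)] by auto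
  have "{0} \<subseteq> L" "{0} \<subseteq> L'" using gross_lattice.closed(4)[OF L] gross_lattice.closed(4)[OF L'] by auto
  then obtain q where "q \<in> L'" "q \<notin> {0}" "qip a b q q = of_int D"
    using norm_outside_sublattice[OF L L' count[OF D(2)] _ _ refl u D(1)] by blast
  then show ?thesis using min[of q] D by simp
qed

lemma second_minimum_le:
  assumes red: "reduced_basis a b L u v w" "reduced_basis a b L' u' v' w'" and D: "qip a b v v = of_int D" "D < p"
    and u: "qip a b u u = qip a b u' u'"
  shows "qip a b v' v' \<le> qip a b v v"
proof -
  have r: "L = lat u v w" "qdet u v w \<noteq> 0" "L' = lat u' v' w'" "qdet u' v' w' \<noteq> 0"
    and min: "\<And>q. q \<in> L' \<Longrightarrow> q \<notin> lat u' 0 0 \<Longrightarrow> qip a b v' v' \<le> qip a b q q"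
    using red unfolding reduced_basis_def by blast+
  have v: "v \<in> L" "v \<notin> lat u 0 0"
    unfolding r(1) using lat_group(7) lat_sub(1)[OF r(2), of 0 0 1 0] by (simp_all add: qcomb_basis)
  have "card {q \<in> lat u 0 0. qip a b q q = of_int D} = card {q \<in> lat u' 0 0. qip a b q q = of_int D}"
    unfolding lat_line_card[OF r(2)] lat_line_card[OF r(4)] u ..
  moreover have "lat u 0 0 \<subseteq> L" "lat u' 0 0 \<subseteq> L'" unfolding r(1,3) by (rule lat_sublattices)+
  ultimately obtain q where "q \<in> L'" "q \<notin> lat u' 0 0" "qip a b q q = of_int D"
    using norm_outside_sublattice[OF L L' count[OF D(2)] _ _ _ v D(1)] by blast
  then show ?thesis using min[of q] D by simp
qed

lemma third_minimum_le:
  assumes red: "reduced_basis a b L u v w" "reduced_basis a b L' u' v' w'" and D: "qip a b w w = of_int D" "D < p"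
    and g: "qip a b u u = qip a b u' u'" "qip a b v v = qip a b v' v'"
      "qip a b u v = qip a b u' v' \<or> qip a b u v = - qip a b u' v'"
  shows "qip a b w' w' \<le> qip a b w w"
proof -
  have r: "L = lat u v w" "qdet u v w \<noteq> 0" "L' = lat u' v' w'" "qdet u' v' w' \<noteq> 0"
    and min: "\<And>q. q \<in> L' \<Longrightarrow> q \<notin> lat u' v' 0 \<Longrightarrow> qip a b w' w' \<le> qip a b q q"
    using red unfolding reduced_basis_def by blast+
  have w: "w \<in> L" "w \<notin> lat u v 0"
    unfolding r(1) using lat_group(8) lat_sub(2)[OF r(2), of 0 0 0 1] by (simp_all add: qcomb_basis)
  have "card {q \<in> lat u v 0. qip a b q q = of_int D} = card {q \<in> lat u' v' 0. qip a b q q = of_int D}"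
    using g(3)
  proof
    assume e: "qip a b u v = qip a b u' v'"
    show ?thesis unfolding lat_plane_card[OF r(2)] lat_plane_card[OF r(4)] g(1,2) e ..
  next
    assume e: "qip a b u v = - qip a b u' v'"
    \<comment> \<open>The inner product is known only up to sign; replacing v' by -v' keeps the
      plane and changes the sign.\<close>
    have "lat u' v' 0 = lat u' (- v') 0"
    proof
      have "- v' \<in> lat u' v' 0" by (rule lat_group(5), rule lat_group(7))
      then show "lat u' (- v') 0 \<subseteq> lat u' v' 0" by (intro lat_subset) (simp_all add: lat_group)
      have "- (- v') \<in> lat u' (- v') 0" by (rule lat_group(5), rule lat_group(7))
      then show "lat u' v' 0 \<subseteq> lat u' (- v') 0" by (intro lat_subset) (simp_all add: lat_group)
    qed
    moreover have d: "qdet u' (- v') w' \<noteq> 0" using r(4) by (simp add: qdet_def algebra_simps)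
    ultimately show ?thesis
      unfolding lat_plane_card[OF r(2)] by (simp add: lat_plane_card[OF d] g e qip_linear)
  qed
  moreover have "lat u v 0 \<subseteq> L" "lat u' v' 0 \<subseteq> L'" unfolding r(1,3) by (rule lat_sublattices)+
  ultimately obtain q where "q \<in> L'" "q \<notin> lat u' v' 0" "qip a b q q = of_int D"
    using norm_outside_sublattice[OF L L' count[OF D(2)] _ _ _ w D(1)] by blast
  then show ?thesis using min[of q] D by simp
qed

end

definition gram_match :: "int \<Rightarrow> int \<Rightarrow> quat \<Rightarrow> quat \<Rightarrow> quat \<Rightarrow> quat \<Rightarrow> quat \<Rightarrow> quat \<Rightarrow> bool" where
  "gram_match a b u v w u' v' w' \<longleftrightarrow>
     qip a b u u = qip a b u' u' \<and> qip a b v v = qip a b v' v' \<and> qip a b w w = qip a b w' w' \<and>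
     qip a b u v = qip a b u' v' \<and> qip a b u w = qip a b u' w' \<and> qip a b v w = qip a b v' w'"

lemma lat_signs:
  fixes e1 e2 e3 :: int
  assumes e: "e1 \<in> {1, -1}" "e2 \<in> {1, -1}" "e3 \<in> {1, -1}"
  shows "lat (qscale (of_int e1) u) (qscale (of_int e2) v) (qscale (of_int e3) w) = lat u v w"
proof
  show "lat (qscale (of_int e1) u) (qscale (of_int e2) v) (qscale (of_int e3) w) \<subseteq> lat u v w"
    by (intro lat_subset lat_group(3)) (simp_all only: lat_group(6,7,8))
  have s: "q = qscale (of_int e) (qscale (of_int e) q)" if "e \<in> {1, -1}" for q and e :: int
    using that by (intro quat_eqI) auto
  show "lat u v w \<subseteq> lat (qscale (of_int e1) u) (qscale (of_int e2) v) (qscale (of_int e3) w)"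
    using s[OF e(1), of u] s[OF e(2), of v] s[OF e(3), of w] lat_group(3,6,7,8) by (intro lat_subset) metis+
qed

lemma lat_shear:
  "lat u v (w + qscale (of_int g) u + qscale (of_int h) v) = lat u v w"
proof
  show "lat u v (w + qscale (of_int g) u + qscale (of_int h) v) \<subseteq> lat u v w"
    by (intro lat_subset lat_group(1) lat_group(3)) (simp_all only: lat_group(6,7,8))
  have "w = (w + qscale (of_int g) u + qscale (of_int h) v) - qscale (of_int g) u - qscale (of_int h) v" by simp
  also have "\<dots> \<in> lat u v (w + qscale (of_int g) u + qscale (of_int h) v)"
    by (intro lat_group(2) lat_group(3)) (simp_all only: lat_group(6,7,8))
  finally show "lat u v w \<subseteq> lat u v (w + qscale (of_int g) u + qscale (of_int h) v)"
    by (intro lat_subset) (simp_all add: lat_group)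
qed

lemma rdata_neg: "rdata m D1 D2 D3 x y z \<Longrightarrow> rdata m D1 D2 D3 (- x) y (- z)"
  by (simp add: rdata_def)

lemma equal_counts_gram_match:
  assumes L: "gross_lattice a b L p" and L': "gross_lattice a b L' p" and p: "prime p"
    and count: "\<And>D::int. D < p \<Longrightarrow> card {q \<in> L. qip a b q q = of_int D} = card {q \<in> L'. qip a b q q = of_int D}"
  obtains u v w u' v' w' where "L = lat u v w" "L' = lat u' v' w'" "qdet u v w \<noteq> 0" "qdet u' v' w' \<noteq> 0"
    "gram_match a b u v w u' v' w'"
proof -
  note count' = count[symmetric]
  obtain u v w where red: "reduced_basis a b L u v w" using gross_lattice.reduced_basis_exists[OF L] by blast
  obtain u' v' w' where red': "reduced_basis a b L' u' v' w'" using gross_lattice.reduced_basis_exists[OF L'] by blast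
  have B: "L = lat u v w" "qdet u v w \<noteq> 0" "L' = lat u' v' w'" "qdet u' v' w' \<noteq> 0"
    using red red' unfolding reduced_basis_def by auto
  obtain D1 D2 D3 x y z where r: "rdata p D1 D2 D3 x y z"
    and G: "qip a b u u = of_int D1" "qip a b v v = of_int D2" "qip a b w w = of_int D3"
    "qip a b u v = of_int x" "qip a b u w = of_int y" "qip a b v w = of_int z"
    by (rule gross_lattice.reduced_basis_rdata[OF L red])
  obtain D1' D2' D3' x' y' z' where r': "rdata p D1' D2' D3' x' y' z'"
    and G': "qip a b u' u' = of_int D1'" "qip a b v' v' = of_int D2'" "qip a b w' w' = of_int D3'"
    "qip a b u' v' = of_int x'" "qip a b u' w' = of_int y'" "qip a b v' w' = of_int z'"
    by (rule gross_lattice.reduced_basis_rdata[OF L' red'])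
  note le1 = first_minimum_le[OF L L' count red red' G(1), unfolded G G' of_int_le_iff]
    and le1' = first_minimum_le[OF L' L count' red' red G'(1), unfolded G G' of_int_le_iff]
    and le2 = second_minimum_le[OF L L' count red red' G(2), unfolded G G' of_int_le_iff of_int_eq_iff]
    and le2' = second_minimum_le[OF L' L count' red' red G'(2), unfolded G G' of_int_le_iff of_int_eq_iff]
    and le3 = third_minimum_le[OF L L' count red red' G(3), unfolded G G' of_int_le_iff of_int_eq_iff of_int_minus[symmetric]]
    and le3' = third_minimum_le[OF L' L count' red' red G'(3), unfolded G G' of_int_le_iff of_int_eq_iff of_int_minus[symmetric]]
  have p0: "p > 1" using p prime_gt_1_int by blast
  have ord: "D1 \<le> D2" "D2 \<le> D3" "D1' \<le> D2'" "D2' \<le> D3'" using r r' by (auto simp: rdata_def)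
  have D1: "D1' = D1"
  proof (cases "D1 < p \<or> D1' < p")
    case True
    then show ?thesis using le1 le1' by fastforce
  next
    case False
    \<comment> \<open>D1 = 4 would give p \<le> D1 \<le> D2 = p, hence p = 4; so both first minima
      are 3.\<close>
    have "p \<noteq> 4" using p prime_odd_int[of p] by auto
    moreover have "D1 = 3 \<or> (D1 = 4 \<and> D2 = p \<and> x = 0)" "D1' = 3 \<or> (D1' = 4 \<and> D2' = p \<and> x' = 0)"
      using rdata_large_first[OF r p] rdata_large_first[OF r' p] ord False by linarith+
    ultimately show ?thesis using ord False by linarith
  qed
  note r' = r'[unfolded D1] and G' = G'[unfolded D1]
  have D2x: "D2' = D2 \<and> (x' = x \<or> x' = - x)"
  proof (cases "D2 < p \<or> D2' < p")
    case True
    then have e: "D2' = D2" "D2 < p" using le2 le2' D1 by fastforce+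
    have "p dvd x'\<^sup>2 - x\<^sup>2"
    proof -
      have "4 * p dvd D1 * D2 - x\<^sup>2" "4 * p dvd D1 * D2 - x'\<^sup>2" using r r' e by (auto simp: rdata_def)
      then have "4 * p dvd (D1 * D2 - x\<^sup>2) - (D1 * D2 - x'\<^sup>2)" by (rule dvd_diff)
      then have "4 * p dvd x'\<^sup>2 - x\<^sup>2" by simp
      then show ?thesis by (rule dvd_mult_right)
    qed
    moreover have "\<bar>x'\<bar> + \<bar>x\<bar> < p" using r r' ord e by (auto simp: rdata_def)
    ultimately show ?thesis using sq_eq_if_cong[OF p] e by blast
  next
    case False
    have d: "D1 * D2 - x\<^sup>2 = 4 * p" "D1 * D2' - x'\<^sup>2 = 4 * p"
      using rdata_large[OF r p] rdata_large[OF r' p] ord False by linarith+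
    have "D1 = 3 \<or> (D1 = 4 \<and> D2 = p \<and> x = 0)" "D1 = 3 \<or> (D1 = 4 \<and> D2' = p \<and> x' = 0)"
      using rdata_large_first[OF r p] rdata_large_first[OF r' p] False by linarith+
    then consider "D2 = p" "D2' = p" "x = 0" "x' = 0" | "D1 = 3" by auto
    then show ?thesis
    proof cases
      case 2
      then have "\<bar>x\<bar> \<le> 1" "\<bar>x'\<bar> \<le> 1" using r r' by (auto simp: rdata_def)
      then have "x = 0 \<or> x = 1 \<or> x = -1" "x' = 0 \<or> x' = 1 \<or> x' = -1" by linarith+
      then have sq: "x = 0 \<and> x\<^sup>2 = 0 \<or> (x = 1 \<or> x = -1) \<and> x\<^sup>2 = 1" "x' = 0 \<and> x'\<^sup>2 = 0 \<or> (x' = 1 \<or> x' = -1) \<and> x'\<^sup>2 = 1"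
        by auto
      \<comment> \<open>As x^2 and x'^2 are 0 or 1, the residue of p modulo 3 decides which value
        both have, and this fixes D2.\<close>
      have "3 * D2 - x\<^sup>2 = 4 * p" "3 * D2' - x'\<^sup>2 = 4 * p" using d 2 by auto
      then show ?thesis using sq by presburger
    qed simp
  qed
  then have D2: "D2' = D2" and xx: "x' = x \<or> x' = - x" by auto
  note r' = r'[unfolded D2] and G' = G'[unfolded D2]
  show ?thesis
  proof (cases "D3 < p \<or> D3' < p")
    case True
    have D3: "D3' = D3" "D3 < p" using True le3 le3' D1 D2 xx by fastforce+
    note r' = r'[unfolded D3(1)] and G' = G'[unfolded D3(1)]
    have "D2 < p" using D3 ord by linarith
    obtain e1 e2 e3 where e: "e1 \<in> {1, -1}" "e2 \<in> {1, -1}" "e3 \<in> {1, -1}"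
      "x = e1 * e2 * x'" "y = e1 * e3 * y'" "z = e2 * e3 * z'"
      by (rule rdata_small_signs[OF r r' p \<open>D2 < p\<close>])
    have sq: "of_int e1 * of_int e1 = (1::rat)" "of_int e2 * of_int e2 = (1::rat)" "of_int e3 * of_int e3 = (1::rat)"
      using e(1-3) by auto
    show ?thesis
    proof (rule that[OF B(1) _ B(2)])
      show "L' = lat (qscale (of_int e1) u') (qscale (of_int e2) v') (qscale (of_int e3) w')"
        unfolding B(3) lat_signs[OF e(1-3)] ..
      have "qdet (qscale (of_int e1) u') (qscale (of_int e2) v') (qscale (of_int e3) w') = of_int (e1 * e2 * e3) * qdet u' v' w'"
        by (simp add: qdet_def algebra_simps)
      then show "qdet (qscale (of_int e1) u') (qscale (of_int e2) v') (qscale (of_int e3) w') \<noteq> 0"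
        using B(4) e(1-3) by auto
      show "gram_match a b u v w (qscale (of_int e1) u') (qscale (of_int e2) v') (qscale (of_int e3) w')"
        unfolding gram_match_def qip_linear G G' mult.assoc[symmetric] sq by (simp add: e)
    qed
  next
    case False
    have D: "D1 * D2 - x\<^sup>2 = 4 * p" using rdata_large[OF r p] False by linarith
    obtain e :: int where e: "e \<in> {1, -1}" "x = e * x'" using xx by force
    \<comment> \<open>Replacing v' by e v' makes the inner products of the first two vectors agree;
      it also turns z' into e z'.\<close>
    have rr: "rdata p D1 D2 D3' x y' (e * z')" using r' rdata_neg[OF r'] e by auto
    have pp: "p > 0" using p0 by simp
    obtain g h where gh: "y = y' + g * D1 + h * x" "z = e * z' + g * x + h * D2"
      "D3 = D3' + g\<^sup>2 * D1 + h\<^sup>2 * D2 + 2 * g * h * x + 2 * g * y' + 2 * h * (e * z')"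
      by (rule rdata_shift[OF r rr D pp])
    define v1 where "v1 = qscale (of_int e) v'"
    \<comment> \<open>Translation by the plane vector found in \<open>rdata_shift\<close> aligns the
      projections of the two third basis vectors.\<close>
    define w1 where "w1 = w' + qscale (of_int g) u' + qscale (of_int h) v1"
    have e2: "of_int e * of_int e = (1::rat)" using e(1) by auto
    have G1: "qip a b v1 v1 = of_int D2" "qip a b u' v1 = of_int x" "qip a b v1 w' = of_int (e * z')"
      "qip a b v1 u' = of_int x" "qip a b w' v1 = of_int (e * z')"
      using e(2) e2 by (simp_all add: v1_def qip_linear G' qip_comm[of a b v' u'] qip_comm[of a b w' v'] mult.assoc[symmetric])
    show ?thesis
    proof (rule that[OF B(1) _ B(2)])
      have "lat u' v1 w' = L'" using lat_signs[of 1 e 1 u' v' w'] e(1) B(3) by (simp add: v1_def)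
      then show "L' = lat u' v1 w1" unfolding w1_def lat_shear ..
      have "qdet u' v1 w1 = of_int e * qdet u' v' w'"
        by (simp add: w1_def v1_def qdet_def algebra_simps)
      then show "qdet u' v1 w1 \<noteq> 0" using B(4) e(1) by auto
      have "qip a b u' w1 = of_int y" "qip a b v1 w1 = of_int z"
        unfolding w1_def gh qip_linear G' G1 by simp_all
      moreover have "qip a b w1 w1 = of_int D3"
        unfolding w1_def gh(3) qip_linear qip_comm[of a b w' u'] G' G1 by (simp add: power2_eq_square algebra_simps)
      ultimately show "gram_match a b u v w u' v1 w1"
        unfolding gram_match_def using G G' G1 by simp
    qed
  qed
qed

section \<open>Theta functions\<close>

lemma even_card_neg_closed:
  fixes A :: "quat set"
  assumes "finite A" "\<And>x. x \<in> A \<Longrightarrow> - x \<in> A" "0 \<notin> A"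
  shows "even (card A)"
  using assms
proof (induction A rule: finite_psubset_induct)
  case (psubset A)
  show ?case
  proof (cases "A = {}")
    case False
    then obtain x where x: "x \<in> A" by blast
    then have mx: "- x \<in> A" and x0: "x \<noteq> 0" using psubset.prems by auto
    have ne: "x \<noteq> - x"
    proof
      assume e: "x = - x"
      have "x = 0"
        using arg_cong[OF e, of q0] arg_cong[OF e, of q1] arg_cong[OF e, of q2] arg_cong[OF e, of q3]
        by (intro quat_eqI) simp_all
      then show False using x0 by blast
    qed
    let ?B = "A - {x, - x}"
    have "even (card ?B)"
    proof (rule psubset.IH)
      show "?B \<subset> A" using x by blast
      show "- y \<in> ?B" if "y \<in> ?B" for y
      proof -
        have "- y = x \<Longrightarrow> y = - x" "- y = - x \<Longrightarrow> y = x" by (metis minus_minus)+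
        then show ?thesis using that psubset.prems(1)[of y] by blast
      qed
      show "0 \<notin> ?B" using psubset.prems(2) by blast
    qed
    moreover have "card A = card {x, - x} + card ?B"
    proof -
      have "A = {x, - x} \<union> ?B" using x mx by blast
      moreover have "card ({x, - x} \<union> ?B) = card {x, - x} + card ?B"
        using psubset.hyps by (intro card_Un_disjoint) auto
      ultimately show ?thesis by simp
    qed
    ultimately show ?thesis using ne by simp
  qed simp
qed

text \<open>Sending x to tr(x) and 2x - tr(x) is a bijection onto the pairs (t, v) with v in the
  Gross lattice of norm 4n - t^2; that every such pair occurs is \<open>in_order_iff_gross\<close>.
  The range of t is generous, since t^2 \<le> 4n implies |t| \<le> 2n.\<close>

lemma theta_coefficient:
  assumes ab: "a < 0" "b < 0" and ord: "is_order a b R" and g: "good_basis a b R i j k A B C U V W"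
  shows "card {x \<in> R. qnorm a b x = of_nat n} =
    (\<Sum>t\<in>{- 2 * int n..2 * int n}. card {v \<in> gross R. qip a b v v = of_int (4 * int n - t\<^sup>2)})"
proof -
  interpret gross_lattice a b "gross R" "\<bar>tdisc A B C U V W\<bar>"
    by (rule gross_is_gross_lattice[OF ab ord g])
  define S where "S t = {v \<in> gross R. qip a b v v = of_int (4 * int n - t\<^sup>2)}" for t
  define f where "f x = (\<lfloor>2 * q0 x\<rfloor>, Quat 0 (2 * q1 x) (2 * q2 x) (2 * q3 x))" for x
  let ?X = "{x \<in> R. qnorm a b x = of_nat n}"
  let ?T = "{- 2 * int n..2 * int n}"
  have tr: "of_int \<lfloor>2 * q0 x\<rfloor> = 2 * q0 x" if xR: "x \<in> R" for x
  proof -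
    obtain z where "2 * q0 x = of_int z" using norm_trace_int(1)[OF ord g xR] by (rule Ints_cases)
    then show ?thesis by simp
  qed
  have "inj_on f ?X"
  proof (rule inj_onI)
    fix x y assume xy: "x \<in> ?X" "y \<in> ?X" "f x = f y"
    then have xyR: "x \<in> R" "y \<in> R" by blast+
    have e: "\<lfloor>2 * q0 x\<rfloor> = \<lfloor>2 * q0 y\<rfloor>" "2 * q1 x = 2 * q1 y" "2 * q2 x = 2 * q2 y" "2 * q3 x = 2 * q3 y"
      using xy(3) unfolding f_def prod.inject quat.inject by blast+
    have "2 * q0 x = 2 * q0 y" using tr[OF xyR(1)] tr[OF xyR(2)] unfolding e(1) by (rule trans[OF sym])
    then show "x = y" using e(2-4) by (intro quat_eqI) simp_all
  qed
  moreover have "f ` ?X = Sigma ?T S"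
  proof
    show "f ` ?X \<subseteq> Sigma ?T S"
    proof
      fix z assume "z \<in> f ` ?X"
      then obtain x where x: "x \<in> R" "qnorm a b x = of_nat n" "z = f x" by auto
      define t where "t = \<lfloor>2 * q0 x\<rfloor>"
      have t: "of_int t = 2 * q0 x" using tr[OF x(1)] by (simp add: t_def)
      let ?v = "Quat 0 (2 * q1 x) (2 * q2 x) (2 * q3 x)"
      have vv: "qip a b ?v ?v = of_int (4 * int n - t\<^sup>2)" unfolding gross_norm x(2) by (simp add: t)
      have vR: "?v \<in> gross R" using x(1) by (auto simp: gross_def)
      have "(0::rat) \<le> of_int (4 * int n - t\<^sup>2)" using qip_pos(1)[OF ab, of ?v] vv by simp
      then have "0 \<le> 4 * int n - t\<^sup>2" unfolding of_int_0_le_iff .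
      then have "t\<^sup>2 \<le> 4 * int n" by simp
      also have "\<dots> \<le> (2 * int n)\<^sup>2"
      proof (cases n)
        case (Suc l)
        then have "1 * (4 * int n) \<le> int n * (4 * int n)" by (intro mult_right_mono) auto
        then show ?thesis by (simp add: power2_eq_square)
      qed simp
      finally have "t\<^sup>2 \<le> (2 * int n)\<^sup>2" .
      then have "\<bar>t\<bar> \<le> \<bar>2 * int n\<bar>" by (rule iffD2[OF abs_le_square_iff])
      then have "t \<in> ?T" unfolding atLeastAtMost_iff by linarith
      moreover have "?v \<in> S t" unfolding S_def using vv vR by blast
      ultimately show "z \<in> Sigma ?T S" unfolding x(3) f_def t_def[symmetric] by (rule SigmaI)
    qed
    show "Sigma ?T S \<subseteq> f ` ?X"
    proof
      fix z assume "z \<in> Sigma ?T S"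
      then obtain t v where "z = (t, v)" "v \<in> S t" by (elim SigmaE) blast
      then have z: "z = (t, v)" "v \<in> gross R" "qip a b v v = of_int (4 * int n - t\<^sup>2)"
        unfolding S_def by blast+
      define x where "x = Quat (of_int t / 2) (q1 v / 2) (q2 v / 2) (q3 v / 2)"
      have v: "Quat 0 (2 * q1 x) (2 * q2 x) (2 * q3 x) = v"
        using closed(6)[OF z(2)] by (intro quat_eqI) (simp_all add: x_def)
      have t: "2 * q0 x = of_int t" by (simp add: x_def)
      have n: "qnorm a b x = of_int (int n)"
        using gross_norm[of a b x] unfolding v z(3) t by simp
      have "x \<in> R" unfolding in_order_iff_gross[OF ord g] v using z(2) t n by blast
      moreover have "f x = z" unfolding f_def v t z(1) by simp
      moreover have "qnorm a b x = of_nat n" using n by simp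
      ultimately show "z \<in> f ` ?X" by blast
    qed
  qed
  ultimately have "card ?X = card (Sigma ?T S)" using card_image[of f ?X] by simp
  also have "\<dots> = (\<Sum>t\<in>?T. card (S t))"
    unfolding S_def by (intro card_SigmaI ballI finite_norm) simp
  finally show ?thesis unfolding S_def .
qed

context gross_lattice
begin

lemma count_zero:
  assumes "D < 0 \<or> \<not> (4 dvd D \<or> 4 dvd D + 1)"
  shows "card {v \<in> L. nm v = of_int D} = 0"
proof -
  have "nm v \<noteq> of_int D" if v: "v \<in> L" for v
  proof
    assume e: "nm v = of_int D"
    have "(0::rat) \<le> of_int D" using qip_pos(1)[OF neg, of v] e by simp
    then have "D \<ge> 0" by simp
    then show False using norm[OF v] e assms by auto
  qed
  then have "{v \<in> L. nm v = of_int D} = {}" by blast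
  then show ?thesis by (simp only: card.empty)
qed

lemma count_0: "card {v \<in> L. nm v = of_int 0} = 1"
proof -
  have "{v \<in> L. nm v = of_int 0} = {0}" using nm_eq_0 closed(4) by auto
  then show ?thesis by simp
qed

lemma count_even:
  assumes "D > 0"
  shows "even (card {v \<in> L. nm v = of_int D})"
proof (rule even_card_neg_closed[OF finite_norm])
  show "- x \<in> {v \<in> L. nm v = of_int D}" if "x \<in> {v \<in> L. nm v = of_int D}" for x
    using that closed(5) by (simp add: qip_linear)
  show "0 \<notin> {v \<in> L. nm v = of_int D}" using assms by (simp add: qip_linear)
qed

text \<open>Let v and w have norm 4n and inner product x, with w neither v nor -v. Their minor is
  (4n - x)(4n + x); the factors are positive with sum 8n \<le> 2m, and even because v - w has norm
  8n - 2x, which must be 0 or 3 modulo 4. The prime m divides a factor, which then equals m,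
  although m > 2 is odd.\<close>

lemma count_le_2:
  assumes p: "prime m" and n: "n > 0" "4 * n \<le> m"
  shows "card {v \<in> L. nm v = of_int (4 * n)} \<le> 2"
proof (cases "{v \<in> L. nm v = of_int (4 * n)} = {}")
  case False
  then obtain v where v: "v \<in> L" "nm v = of_int (4 * n)" by blast
  have "w = v \<or> w = - v" if w: "w \<in> L" "nm w = of_int (4 * n)" for w
  proof (rule ccontr)
    assume ne: "\<not> ?thesis"
    obtain x where x: "qip a b v w = of_int x" using ip[OF v(1) w(1)] by (auto elim: Ints_cases)
    have N: "nm (v - w) = of_int (8 * n - 2 * x)" "nm (v + w) = of_int (8 * n + 2 * x)"
      using v w x by (simp_all add: qip_linear qip_comm[of a b w v])
    have "v - w \<noteq> 0" "v + w \<noteq> 0" using ne by (auto simp: add_eq_0_iff)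
    then have "nm (v - w) > 0" "nm (v + w) > 0" using nm_pos closed v w by auto
    then have b: "4 * n - x > 0" "4 * n + x > 0" unfolding N by auto
    obtain E where "nm (v - w) = of_int E" "4 dvd E \<or> 4 dvd E + 1" using norm closed(2)[OF v(1) w(1)] by blast
    then have "4 dvd 8 * n - 2 * x \<or> 4 dvd 8 * n - 2 * x + 1" unfolding N of_int_eq_iff by blast
    then have ev: "even x" by presburger
    obtain k where "of_int (4 * n * (4 * n) - x\<^sup>2) = (of_int (4 * m * k) :: rat)"
      using minor[OF v(1) w(1)] unfolding v w x by auto
    then have "4 * n * (4 * n) - x\<^sup>2 = 4 * m * k" by (simp only: of_int_eq_iff)
    then have "(4 * n - x) * (4 * n + x) = m * (4 * k)" by (simp add: power2_eq_square algebra_simps)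
    then have "m dvd (4 * n - x) * (4 * n + x)" by simp
    then have "m dvd 4 * n - x \<or> m dvd 4 * n + x" using p prime_dvd_mult_iff by blast
    then obtain s where s: "m dvd s" "s = 4 * n - x \<or> s = 4 * n + x" by blast
    then have s2: "0 < s" "s < 2 * m" "even s" using b n ev by auto
    obtain l where l: "s = m * l" using s(1) by (elim dvdE)
    have "l > 0" using s2(1) l m_pos by (simp add: zero_less_mult_iff)
    moreover have "m * l < m * 2" using s2(2) l by simp
    then have "l < 2" using m_pos by simp
    ultimately have "s = m" using l by simp
    then have "even m" using s2 by simp
    moreover have "m > 2" using n by linarith
    ultimately show False using prime_odd_int[OF p] by simp
  qed
  then have "{v \<in> L. nm v = of_int (4 * n)} \<subseteq> {v, - v}" by blast
  then have "card {v \<in> L. nm v = of_int (4 * n)} \<le> card {v, - v}" by (intro card_mono) auto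
  also have "\<dots> \<le> 2" by (simp add: card_insert_if)
  finally show ?thesis .
next
  case True
  show ?thesis unfolding True by simp
qed

end

text \<open>Stated for arbitrary functions, as only their vanishing pattern, their parity and the
  bound at multiples of 4 enter. Each coefficient brings in the value at 4N - 1 twice and the value
  at 4N once.\<close>

lemma equal_theta_counts:
  fixes r r' :: "int \<Rightarrow> nat" and p :: int
  assumes zero: "\<And>D. D < 0 \<or> \<not> (4 dvd D \<or> 4 dvd D + 1) \<Longrightarrow> r D = r' D" "r 0 = r' 0"
    and ev: "\<And>D. D > 0 \<Longrightarrow> even (r D)" "\<And>D. D > 0 \<Longrightarrow> even (r' D)"
    and le: "\<And>n. n > 0 \<Longrightarrow> 4 * n \<le> p \<Longrightarrow> r (4 * n) \<le> 2" "\<And>n. n > 0 \<Longrightarrow> 4 * n \<le> p \<Longrightarrow> r' (4 * n) \<le> 2"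
    and theta: "\<And>n. (\<Sum>t\<in>{- 2 * int n..2 * int n}. r (4 * int n - t\<^sup>2)) = (\<Sum>t\<in>{- 2 * int n..2 * int n}. r' (4 * int n - t\<^sup>2))"
    and D: "D < p"
  shows "r D = r' D"
proof -
  have "\<forall>D::int. D \<le> 4 * int n \<and> D < p \<longrightarrow> r D = r' D" for n
  proof (induction n)
    case 0
    show ?case
    proof (intro allI impI)
      fix D :: int assume "D \<le> 4 * int 0 \<and> D < p"
      then show "r D = r' D" using zero by (cases "D = 0") auto
    qed
  next
    case (Suc n)
    define N where "N = int (Suc n)"
    have N: "N > 0" by (simp add: N_def)
    have two: "r (4 * N - 1) = r' (4 * N - 1) \<and> r (4 * N) = r' (4 * N)" if "4 * N - 1 < p"
    proof -
      \<comment> \<open>Only t = 0, 1, -1 give 4N - t^2 above 4(N - 1); the other terms agree by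
        induction.\<close>
      let ?T = "{- 2 * N..2 * N}" let ?U = "{-1, 0, 1 :: int}"
      have U: "?U \<subseteq> ?T" using N by auto
      have split: "sum f ?T = sum f (?T - ?U) + (f (-1) + f 0 + f 1)" for f :: "int \<Rightarrow> nat"
        using sum.subset_diff[OF U, of f] by simp
      have "(\<Sum>t\<in>?T - ?U. r (4 * N - t\<^sup>2)) = (\<Sum>t\<in>?T - ?U. r' (4 * N - t\<^sup>2))"
      proof (rule sum.cong[OF refl])
        fix t assume "t \<in> ?T - ?U"
        then have "2 \<le> \<bar>t\<bar>" by auto
        then have "2\<^sup>2 \<le> \<bar>t\<bar>\<^sup>2" by (intro power_mono) auto
        then have "4 * N - t\<^sup>2 \<le> 4 * int n" by (simp add: N_def)
        moreover have "4 * int n < p" using that by (simp add: N_def)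
        ultimately show "r (4 * N - t\<^sup>2) = r' (4 * N - t\<^sup>2)" using Suc.IH by force
      qed
      then have eq: "2 * r (4 * N - 1) + r (4 * N) = 2 * r' (4 * N - 1) + r' (4 * N)"
        using theta[of "Suc n"] unfolding N_def[symmetric] split by simp
      obtain s s' where s: "r (4 * N - 1) = 2 * s" "r' (4 * N - 1) = 2 * s'"
        using ev(1)[of "4 * N - 1"] ev(2)[of "4 * N - 1"] N by (auto elim!: evenE)
      obtain t t' where t: "r (4 * N) = 2 * t" "r' (4 * N) = 2 * t'"
        using ev(1)[of "4 * N"] ev(2)[of "4 * N"] N by (auto elim!: evenE)
      \<comment> \<open>4N - 1 < p gives 4N \<le> p, which is just what the bound at 4N
        needs.\<close>
      have "t \<le> 1" "t' \<le> 1" using le[OF N] that t by auto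
      moreover have "2 * s + t = 2 * s' + t'" using eq s t by linarith
      ultimately have "t = t' \<and> s = s'" by presburger
      then show ?thesis using s t by simp
    qed
    show ?case
    proof (intro allI impI)
      fix D :: int assume D: "D \<le> 4 * int (Suc n) \<and> D < p"
      then have "D \<le> 4 * int n \<or> D = 4 * N - 3 \<or> D = 4 * N - 2 \<or> D = 4 * N - 1 \<or> D = 4 * N"
        unfolding N_def by (simp add: algebra_simps) presburger
      then consider "D \<le> 4 * int n" | "D = 4 * N - 3" | "D = 4 * N - 2" | "D = 4 * N - 1" | "D = 4 * N"
        by blast
      then show "r D = r' D"
      proof cases
        case 1 then show ?thesis using Suc.IH D by blast
      next
        case 2
        then have "\<not> (4 dvd D \<or> 4 dvd D + 1)" by presburger
        then show ?thesis using zero(1) by blast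
      next
        case 3
        then have "\<not> (4 dvd D \<or> 4 dvd D + 1)" by presburger
        then show ?thesis using zero(1) by blast
      next
        case 4 then show ?thesis using two D by simp
      next
        case 5 then show ?thesis using two D by simp
      qed
    qed
  qed
  from this[of "nat D"] show ?thesis using D by (cases "D \<ge> 0") (auto intro: zero)
qed

section \<open>Isometries of Gross lattices\<close>

text \<open>Inner products with all z determine the imaginary part of a product, and here they are
  expressed by real parts, inner products and oriented volume. A linear bijection that preserves
  these three therefore preserves products.\<close>

lemma qip_qmult:
  "qip a b (qmult a b x y) z = q0 x * qip a b y z + q0 y * qip a b x z + of_int a * of_int b * qdet x y z"
  by (simp add: qip_def qmult_sel qdet_def algebra_simps)

lemma q0_qmult: "q0 (qmult a b x y) = q0 x * q0 y - qip a b x y"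
  by (simp add: qip_def qmult_sel)

lemma oriented_isometry_ring_iso:
  assumes ab: "a < 0" "b < 0"
    and R: "is_order a b R" "good_basis a b R i j k A B C U V W"
    and R': "is_order a b R'" "good_basis a b R' i' j' k' A' B' C' U' V' W'"
    and L: "gross R = lat u v w" "gross R' = lat u' v' w'"
    and d: "qdet u v w \<noteq> 0" "qdet u' v' w' = qdet u v w"
    and g: "gram_match a b u v w u' v' w'"
  shows "ring_iso_orders a b R R'"
proof -
  have d': "qdet u' v' w' \<noteq> 0" using d by simp
  have pure: "q0 x = 0" if "x \<in> gross S" for x S using that by (auto simp: gross_def)
  have q0: "q0 u = 0" "q0 v = 0" "q0 w = 0" "q0 u' = 0" "q0 v' = 0" "q0 w' = 0"
    by (rule pure[of _ R], unfold L, rule lat_group)+ (rule pure[of _ R'], unfold L, rule lat_group)+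
  \<comment> \<open>The linear map with u, v, w \<mapsto> u', v', w' that fixes 1, written by
    Cramer's rule.\<close>
  define \<Phi> where "\<Phi> q = qcomb (q0 q) (qdet q v w / qdet u v w) (qdet u q w / qdet u v w) (qdet u v q / qdet u v w) u' v' w'" for q
  have \<Phi>: "\<Phi> (qcomb n x y z u v w) = qcomb n x y z u' v' w'" for n x y z
    unfolding \<Phi>_def using d(1) by (simp add: qdet_qcomb q0)
  have ex: "\<exists>n x y z. q = qcomb n x y z u v w" for q using qcomb_exists[OF d(1)] by metis
  have ex': "\<exists>n x y z. q = qcomb n x y z u' v' w'" for q using qcomb_exists[OF d'] by metis
  have ip: "qip a b (\<Phi> q) (\<Phi> r) = qip a b q r" for q r
  proof -
    obtain n x y z where q: "q = qcomb n x y z u v w" using ex by blast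
    obtain n' x' y' z' where r: "r = qcomb n' x' y' z' u v w" using ex by blast
    show ?thesis using g unfolding q r \<Phi> qip_qcomb gram_match_def by simp
  qed
  have q0\<Phi>: "q0 (\<Phi> q) = q0 q" for q by (simp add: \<Phi>_def q0)
  have add: "\<Phi> (q + r) = \<Phi> q + \<Phi> r" for q r
  proof -
    obtain n x y z where q: "q = qcomb n x y z u v w" using ex by blast
    obtain n' x' y' z' where r: "r = qcomb n' x' y' z' u v w" using ex by blast
    show ?thesis unfolding q r qcomb_add \<Phi> ..
  qed
  have det: "qdet (\<Phi> q) (\<Phi> r) (\<Phi> s) = qdet q r s" for q r s
  proof -
    obtain n1 x1 y1 z1 where q: "q = qcomb n1 x1 y1 z1 u v w" using ex by blast
    obtain n2 x2 y2 z2 where r: "r = qcomb n2 x2 y2 z2 u v w" using ex by blast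
    obtain n3 x3 y3 z3 where s: "s = qcomb n3 x3 y3 z3 u v w" using ex by blast
    show ?thesis unfolding q r s \<Phi> qdet_three_qcomb d(2) ..
  qed
  have mult: "\<Phi> (qmult a b x y) = qmult a b (\<Phi> x) (\<Phi> y)" for x y
  proof -
    \<comment> \<open>The defect of multiplicativity is orthogonal to the image of \<Phi>. As it
      lies in that image itself, its inner product with itself is 0, and definiteness kills its
      imaginary part.\<close>
    define e where "e = \<Phi> (qmult a b x y) - qmult a b (\<Phi> x) (\<Phi> y)"
    obtain n r s t where "e = qcomb n r s t u' v' w'" using ex' by blast
    then have "e = \<Phi> (qcomb n r s t u v w)" unfolding \<Phi> .
    then obtain z where z: "e = \<Phi> z" by blast
    have "qip a b e e = qip a b (\<Phi> (qmult a b x y)) (\<Phi> z) - qip a b (qmult a b (\<Phi> x) (\<Phi> y)) (\<Phi> z)"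
      unfolding z[symmetric] by (simp add: e_def qip_linear)
    also have "\<dots> = 0" unfolding ip qip_qmult q0\<Phi> det by simp
    finally have "q1 e = 0 \<and> q2 e = 0 \<and> q3 e = 0" using qip_pos(2)[OF ab] by blast
    moreover have "q0 e = 0" unfolding e_def quat_sel q0\<Phi> q0_qmult ip by simp
    ultimately have "e = 0" by (intro quat_eqI) simp_all
    then show ?thesis by (simp add: e_def)
  qed
  have mem: "qcomb n x y z u' v' w' \<in> R' \<longleftrightarrow> qcomb n x y z u v w \<in> R" for n x y z
  proof -
    have D: "Quat 0 (2 * q1 (qcomb n x y z u v w)) (2 * q2 (qcomb n x y z u v w)) (2 * q3 (qcomb n x y z u v w))
        = qcomb 0 (2 * x) (2 * y) (2 * z) u v w"
      "Quat 0 (2 * q1 (qcomb n x y z u' v' w')) (2 * q2 (qcomb n x y z u' v' w')) (2 * q3 (qcomb n x y z u' v' w'))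
        = qcomb 0 (2 * x) (2 * y) (2 * z) u' v' w'"
      by (rule quat_eqI; simp add: q0 algebra_simps)+
    have I: "qcomb 0 x y z r s t \<in> lat r s t \<longleftrightarrow> x \<in> \<int> \<and> y \<in> \<int> \<and> z \<in> \<int>" if "qdet r s t \<noteq> 0" for r s t x y z
      unfolding lat_def mem_Collect_eq qcomb_eq_iff[OF that] by (auto elim!: Ints_cases)
    have "qnorm a b (\<Phi> (qcomb n x y z u v w)) = qnorm a b (qcomb n x y z u v w)"
      unfolding qnorm_eq ip q0\<Phi> ..
    then have "qnorm a b (qcomb n x y z u' v' w') = qnorm a b (qcomb n x y z u v w)" unfolding \<Phi> .
    moreover have "q0 (qcomb n x y z u' v' w') = q0 (qcomb n x y z u v w)" by (simp add: q0)
    ultimately show ?thesis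
      unfolding in_order_iff_gross[OF R] in_order_iff_gross[OF R'] D L I[OF d(1)] I[OF d'] by (simp only:)
  qed
  have "bij_betw \<Phi> R R'"
    unfolding bij_betw_def
  proof
    show "inj_on \<Phi> R"
    proof (rule inj_onI)
      fix q r assume e: "\<Phi> q = \<Phi> r"
      obtain n x y z where q: "q = qcomb n x y z u v w" using ex by blast
      obtain n' x' y' z' where r: "r = qcomb n' x' y' z' u v w" using ex by blast
      show "q = r" using e unfolding q r \<Phi> qcomb_eq_iff[OF d(1)] qcomb_eq_iff[OF d'] .
    qed
    show "\<Phi> ` R = R'"
    proof
      show "\<Phi> ` R \<subseteq> R'"
      proof
        fix r assume "r \<in> \<Phi> ` R"
        then obtain q where q: "q \<in> R" "r = \<Phi> q" by blast
        obtain n x y z where e: "q = qcomb n x y z u v w" using ex by blast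
        show "r \<in> R'" using q(1) unfolding q(2) e \<Phi> mem .
      qed
      show "R' \<subseteq> \<Phi> ` R"
      proof
        fix r assume r: "r \<in> R'"
        obtain n x y z where e: "r = qcomb n x y z u' v' w'" using ex' by blast
        have "qcomb n x y z u v w \<in> R" using r unfolding e mem .
        moreover have "r = \<Phi> (qcomb n x y z u v w)" unfolding e \<Phi> ..
        ultimately show "r \<in> \<Phi> ` R" by blast
      qed
    qed
  qed
  moreover have "\<Phi> qone = qone"
  proof -
    have "qone = qcomb 1 0 0 0 u v w" "qone = qcomb 1 0 0 0 u' v' w'" by (rule quat_eqI; simp)+
    then show ?thesis using \<Phi> by metis
  qed
  ultimately show ?thesis unfolding ring_iso_orders_def using add mult by blast
qed

text \<open>Equal Gram matrices determine \<open>qdet\<close> up to sign, and in rank three negating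
  all basis vectors changes that sign while keeping the Gram matrix.\<close>

lemma isometry_ring_iso:
  assumes ab: "a < 0" "b < 0"
    and R: "is_order a b R" "good_basis a b R i j k A B C U V W"
    and R': "is_order a b R'" "good_basis a b R' i' j' k' A' B' C' U' V' W'"
    and L: "gross R = lat u v w" "gross R' = lat u' v' w'"
    and d: "qdet u v w \<noteq> 0" "qdet u' v' w' \<noteq> 0"
    and g: "gram_match a b u v w u' v' w'"
  shows "ring_iso_orders a b R R'"
proof -
  have "(of_int a * of_int b * qdet u v w)\<^sup>2 = (of_int a * of_int b * qdet u' v' w')\<^sup>2"
    using g unfolding qip_gram_det[symmetric] gram_match_def by simp
  then have "(qdet u' v' w')\<^sup>2 = (qdet u v w)\<^sup>2" using ab by (simp add: power_mult_distrib)
  then consider "qdet u' v' w' = qdet u v w" | "qdet u' v' w' = - qdet u v w" by (auto simp: power2_eq_iff)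
  then show ?thesis
  proof cases
    case 1
    then show ?thesis by (rule oriented_isometry_ring_iso[OF ab R R' L d(1) _ g])
  next
    case 2
    have m: "qscale (of_int (-1)) x = - x" for x by (rule quat_eqI) simp_all
    have "gross R' = lat (- u') (- v') (- w')"
      using lat_signs[of "-1" "-1" "-1" u' v' w'] L(2) unfolding m by simp
    moreover have "qdet (- u') (- v') (- w') = qdet u v w"
    proof -
      have "qdet (- u') (- v') (- w') = - qdet u' v' w'" by (simp add: qdet_def algebra_simps)
      then show ?thesis using 2 by simp
    qed
    moreover have "gram_match a b u v w (- u') (- v') (- w')"
      using g by (simp add: gram_match_def qip_linear)
    ultimately show ?thesis using oriented_isometry_ring_iso[OF ab R R' L(1) _ d(1)] by blast
  qed
qed

text \<open>Discriminant 1 would give a ternary lattice of determinant 4 with all nonzero norms at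
  least 3, which \<open>rdata_ne_1\<close> excludes.\<close>

lemma gross_lattice_maximal_order:
  assumes p: "prime p" "is_Bp p a b" and R: "is_maximal_order a b R" and g: "good_basis a b R i j k A B C U V W"
  shows "gross_lattice a b (gross R) (int p)"
proof -
  have ab: "a < 0" "b < 0" using p by (auto simp: is_Bp_def ramified_infty_def)
  have ord: "is_order a b R" using R by (simp add: is_maximal_order_def)
  have L: "gross_lattice a b (gross R) \<bar>tdisc A B C U V W\<bar>" by (rule gross_is_gross_lattice[OF ab ord g])
  have "\<bar>tdisc A B C U V W\<bar> \<noteq> 1"
  proof
    assume one: "\<bar>tdisc A B C U V W\<bar> = 1"
    obtain u v w where red: "reduced_basis a b (gross R) u v w" using gross_lattice.reduced_basis_exists[OF L] by blast
    obtain D1 D2 D3 x y z where "rdata \<bar>tdisc A B C U V W\<bar> D1 D2 D3 x y z"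
      by (rule gross_lattice.reduced_basis_rdata[OF L red])
    then show False using rdata_ne_1 unfolding one by blast
  qed
  then show ?thesis using maximal_order_disc[OF p(2) R g p(1)] L by auto
qed

theorem theorem1p2:
  fixes p :: nat and a b :: int and R R' :: "quat set"
  assumes "prime p"
    and "is_Bp p a b"
    and "is_maximal_order a b R"
    and "is_maximal_order a b R'"
    and "theta a b R = theta a b R'"
  shows "ring_iso_orders a b R R'"
proof -
  have ab: "a < 0" "b < 0" using assms(2) by (auto simp: is_Bp_def ramified_infty_def)
  have ord: "is_order a b R" "is_order a b R'" using assms(3,4) by (auto simp: is_maximal_order_def)
  obtain i j k A B C U V W where g: "good_basis a b R i j k A B C U V W"
    by (rule order_good_basis[OF ab ord(1)])
  obtain i' j' k' A' B' C' U' V' W' where g': "good_basis a b R' i' j' k' A' B' C' U' V' W'"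
    by (rule order_good_basis[OF ab ord(2)])
  have p: "prime (int p)" using assms(1) by simp
  have L: "gross_lattice a b (gross R) (int p)" and L': "gross_lattice a b (gross R') (int p)"
    using gross_lattice_maximal_order assms g g' by blast+
  define r where "r D = card {v \<in> gross R. qip a b v v = of_int D}" for D :: int
  define r' where "r' D = card {v \<in> gross R'. qip a b v v = of_int D}" for D :: int
  have theta: "(\<Sum>t\<in>{- 2 * int n..2 * int n}. r (4 * int n - t\<^sup>2)) = (\<Sum>t\<in>{- 2 * int n..2 * int n}. r' (4 * int n - t\<^sup>2))" for n
  proof -
    have "card {x \<in> R. qnorm a b x = of_nat n} = card {x \<in> R'. qnorm a b x = of_nat n}"
      using arg_cong[OF assms(5), of "\<lambda>f. fps_nth f n"] by (simp add: theta_def)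
    then show ?thesis
      unfolding theta_coefficient[OF ab ord(1) g] theta_coefficient[OF ab ord(2) g'] r_def r'_def .
  qed
  have count: "r D = r' D" if "D < int p" for D
  proof (rule equal_theta_counts[OF _ _ _ _ _ _ theta that])
    show "r D = r' D" if "D < 0 \<or> \<not> (4 dvd D \<or> 4 dvd D + 1)" for D
      unfolding r_def r'_def gross_lattice.count_zero[OF L that] gross_lattice.count_zero[OF L' that] ..
    show "r 0 = r' 0"
      unfolding r_def r'_def gross_lattice.count_0[OF L] gross_lattice.count_0[OF L'] ..
    show "even (r D)" "even (r' D)" if "D > 0" for D
      unfolding r_def r'_def
      using gross_lattice.count_even[OF L that] gross_lattice.count_even[OF L' that] by blast+
    show "r (4 * n) \<le> 2" "r' (4 * n) \<le> 2" if "n > 0" "4 * n \<le> int p" for n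
      unfolding r_def r'_def
      using gross_lattice.count_le_2[OF L p that] gross_lattice.count_le_2[OF L' p that] by blast+
  qed
  obtain u v w u' v' w' where "gross R = lat u v w" "gross R' = lat u' v' w'" "qdet u v w \<noteq> 0" "qdet u' v' w' \<noteq> 0"
    "gram_match a b u v w u' v' w'"
    by (rule equal_counts_gram_match[OF L L' p count[unfolded r_def r'_def]])
  then show ?thesis by (rule isometry_ring_iso[OF ab ord(1) g ord(2) g'])
qed

end
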